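(* Let $(\phi_1,\dots,\phi_n)$, $n\ge2$, be a Chebyshev asymptotic scale on $[T,x_0[$ with $\phi_i\in AC^{n-1}[T,x_0[$, and let $f\in AC^{n-1}[T,x_0[$. (I) The following are equivalent: (i) there is $a_1\in\mathbb R$ with $L_k[f(x)]=a_1L_k[\phi_1(x)]+o(L_k[\phi_1(x)])$ as $x\to x_0^-$ for all $0\le k\le n-1$; (ii) there is $a_1\in\mathbb R$ with $L_{n-1}[f(x)]=a_1b_1+o(1)$ as $x\to x_0^-$; (iii) the improper integral $\int_T^{x_0}\frac{L[f](t)}{p_n(t)}dt$ converges. The constants $a_1$ in (i) and (ii) coincide, and under (iii) $$L_{n-1}[f(x)]=a_1b_1-\int_x^{x_0}\frac{L[f](t)}{p_n(t)}dt,\quad x\in[T,x_0[ .$$ (II) Fix $i\in\{2,\dots,n\}$. The following are equivalent: (iv) there are $a_1,\dots,a_i\in\mathbb R$ such that, as $x\to x_0^-$, $L_k[f(x)]=\sum_{j=1}^{i}a_jL_k[\phi_j(x)]+o(L_k[\phi_i(x)])$ for $0\le k\le n-i$, and $L_{n-i+h}[f(x)]=\sum_{j=1}^{i-h}a_jL_{n-i+h}[\phi_j(x)]+o(1)$ for $0\le h\le i-1$; (v) there are $a_1,\dots,a_i\in\mathbb R$ such that the second group of relations in (iv) holds for $0\le h\le i-1$; (vi) the iterated improper integral $$\int_T^{x_0}\frac{dt_{n-i+1}}{p_{n-i+1}(t_{n-i+1})}\int_{t_{n-i+1}}^{x_0}\frac{dt_{n-i+2}}{p_{n-i+2}(t_{n-i+2})}\cdots\int_{t_{n-2}}^{x_0}\frac{dt_{n-1}}{p_{n-1}(t_{n-1})}\int_{t_{n-1}}^{x_0}\frac{L[f](t)}{p_n(t)}dt$$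 (with $i$ iterated integrations) converges. The constants $a_j$ in (iv) and (v) are the same, and under (vi), for all $x\in[T,x_0[$, $$L_{n-i}[f(x)]=\sum_{j=1}^ia_jL_{n-i}[\phi_j(x)]+(-1)^i\int_x^{x_0}\frac{dt_{n-i+1}}{p_{n-i+1}(t_{n-i+1})}\int_{t_{n-i+1}}^{x_0}\cdots\int_{t_{n-2}}^{x_0}\frac{dt_{n-1}}{p_{n-1}(t_{n-1})}\int_{t_{n-1}}^{x_0}\frac{L[f](t)}{p_n(t)}dt.$$
   Context: $T\in\mathbb R$, $x_0\in\mathbb R\cup\{+\infty\}$, $T<x_0$. $AC^k(I)$: functions whose $k$-th derivative is absolutely continuous on every compact subinterval of $I$. $W(\cdot)$ is the Wronskian; $g\gg h$ as $x\to x_0^-$ means $h/g\to0$; Landau symbols refer to $x\to x_0^-$. A Chebyshev asymptotic scale on $[T,x_0[$: real $\phi_i\in C^{n-1}[T,x_0[$, each nonzero on a left deleted neighbourhood of $x_0$, $\phi_1\gg\dots\gg\phi_n$ as $x\to x_0^-$, $W(\phi_1,\dots,\phi_i)\neq0$ on $[T,x_0[$ ($1\le i\le n$). $Lu:=W(\phi_1,\dots,\phi_n,u)/W(\phi_1,\dots,\phi_n)$, defined a.e. and locally integrable for $u\in AC^{n-1}[T,x_0[$. With $\widetilde W_i:=W(\phi_n,\phi_{n-1},\dots,\phi_{n-i+1})$, $\widetilde W_0:=1$ (nonvanishing on $[T,x_0[$): $p_0:=1/|\phi_n|$, $p_i:=\widetilde W_i^2/|\widetilde W_{i-1}\widetilde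 W_{i+1}|$ ($1\le i\le n-1$), $p_n:=|\widetilde W_n/\widetilde W_{n-1}|$. Operators $L_0u:=p_0u$, $L_ku:=p_k(L_{k-1}u)'$ ($1\le k\le n$). $P_{n-1}(x):=\frac1{p_0(x)}\int_T^x\frac{dt_1}{p_1}\int_T^{t_1}\frac{dt_2}{p_2}\cdots\int_T^{t_{n-2}}\frac{dt_{n-1}}{p_{n-1}}$, and $b_1:=\lim_{x\to x_0^-}\phi_1(x)/P_{n-1}(x)$, which exists and is nonzero (one has $L_{n-1}[\phi_1]\equiv b_1$). Integrals $\int^{x_0}$ are improper; an iterated improper integral converges if all inner improper integrals converge and the outermost one converges. *)

theory Defs
  imports "HOL-Analysis.Analysis" "HOL-Library.Landau_Symbols"
begin

definition lnbhd :: "ereal \<Rightarrow> real filter" where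
  "lnbhd x0 = (if x0 = \<infinity> then at_top else at_left (real_of_ereal x0))"

definition Ivl :: "real \<Rightarrow> ereal \<Rightarrow> real set" where
  "Ivl T x0 = {x. T \<le> x \<and> ereal x < x0}"

fun hder :: "real set \<Rightarrow> nat \<Rightarrow> (real \<Rightarrow> real) \<Rightarrow> real \<Rightarrow> real" where
  "hder S 0 g = g"
| "hder S (Suc k) g = (\<lambda>x. vector_derivative (hder S k g) (at x within S))"

definition wronsk :: "real set \<Rightarrow> (real \<Rightarrow> real) list \<Rightarrow> real \<Rightarrow> real" where
  "wronsk S gs x = (\<Sum>p | p permutes {..<length gs}.
      of_int (sign p) * (\<Prod>j<length gs. hder S (p j) (gs ! j) x))"

definition abs_cont_on :: "real \<Rightarrow> real \<Rightarrow> (real \<Rightarrow> real) \<Rightarrow> bool" where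
  "abs_cont_on a b g \<longleftrightarrow> (\<forall>\<epsilon>>0. \<exists>\<delta>>0. \<forall>(m::nat) u v.
      (\<forall>k<m. a \<le> u k \<and> u k \<le> v k \<and> v k \<le> b) \<and>
      (\<forall>k<m. \<forall>l<m. k \<noteq> l \<longrightarrow> v k \<le> u l \<or> v l \<le> u k) \<and>
      (\<Sum>k<m. v k - u k) < \<delta> \<longrightarrow> (\<Sum>k<m. \<bar>g (v k) - g (u k)\<bar>) < \<epsilon>)"

definition Ck :: "real set \<Rightarrow> nat \<Rightarrow> (real \<Rightarrow> real) \<Rightarrow> bool" where
  "Ck S k g \<longleftrightarrow> (\<forall>j<k. \<forall>x\<in>S. (hder S j g has_real_derivative hder S (Suc j) g x) (at x within S))
      \<and> continuous_on S (hder S k g)"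

definition ACk :: "real set \<Rightarrow> nat \<Rightarrow> (real \<Rightarrow> real) \<Rightarrow> bool" where
  "ACk S k g \<longleftrightarrow> (\<forall>j<k. \<forall>x\<in>S. (hder S j g has_real_derivative hder S (Suc j) g x) (at x within S))
      \<and> (\<forall>a b. {a..b} \<subseteq> S \<longrightarrow> abs_cont_on a b (hder S k g))"

definition cheb_scale :: "real \<Rightarrow> ereal \<Rightarrow> nat \<Rightarrow> (nat \<Rightarrow> real \<Rightarrow> real) \<Rightarrow> bool" where
  "cheb_scale T x0 n phi \<longleftrightarrow>
     (\<forall>i\<in>{1..n}. Ck (Ivl T x0) (n - 1) (phi i) \<and> eventually (\<lambda>x. phi i x \<noteq> 0) (lnbhd x0)) \<and>
     (\<forall>i\<in>{1..<n}. ((\<lambda>x. phi (Suc i) x / phi i x) \<longlongrightarrow> 0) (lnbhd x0)) \<and>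
     (\<forall>i\<in>{1..n}. \<forall>x\<in>Ivl T x0. wronsk (Ivl T x0) (map phi [1..<Suc i]) x \<noteq> 0)"

text \<open>Reversed Wronskians W(phi_n, phi_(n-1), ..., phi_(n-i+1)); equal to 1 for i = 0.\<close>
definition Wt :: "real \<Rightarrow> ereal \<Rightarrow> nat \<Rightarrow> (nat \<Rightarrow> real \<Rightarrow> real) \<Rightarrow> nat \<Rightarrow> real \<Rightarrow> real" where
  "Wt T x0 n phi i = wronsk (Ivl T x0) (map phi (rev [n - i + 1..<n + 1]))"

definition pp :: "real \<Rightarrow> ereal \<Rightarrow> nat \<Rightarrow> (nat \<Rightarrow> real \<Rightarrow> real) \<Rightarrow> nat \<Rightarrow> real \<Rightarrow> real" where
  "pp T x0 n phi k x =
     (if k = 0 then 1 / \<bar>phi n x\<bar>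
      else if k < n then (Wt T x0 n phi k x)\<^sup>2 / \<bar>Wt T x0 n phi (k - 1) x * Wt T x0 n phi (k + 1) x\<bar>
      else \<bar>Wt T x0 n phi n x / Wt T x0 n phi (n - 1) x\<bar>)"

fun Lk :: "real \<Rightarrow> ereal \<Rightarrow> nat \<Rightarrow> (nat \<Rightarrow> real \<Rightarrow> real) \<Rightarrow> nat \<Rightarrow> (real \<Rightarrow> real) \<Rightarrow> real \<Rightarrow> real" where
  "Lk T x0 n phi 0 u = (\<lambda>x. pp T x0 n phi 0 x * u x)"
| "Lk T x0 n phi (Suc k) u =
     (\<lambda>x. pp T x0 n phi (Suc k) x * vector_derivative (Lk T x0 n phi k u) (at x within Ivl T x0))"

definition LL :: "real \<Rightarrow> ereal \<Rightarrow> nat \<Rightarrow> (nat \<Rightarrow> real \<Rightarrow> real) \<Rightarrow> (real \<Rightarrow> real) \<Rightarrow> real \<Rightarrow> real" where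
  "LL T x0 n phi u x =
     wronsk (Ivl T x0) (map phi [1..<n + 1] @ [u]) x / wronsk (Ivl T x0) (map phi [1..<n + 1]) x"

definition imp_conv :: "real \<Rightarrow> ereal \<Rightarrow> (real \<Rightarrow> real) \<Rightarrow> bool" where
  "imp_conv a x0 g \<longleftrightarrow> (\<forall>y. a \<le> y \<and> ereal y < x0 \<longrightarrow> g integrable_on {a..y}) \<and>
     (\<exists>l. ((\<lambda>y. integral {a..y} g) \<longlongrightarrow> l) (lnbhd x0))"

definition imp_int :: "real \<Rightarrow> ereal \<Rightarrow> (real \<Rightarrow> real) \<Rightarrow> real" where
  "imp_int a x0 g = Lim (lnbhd x0) (\<lambda>y. integral {a..y} g)"

text \<open>Integrands of the iterated improper integral:
  itg 0 = L[f]/p_n,  itg (m+1) s = (1/p_(n-m-1)(s)) * int_s^x0 itg m.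
  The i-fold iterated integral in (vi) is int_T^x0 itg (i-1).\<close>
fun itg :: "real \<Rightarrow> ereal \<Rightarrow> nat \<Rightarrow> (nat \<Rightarrow> real \<Rightarrow> real) \<Rightarrow> (real \<Rightarrow> real) \<Rightarrow> nat \<Rightarrow> real \<Rightarrow> real" where
  "itg T x0 n phi f 0 = (\<lambda>t. LL T x0 n phi f t / pp T x0 n phi n t)"
| "itg T x0 n phi f (Suc m) =
     (\<lambda>s. (1 / pp T x0 n phi (n - Suc m) s) * imp_int s x0 (itg T x0 n phi f m))"

definition iter_conv :: "real \<Rightarrow> ereal \<Rightarrow> nat \<Rightarrow> (nat \<Rightarrow> real \<Rightarrow> real) \<Rightarrow> (real \<Rightarrow> real) \<Rightarrow> nat \<Rightarrow> bool" where
  "iter_conv T x0 n phi f i \<longleftrightarrow>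
     (\<forall>k. k + 1 < i \<longrightarrow> (\<forall>s\<in>Ivl T x0. imp_conv s x0 (itg T x0 n phi f k))) \<and>
     imp_conv T x0 (itg T x0 n phi f (i - 1))"

text \<open>P_(n-1)(x) = (1/p_0(x)) int_T^x dt_1/p_1 ... int_T^(t_(n-2)) dt_(n-1)/p_(n-1).\<close>
fun Rr :: "real \<Rightarrow> ereal \<Rightarrow> nat \<Rightarrow> (nat \<Rightarrow> real \<Rightarrow> real) \<Rightarrow> nat \<Rightarrow> real \<Rightarrow> real" where
  "Rr T x0 n phi 0 = (\<lambda>t. 1)"
| "Rr T x0 n phi (Suc m) = (\<lambda>t. integral {T..t} (\<lambda>s. Rr T x0 n phi m s / pp T x0 n phi (n - 1 - m) s))"

definition Pn1 :: "real \<Rightarrow> ereal \<Rightarrow> nat \<Rightarrow> (nat \<Rightarrow> real \<Rightarrow> real) \<Rightarrow> real \<Rightarrow> real" where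
  "Pn1 T x0 n phi x = Rr T x0 n phi (n - 1) x / pp T x0 n phi 0 x"

definition b1 :: "real \<Rightarrow> ereal \<Rightarrow> nat \<Rightarrow> (nat \<Rightarrow> real \<Rightarrow> real) \<Rightarrow> real" where
  "b1 T x0 n phi = Lim (lnbhd x0) (\<lambda>x. phi 1 x / Pn1 T x0 n phi x)"

end

theory Submission
  imports Defs "Jordan_Normal_Form.Determinant"
begin

text \<open>
  Dividing by \<open>h\<close> and differentiating, \<open>g \<mapsto> (g/h)'\<close>, turns \<open>W(h, g\<^sub>1, \<dots>, g\<^sub>m)\<close> into
  \<open>h\<^bsup>m+1\<^esup> W((g\<^sub>1/h)', \<dots>, (g\<^sub>m/h)')\<close>. Starting from \<open>\<phi>\<^sub>1\<close>, this reduction preserves the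
  Chebyshev property, and Rolle's theorem shows that nontrivial combinations of the \<open>\<phi>\<^sub>i\<close> do not
  vanish near \<open>x\<^sub>0\<close>; hence ratios of such combinations and of their reductions have limits, and
  l'Hospital's rule shows that the reduction also preserves the relation \<open>\<phi>\<^sub>1 \<ggreater> \<phi>\<^sub>2 \<ggreater> \<dots>\<close>.
  It follows that \<open>W(\<phi>\<^sub>1, \<dots>, \<phi>\<^sub>i, \<phi>\<^sub>n)\<close> never vanishes, so that one may equally well reduce by the
  last function \<open>\<phi>\<^sub>n\<close>. Iterating the latter gives nonvanishing functions \<open>q\<^sub>0, \<dots>, q\<^sub>n\<^sub>-\<^sub>1\<close> with
  \<open>p\<^sub>k = 1/\<bar>q\<^sub>k\<bar>\<close> for \<open>k < n\<close> and \<open>p\<^sub>n = \<bar>q\<^sub>0 \<cdots> q\<^sub>n\<^sub>-\<^sub>1\<bar>\<close>; up to a constant sign \<open>L\<^sub>k u\<close> is the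
  \<open>k\<close>-fold reduction of \<open>u\<close> divided by \<open>q\<^sub>k\<close>. Thus \<open>L\<^sub>k \<phi>\<^sub>j\<close> is unbounded, constantly \<open>\<plusminus>1\<close> or zero
  according as \<open>j < n - k\<close>, \<open>j = n - k\<close> or \<open>j > n - k\<close>.

  For the residual \<open>r = f - \<Sum>j. a\<^sub>j \<phi>\<^sub>j\<close> one has \<open>(L\<^sub>k\<^sub>-\<^sub>1 r)' = L\<^sub>k r / p\<^sub>k\<close> for \<open>k < n\<close> and
  \<open>(L\<^sub>n\<^sub>-\<^sub>1 r)' = L[f] / p\<^sub>n\<close> almost everywhere, the latter by Lebesgue's theorem for absolutely
  continuous functions. The iterated integrals therefore successively recover the functions
  \<open>\<plusminus>L\<^sub>k r\<close>, the limits at each stage determining the \<open>a\<^sub>j\<close>, and l'Hospital's rule in the form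
  \<open>\<infinity>/\<infinity>\<close> carries the estimate at level \<open>n - i\<close> down to all smaller levels.
\<close>

section \<open>Monotone functions are differentiable almost everywhere\<close>

text \<open>The top level shapes the proof. The (n-1)-st derivatives are merely absolutely
  continuous on compact intervals, so \<open>LL\<close> is built from genuine n-th derivatives only
  off a null set; elsewhere \<open>vector_derivative\<close> has an uncontrolled value. Wronskian
  identities are therefore proved one point at a time, demanding the highest derivative there only,
  while the divisors must be nonzero on the whole interval. The quotient calculus is set up over an
  abstract class of admissible top derivatives and used twice, with local absolute continuity and
  with differentiability at a point. Using l'Hospital's rule backwards, from G/H to G'/H', is
  legitimate because G' - c H' is itself a nontrivial combination and so keeps its sign near the end
  point for every c; the wrong sign contradicts G = o(H). The truncated sums in the expansions do no
  harm: L_k phi_j vanishes identically for j > n - k, so one residual with all i terms serves every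
  level.\<close>

lemma Vitali_intervals:
  fixes E :: "real set" and K :: "(real \<times> real) set"
  assumes K: "\<And>u v. (u,v) \<in> K \<Longrightarrow> u < v"
    and cov: "\<And>x d. x \<in> E \<Longrightarrow> 0 < d \<Longrightarrow> \<exists>u v. (u,v) \<in> K \<and> u \<le> x \<and> x \<le> v \<and> v - u < d"
  obtains C where "countable C" "C \<subseteq> K"
    "pairwise (\<lambda>I J. disjnt {fst I..snd I} {fst J..snd J}) C"
    "negligible (E - (\<Union>I\<in>C. {fst I..snd I}))"
proof -
  let ?a = "\<lambda>I::real\<times>real. (fst I + snd I) / 2" and ?r = "\<lambda>I::real\<times>real. (snd I - fst I) / 2"
  have cb: "cball (?a I) (?r I) = {fst I..snd I}" for I
    by (auto simp: cball_eq_atLeastAtMost field_simps)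
  obtain C where "countable C" "C \<subseteq> K"
     "pairwise (\<lambda>i j. disjnt (cball (?a i) (?r i)) (cball (?a j) (?r j))) C"
     "negligible (E - (\<Union>i \<in> C. cball (?a i) (?r i)))"
  proof (rule Vitali_covering_theorem_cballs[of K ?r E ?a])
    show "0 < ?r I" if "I \<in> K" for I using K[of "fst I" "snd I"] that by simp
    show "\<exists>I. I \<in> K \<and> x \<in> cball (?a I) (?r I) \<and> ?r I < d" if x: "x \<in> E" and d: "0 < d" for x d
    proof -
      obtain u v where "(u,v) \<in> K" "u \<le> x" "x \<le> v" "v - u < d" using cov[OF x d] by blast
      then show ?thesis unfolding cb by (intro exI[of _ "(u,v)"]) auto
    qed
  qed blast
  then show ?thesis using that unfolding cb by blast
qed

text \<open>Index sets vary: natural numbers for absolute continuity, pairs of end points in Vitali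
  covers, tagged intervals in gauge sums. Touching is allowed, but a degenerate interval may not sit
  inside another one.\<close>

definition nonoverlap :: "'i set \<Rightarrow> ('i \<Rightarrow> real) \<Rightarrow> ('i \<Rightarrow> real) \<Rightarrow> bool" where
  "nonoverlap A u v \<longleftrightarrow> (\<forall>i\<in>A. u i \<le> v i) \<and> (\<forall>i\<in>A. \<forall>j\<in>A. i \<noteq> j \<longrightarrow> v i \<le> u j \<or> v j \<le> u i)"

lemma nonoverlap_subset: "nonoverlap A u v \<Longrightarrow> B \<subseteq> A \<Longrightarrow> nonoverlap B u v"
  by (simp add: nonoverlap_def subset_iff)

lemma mono_sum_nonoverlap:
  fixes F :: "real \<Rightarrow> real"
  assumes "finite A" and "mono_on {a..b} F" and "nonoverlap A u v" 
    and "\<And>i. i \<in> A \<Longrightarrow> a \<le> u i \<and> v i \<le> b" and "a \<le> b"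
  shows "(\<Sum>i\<in>A. F (v i) - F (u i)) \<le> F b - F a"
  using assms
proof (induction A arbitrary: a b rule: finite_psubset_induct)
  case (psubset A)
  show ?case
  proof (cases "A = {}")
    case True
    then show ?thesis using psubset.prems by (auto dest: mono_onD)
  next
    case False
    then obtain i where i: "i \<in> A" by blast
    define L where "L = {j\<in>A - {i}. v j \<le> u i}"
    \<comment> \<open>Negating the condition of \<open>L\<close> keeps the two parts disjoint even
      for a degenerate interval that lies on both sides.\<close>
    define R where "R = {j\<in>A - {i}. \<not> v j \<le> u i}"
    have ui: "a \<le> u i" "u i \<le> v i" "v i \<le> b"
      using psubset.prems i by (auto simp: nonoverlap_def)
    have R: "v i \<le> u j" if "j \<in> R" for j
      using psubset.prems(2) that i unfolding R_def nonoverlap_def by blast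
    have ss: "L \<subset> A" "R \<subset> A" using i by (auto simp: L_def R_def)
    have "(\<Sum>i\<in>L. F (v i) - F (u i)) \<le> F (u i) - F a"
    proof (rule psubset.IH[OF ss(1)])
      show "mono_on {a..u i} F" by (rule mono_on_subset[OF psubset.prems(1)]) (use ui in auto)
      show "nonoverlap L u v" using psubset.prems(2) ss nonoverlap_subset by blast
      show "a \<le> u j \<and> v j \<le> u i" if "j \<in> L" for j using psubset.prems(3)[of j] that by (auto simp: L_def)
    qed (use ui in auto)
    moreover have "(\<Sum>i\<in>R. F (v i) - F (u i)) \<le> F b - F (v i)"
    proof (rule psubset.IH[OF ss(2)])
      show "mono_on {v i..b} F" by (rule mono_on_subset[OF psubset.prems(1)]) (use ui in auto)
      show "nonoverlap R u v" using psubset.prems(2) ss nonoverlap_subset by blast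
      show "v i \<le> u j \<and> v j \<le> b" if "j \<in> R" for j using psubset.prems(3)[of j] R[OF that] that by (auto simp: R_def)
    qed (use ui in auto)
    moreover have "(\<Sum>j\<in>A. F (v j) - F (u j)) = F (v i) - F (u i) + ((\<Sum>j\<in>L. F (v j) - F (u j)) + (\<Sum>j\<in>R. F (v j) - F (u j)))"
    proof -
      have "A - {i} = L \<union> R" "L \<inter> R = {}" by (auto simp: L_def R_def)
      moreover have "finite L" "finite R" using psubset.hyps by (auto simp: L_def R_def)
      ultimately have "(\<Sum>j\<in>A - {i}. F (v j) - F (u j)) = (\<Sum>j\<in>L. F (v j) - F (u j)) + (\<Sum>j\<in>R. F (v j) - F (u j))"
        by (simp add: sum.union_disjoint)
      then show ?thesis using sum.remove[OF psubset.hyps(1) i, of "\<lambda>j. F (v j) - F (u j)"] by simp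
    qed
    ultimately show ?thesis by linarith
  qed
qed

abbreviation straddle :: "real \<Rightarrow> real \<Rightarrow> real \<Rightarrow> real \<Rightarrow> bool" where
  "straddle x e u v \<equiv> u < v \<and> u \<le> x \<and> x \<le> v \<and> v - u < e"

text \<open>Disjoint steep intervals selected by Vitali carry an increment of at least \<beta> times
  their length, while monotonicity caps the total increment by B. The family \<I> localises the
  increments: it is a single interval for unbounded slopes and a Vitali family of flat intervals for
  oscillating ones. As E need not be measurable, the bound concerns a measurable superset.\<close>

lemma steep_cover_measure:
  fixes F :: "real \<Rightarrow> real" and \<I> :: "(real \<times> real) set"
  assumes "\<beta> > 0"
    and mono: "\<And>I. I \<in> \<I> \<Longrightarrow> fst I \<le> snd I \<and> mono_on {fst I..snd I} F"
    and EI: "E \<subseteq> (\<Union>I\<in>\<I>. {fst I<..<snd I})"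
    and steep: "\<And>x d. x \<in> E \<Longrightarrow> 0 < d \<Longrightarrow> \<exists>u v. straddle x d u v \<and> F v - F u \<ge> \<beta> * (v - u)"
    and bound: "\<And>\<J>. finite \<J> \<Longrightarrow> \<J> \<subseteq> \<I> \<Longrightarrow> (\<Sum>I\<in>\<J>. F (snd I) - F (fst I)) \<le> B"
  obtains A where "A \<in> lmeasurable" "E \<subseteq> A" "measure lebesgue A \<le> B / \<beta>"
proof -
  define K where "K = {(u,v). u < v \<and> F v - F u \<ge> \<beta> * (v - u) \<and> (\<exists>I\<in>\<I>. fst I < u \<and> v < snd I)}"
  have cov: "\<exists>u v. (u,v) \<in> K \<and> u \<le> x \<and> x \<le> v \<and> v - u < d" if x: "x \<in> E" and d: "0 < d" for x d
  proof -
    obtain I where I: "I \<in> \<I>" "fst I < x" "x < snd I" using EI x by auto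
    define d' where "d' = min d (min (x - fst I) (snd I - x))"
    have "d' > 0" using I d by (auto simp: d'_def)
    then obtain u v where uv: "u < v" "u \<le> x" "x \<le> v" "v - u < d'" "F v - F u \<ge> \<beta> * (v - u)" 
      using steep[OF x] by blast
    then have "fst I < u" "v < snd I" "v - u < d" by (auto simp: d'_def)
    with uv I show ?thesis unfolding K_def by blast
  qed
  have Klt: "u < v" if "(u,v) \<in> K" for u v using that by (auto simp: K_def)
  obtain C where C: "countable C" "C \<subseteq> K"
    "pairwise (\<lambda>I J. disjnt {fst I..snd I} {fst J..snd J}) C"
    "negligible (E - (\<Union>I\<in>C. {fst I..snd I}))"
    by (rule Vitali_intervals[OF Klt cov])
  have K12: "fst J < snd J" "F (snd J) - F (fst J) \<ge> \<beta> * (snd J - fst J)" 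
    and K3: "\<exists>I\<in>\<I>. fst I < fst J \<and> snd J < snd I" if "J \<in> K" for J
    using that unfolding K_def by (cases J; simp)+
  define U where "U = (\<Union>I\<in>C. {fst I..snd I})"
  have fin: "measure lebesgue (\<Union>I\<in>D. {fst I..snd I}) \<le> B / \<beta>" if D: "D \<subseteq> C" "finite D" for D
  proof -
    have DK: "J \<in> K" if "J \<in> D" for J using C(2) D that by blast
    \<comment> \<open>Each selected interval is assigned to one member of \<I> around it, so that
      increments can be summed member by member.\<close>
    have "\<forall>J\<in>D. \<exists>I. I \<in> \<I> \<and> fst I < fst J \<and> snd J < snd I"
      using K3 DK by blast
    then obtain h where h: "\<And>J. J \<in> D \<Longrightarrow> h J \<in> \<I> \<and> fst (h J) < fst J \<and> snd J < snd (h J)"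
      by (drule_tac bchoice) blast
    have KD: "fst J < snd J" "F (snd J) - F (fst J) \<ge> \<beta> * (snd J - fst J)" if "J \<in> D" for J
      using K12 DK that by blast+
    have "measure lebesgue (\<Union>I\<in>D. {fst I..snd I}) \<le> (\<Sum>I\<in>D. measure lebesgue {fst I..snd I})"
      by (rule measure_UNION_le) (use D in auto)
    also have "\<dots> = (\<Sum>I\<in>D. snd I - fst I)"
      by (rule sum.cong) (use KD in \<open>auto simp: less_imp_le\<close>)
    finally have "\<beta> * measure lebesgue (\<Union>I\<in>D. {fst I..snd I}) \<le> \<beta> * (\<Sum>I\<in>D. snd I - fst I)"
      using \<open>\<beta> > 0\<close> by (simp add: mult_left_mono)
    also have "\<dots> = (\<Sum>I\<in>D. \<beta> * (snd I - fst I))" by (simp add: sum_distrib_left)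
    also have "\<dots> \<le> (\<Sum>I\<in>D. F (snd I) - F (fst I))" by (rule sum_mono) (use KD in auto)
    also have "\<dots> = (\<Sum>I\<in>h ` D. \<Sum>J\<in>{J\<in>D. h J = I}. F (snd J) - F (fst J))"
      by (rule sum.image_gen[OF D(2)])
    also have "\<dots> \<le> (\<Sum>I\<in>h ` D. F (snd I) - F (fst I))"
    proof (rule sum_mono)
      fix I assume I: "I \<in> h ` D"
      have "I \<in> \<I>" using I h by blast
      show "(\<Sum>J\<in>{J\<in>D. h J = I}. F (snd J) - F (fst J)) \<le> F (snd I) - F (fst I)"
      proof (rule mono_sum_nonoverlap[where F=F and u=fst and v=snd])
        have "snd J \<le> fst J' \<or> snd J' \<le> fst J" if "J \<in> D" "J' \<in> D" "J \<noteq> J'" for J J'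
        proof -
          have "disjnt {fst J..snd J} {fst J'..snd J'}" using C(3) that D unfolding pairwise_def by blast
          moreover have "max (fst J) (fst J') \<in> {fst J..snd J} \<inter> {fst J'..snd J'}"
            if "\<not> (snd J \<le> fst J' \<or> snd J' \<le> fst J)"
            using KD(1)[OF \<open>J \<in> D\<close>] KD(1)[OF \<open>J' \<in> D\<close>] that by simp
          ultimately show ?thesis unfolding disjnt_def by blast
        qed
        then show "nonoverlap {J\<in>D. h J = I} fst snd"
          using KD(1) unfolding nonoverlap_def by (simp add: less_imp_le)
        show "fst I \<le> fst J \<and> snd J \<le> snd I" if "J \<in> {J\<in>D. h J = I}" for J
          using h[of J] that by (simp add: less_imp_le)
        show "finite {J \<in> D. h J = I}" using D by simp
        show "mono_on {fst I..snd I} F" "fst I \<le> snd I" using mono[OF \<open>I \<in> \<I>\<close>] by blast+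
      qed
    qed
    also have "\<dots> \<le> B" by (rule bound) (use D h in blast)+
    finally show ?thesis using \<open>\<beta> > 0\<close> by (simp add: field_simps)
  qed
  have Um: "U \<in> lmeasurable" "measure lebesgue U \<le> B / \<beta>"
  proof -
    show "U \<in> lmeasurable" unfolding U_def
      by (rule fmeasurable_UN_bound[OF C(1), where B="B/\<beta>"]) (use fin in blast | simp)+
    show "measure lebesgue U \<le> B / \<beta>" unfolding U_def
      by (rule measure_UN_bound[OF C(1), where B="B/\<beta>"]) (use fin in blast | simp)+
  qed
  show ?thesis
  proof (rule that[of "U \<union> (E - U)"])
    have neg: "negligible (E - U)" using C(4) by (simp add: U_def)
    show "U \<union> (E - U) \<in> lmeasurable"
      by (rule fmeasurable.Un[OF Um(1) negligible_imp_measurable[OF neg]])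
    have "measure lebesgue (U \<union> (E - U)) \<le> measure lebesgue U + measure lebesgue (E - U)"
      using Um(1) negligible_imp_measurable[OF neg] by (intro measure_Un_le) auto
    then show "measure lebesgue (U \<union> (E - U)) \<le> B / \<beta>"
      using Um(2) negligible_imp_measure0[OF neg] by linarith
  qed blast
qed

lemma nonoverlap_measure:
  assumes "finite A" "nonoverlap A u v" "\<And>i. i \<in> A \<Longrightarrow> {u i<..<v i} \<subseteq> U" "U \<in> lmeasurable"
  shows "(\<Sum>i\<in>A. v i - u i) \<le> measure lebesgue U"
proof -
  have "(\<Sum>i\<in>A. v i - u i) = (\<Sum>i\<in>A. measure lebesgue {u i<..<v i})"
    by (rule sum.cong) (use assms(2) in \<open>auto simp: nonoverlap_def\<close>)
  also have "\<dots> = measure lebesgue (\<Union>i\<in>A. {u i<..<v i})"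
  proof (rule measure_UNION'[symmetric])
    show "pairwise (\<lambda>i j. disjnt {u i<..<v i} {u j<..<v j}) A"
    proof (rule pairwiseI)
      fix i j assume "i \<in> A" "j \<in> A" "i \<noteq> j"
      then have "v i \<le> u j \<or> v j \<le> u i" using assms(2) unfolding nonoverlap_def by blast
      then show "disjnt {u i<..<v i} {u j<..<v j}" by (auto simp: disjnt_def)
    qed
  qed (use assms in auto)
  also have "\<dots> \<le> measure lebesgue U"
    by (rule measure_mono_fmeasurable) (use assms in \<open>auto intro!: sets.finite_UN\<close>)
  finally show ?thesis .
qed

lemma open_outer_approx:
  assumes "A \<in> lmeasurable" "\<eta> > 0"
  obtains T where "open T" "A \<subseteq> T" "T \<in> lmeasurable" "measure lebesgue T \<le> measure lebesgue A + \<eta>"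
proof -
  obtain T where T: "open T" "A \<subseteq> T" "(T - A) \<in> lmeasurable" "emeasure lebesgue (T - A) < ennreal \<eta>"
    using sets_lebesgue_outer_open[of A \<eta>] assms by blast
  have eq: "T = A \<union> (T - A)" using T(2) by blast
  have m: "T \<in> lmeasurable" by (subst eq) (rule fmeasurable.Un[OF assms(1) T(3)])
  have "measure lebesgue (T - A) \<le> \<eta>"
    using T(4) assms(2) by (simp add: Sigma_Algebra.measure_def enn2real_leI less_imp_le)
  moreover have "measure lebesgue T \<le> measure lebesgue A + measure lebesgue (T - A)"
    by (subst eq) (rule measure_Un_le; use assms T in auto)
  ultimately show ?thesis using that[OF T(1,2) m] by linarith
qed

text \<open>Slopes over straddling intervals give one lower and one upper derivate in place of the
  four Dini derivates, and the intervals themselves form the Vitali covers.\<close>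

definition Lower_set :: "(real \<Rightarrow> real) \<Rightarrow> real \<Rightarrow> real set" where
  "Lower_set F \<alpha> = {x. \<forall>e>0. \<exists>u v. straddle x e u v \<and> F v - F u \<le> \<alpha> * (v - u)}"

definition Upper_set :: "(real \<Rightarrow> real) \<Rightarrow> real \<Rightarrow> real set" where
  "Upper_set F \<beta> = {x. \<forall>e>0. \<exists>u v. straddle x e u v \<and> F v - F u \<ge> \<beta> * (v - u)}"

lemma countable_imp_negligible: "countable (S :: real set) \<Longrightarrow> negligible S"
  unfolding negligible_iff_null_sets by (rule null_sets_completionI[OF countable_imp_null_set_lborel])

text \<open>Two covers are nested. In an open set of measure at most x + \<eta>, flat intervals
  cover almost all of the set and have total increment at most \<alpha> (x + \<eta>); steep
  intervals inside them then bound its outer measure by \<alpha> (x + \<eta>) / \<beta>. For the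
  outer measure m this gives \<beta> m \<le> \<alpha> m, hence m = 0.\<close>

lemma negligible_oscillating_slopes:
  fixes F :: "real \<Rightarrow> real"
  assumes F: "mono_on {c..d} F" and \<alpha>\<beta>: "0 < \<alpha>" "\<alpha> < \<beta>"
  shows "negligible ({c<..<d} \<inter> Lower_set F \<alpha> \<inter> Upper_set F \<beta>)" (is "negligible ?E")
proof -
  \<comment> \<open>The set is not known to be measurable, so its outer measure enters as
    \<open>Inf M\<close>.\<close>
  define M where "M = {measure lebesgue A | A. A \<in> lmeasurable \<and> ?E \<subseteq> A}"
  have M0: "x \<ge> 0" if "x \<in> M" for x using that by (auto simp: M_def)
  have bdd: "bdd_below M" by (rule bdd_belowI[of _ 0]) (rule M0)
  have Mne: "M \<noteq> {}" unfolding M_def by (auto intro!: exI[of _ "{c<..<d}"])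
  have claim: "\<beta> * Inf M \<le> \<alpha> * (x + \<eta>)" if x: "x \<in> M" and \<eta>: "\<eta> > 0" for x \<eta>
  proof -
    obtain A where A: "A \<in> lmeasurable" "?E \<subseteq> A" "x = measure lebesgue A" using x by (auto simp: M_def)
    obtain T0 where T0: "open T0" "A \<subseteq> T0" "T0 \<in> lmeasurable" "measure lebesgue T0 \<le> measure lebesgue A + \<eta>"
      using open_outer_approx[OF A(1) \<eta>] by blast
    define T where "T = T0 \<inter> {c<..<d}"
    have T: "open T" "?E \<subseteq> T" using T0 A by (auto simp: T_def)
    define K where "K = {(u,v). u < v \<and> F v - F u \<le> \<alpha> * (v - u) \<and> {u..v} \<subseteq> T}"
    have cov: "\<exists>u v. (u,v) \<in> K \<and> u \<le> z \<and> z \<le> v \<and> v - u < e" if z: "z \<in> ?E" and e: "0 < e" for z e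
    proof -
      obtain r where r: "r > 0" "ball z r \<subseteq> T" using T z open_contains_ball by blast
      have "z \<in> Lower_set F \<alpha>" "min e r > 0" using z e r by auto
      then obtain u v where uv: "u < v" "u \<le> z" "z \<le> v" "v - u < min e r" "F v - F u \<le> \<alpha> * (v - u)"
        unfolding Lower_set_def by blast
      then have "{u..v} \<subseteq> ball z r" by (auto simp: dist_real_def)
      with uv r show ?thesis unfolding K_def by auto
    qed
    have Klt: "u < v" if "(u,v) \<in> K" for u v using that by (simp add: K_def)
    have K: "fst I < snd I" "F (snd I) - F (fst I) \<le> \<alpha> * (snd I - fst I)" "{fst I..snd I} \<subseteq> T" if "I \<in> K" for I
      using that unfolding K_def by (cases I; simp)+
    obtain C where C: "countable C" "C \<subseteq> K"
      "pairwise (\<lambda>I J. disjnt {fst I..snd I} {fst J..snd J}) C"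
      "negligible (?E - (\<Union>I\<in>C. {fst I..snd I}))"
      by (rule Vitali_intervals[OF Klt cov])
    \<comment> \<open>The second cover needs room inside open flat intervals; only the countably
      many end points and a null set are lost.\<close>
    define E' where "E' = ?E \<inter> (\<Union>I\<in>C. {fst I<..<snd I})"
    have neg: "negligible (?E - E')"
    proof (rule negligible_subset)
      show "negligible ((?E - (\<Union>I\<in>C. {fst I..snd I})) \<union> (fst ` C \<union> snd ` C))"
        using C by (intro negligible_Un C(4) countable_imp_negligible countable_Un countable_image)
      have "x \<in> {fst I<..<snd I} \<or> x \<in> fst ` C \<union> snd ` C" if "x \<in> {fst I..snd I}" "I \<in> C" for x I
        proof -
        have "x = fst I \<or> x = snd I \<or> (fst I < x \<and> x < snd I)" using that(1) by auto
        then show ?thesis using that(2) by (metis UnI1 UnI2 greaterThanLessThan_iff image_eqI)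
      qed
      then show "?E - E' \<subseteq> (?E - (\<Union>I\<in>C. {fst I..snd I})) \<union> (fst ` C \<union> snd ` C)"
        unfolding E'_def by blast
    qed
    obtain A' where A': "A' \<in> lmeasurable" "E' \<subseteq> A'" "measure lebesgue A' \<le> (\<alpha> * (x + \<eta>)) / \<beta>"
    proof (rule steep_cover_measure[of \<beta> C F E' "\<alpha> * (x + \<eta>)"])
      show "\<beta> > 0" using \<alpha>\<beta> by simp
      show "fst I \<le> snd I \<and> mono_on {fst I..snd I} F" if "I \<in> C" for I
      proof -
        have "I \<in> K" using that C by blast
        note K[OF this]
        moreover have "T \<subseteq> {c..d}" by (auto simp: T_def)
        ultimately show ?thesis using mono_on_subset[OF F] by (metis less_imp_le subset_trans)
      qed
      show "E' \<subseteq> (\<Union>I\<in>C. {fst I<..<snd I})" by (auto simp: E'_def)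
      show "\<exists>u v. straddle z e u v \<and> F v - F u \<ge> \<beta> * (v - u)" if "z \<in> E'" "0 < e" for z e
        using that unfolding E'_def Upper_set_def by blast
      show "(\<Sum>I\<in>J. F (snd I) - F (fst I)) \<le> \<alpha> * (x + \<eta>)" if J: "finite J" "J \<subseteq> C" for J
      proof -
        have "(\<Sum>I\<in>J. F (snd I) - F (fst I)) \<le> (\<Sum>I\<in>J. \<alpha> * (snd I - fst I))"
          by (rule sum_mono) (use K C J in blast)
        also have "\<dots> = \<alpha> * (\<Sum>I\<in>J. snd I - fst I)" by (simp add: sum_distrib_left)
        also have "\<dots> = \<alpha> * (\<Sum>I\<in>J. measure lebesgue {fst I..snd I})"
          by (intro arg_cong[of _ _ "(*) \<alpha>"] sum.cong refl) (use K(1) C J in \<open>fastforce simp: less_imp_le\<close>)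
        also have "(\<Sum>I\<in>J. measure lebesgue {fst I..snd I}) = measure lebesgue (\<Union>I\<in>J. {fst I..snd I})"
          by (rule measure_UNION'[symmetric]) (use J pairwise_subset[OF C(3)] in auto)
        also have "\<dots> \<le> measure lebesgue T0"
        proof (rule measure_mono_fmeasurable)
          show "(\<Union>I\<in>J. {fst I..snd I}) \<subseteq> T0" using K(3) C(2) J unfolding T_def by blast
        qed (use T0 J in auto)
        also have "\<dots> \<le> x + \<eta>" using T0 A by simp
        finally show ?thesis using \<alpha>\<beta> by (simp add: mult_left_mono)
      qed
    qed
    have "measure lebesgue (A' \<union> (?E - E')) \<in> M"
      unfolding M_def using A' negligible_imp_measurable[OF neg] by blast
    then have "Inf M \<le> measure lebesgue (A' \<union> (?E - E'))" by (rule cInf_lower[OF _ bdd])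
    also have "\<dots> \<le> measure lebesgue A' + measure lebesgue (?E - E')"
      using A' negligible_imp_measurable[OF neg] by (intro measure_Un_le) auto
    also have "\<dots> \<le> (\<alpha> * (x + \<eta>)) / \<beta>" using A' negligible_imp_measure0[OF neg] by linarith
    finally show ?thesis using \<alpha>\<beta> by (simp add: field_simps)
  qed
  have "\<beta> * Inf M / \<alpha> \<le> x" if "x \<in> M" for x
  proof (rule field_le_epsilon)
    fix \<eta> :: real assume "\<eta> > 0"
    from claim[OF that this] show "\<beta> * Inf M / \<alpha> \<le> x + \<eta>" using \<alpha>\<beta> by (simp add: field_simps)
  qed
  then have "\<beta> * Inf M / \<alpha> \<le> Inf M" using Mne by (intro cInf_greatest)
  then have "(\<beta> - \<alpha>) * Inf M \<le> 0" using \<alpha>\<beta> by (simp add: field_simps)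
  then have I0: "Inf M \<le> 0" using \<alpha>\<beta> by (simp add: mult_le_0_iff)
  show ?thesis unfolding negligible_outer
  proof (intro allI impI)
    fix e :: real assume "e > 0"
    then have "Inf M < e" using I0 by simp
    then obtain x where "x \<in> M" "x < e" using cInf_lessD[OF Mne] by blast
    then show "\<exists>A. ?E \<subseteq> A \<and> A \<in> lmeasurable \<and> measure lebesgue A < e" unfolding M_def by blast
  qed
qed

text \<open>For each k the outer measure is at most the total increment divided by k + 1.\<close>

lemma negligible_unbounded_slopes:
  fixes F :: "real \<Rightarrow> real"
  assumes F: "mono_on {c..d} F"
  shows "negligible ({c<..<d} \<inter> (\<Inter>k::nat. Upper_set F (real (Suc k))))" (is "negligible ?E")
proof (cases "c < d")
  case cd: True
  show ?thesis unfolding negligible_outer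
  proof (intro allI impI)
    fix e :: real assume e: "e > 0"
    obtain k :: nat where k: "real k > (F d - F c) / e" using reals_Archimedean2 by blast
    obtain A where A: "A \<in> lmeasurable" "?E \<subseteq> A" "measure lebesgue A \<le> (F d - F c) / real (Suc k)"
    proof (rule steep_cover_measure[of "real (Suc k)" "{(c,d)}" F ?E "F d - F c"])
      show "\<exists>u v. straddle z e u v \<and> F v - F u \<ge> real (Suc k) * (v - u)"
        if z: "z \<in> ?E" and "0 < e" for z e
      proof -
        have "z \<in> Upper_set F (real (Suc k))" using z by blast
        then show ?thesis using \<open>0 < e\<close> unfolding Upper_set_def by blast
      qed
      show "(\<Sum>I\<in>J. F (snd I) - F (fst I)) \<le> F d - F c" if "J \<subseteq> {(c, d)}" for J
      proof -
        have "J = {} \<or> J = {(c,d)}" using that by blast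
        then show ?thesis using mono_onD[OF F, of c d] cd by auto
      qed
    qed (use F cd in auto)
    have "F d - F c < e * real (Suc k)" using k e by (simp add: field_simps)
    then have "(F d - F c) / real (Suc k) < e" by (simp add: divide_less_eq)
    with A show "\<exists>A. ?E \<subseteq> A \<and> A \<in> lmeasurable \<and> measure lebesgue A < e" by (meson le_less_trans)
  qed
next
  case False
  then have "{c<..<d} = {}" by auto
  then show ?thesis by (simp only: Int_empty_left negligible_empty)
qed

text \<open>The derivative is the upper derivate L, the infimum of all \<beta> that bound the short
  straddling slopes. If slopes kept falling below L - \<epsilon>, two rationals placed between L -
  \<epsilon> and L would contradict \<open>osc\<close>.\<close>

lemma mono_differentiable_point:
  fixes F :: "real \<Rightarrow> real"
  assumes F: "mono_on {c..d} F" and x: "c < x" "x < d"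
    and bnd: "x \<notin> Upper_set F \<gamma>"
    and osc: "\<And>\<alpha> \<beta>. \<alpha> \<in> \<rat> \<Longrightarrow> \<beta> \<in> \<rat> \<Longrightarrow> 0 < \<alpha> \<Longrightarrow> \<alpha> < \<beta> \<Longrightarrow> x \<notin> Lower_set F \<alpha> \<inter> Upper_set F \<beta>"
  shows "F differentiable (at x)"
proof -
  define P where "P e \<beta> \<longleftrightarrow> (\<forall>u v. straddle x e u v \<longrightarrow> F v - F u \<le> \<beta> * (v - u))" for e \<beta>
  define Bs where "Bs = {\<beta>. \<exists>e>0. P e \<beta>}"
  have not_Upper: "\<beta> \<in> Bs" if "x \<notin> Upper_set F \<beta>" for \<beta>
    using that unfolding Upper_set_def Bs_def P_def mem_Collect_eq by (meson not_le less_imp_le)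
  have \<gamma>: "\<gamma> \<in> Bs" by (rule not_Upper[OF bnd])
  define r where "r = min (x - c) (d - x)"
  have r: "r > 0" using x by (simp add: r_def)
  have inc: "F v - F u \<ge> 0" if "u < v" "u \<le> x" "x \<le> v" "v - u < r" for u v
    using that mono_onD[OF F, of u v] by (auto simp: r_def)
  have Bs0: "\<beta> \<ge> 0" if b: "\<beta> \<in> Bs" for \<beta>
  proof -
    obtain e where e: "e > 0" "P e \<beta>" using b unfolding Bs_def by blast
    define v where "v = x + min e r / 2"
    have v: "x < v" "v - x < e" "v - x < r" using e r by (auto simp: v_def min_def)
    have "0 \<le> \<beta> * (v - x)" using inc[of x v] e(2)[unfolded P_def, rule_format, of x v] v by linarith
    then show ?thesis using v by (simp add: zero_le_mult_iff)
  qed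
  define L where "L = Inf Bs"
  have bdd: "bdd_below Bs" by (rule bdd_belowI[of _ 0]) (rule Bs0)
  have est: "\<exists>e>0. \<forall>u v. straddle x e u v \<longrightarrow> \<bar>F v - F u - L * (v - u)\<bar> \<le> \<epsilon> * (v - u)"
    if \<epsilon>: "\<epsilon> > 0" for \<epsilon>
  proof -
    have "Inf Bs < L + \<epsilon>" using \<epsilon> by (simp add: L_def)
    then obtain \<beta> where \<beta>: "\<beta> \<in> Bs" "\<beta> < L + \<epsilon>" using cInf_lessD[of Bs] \<gamma> by blast
    then obtain e1 where e1: "e1 > 0" "P e1 \<beta>"
      unfolding Bs_def by blast
    obtain e2 where e2: "e2 > 0" "\<forall>u v. straddle x e2 u v \<longrightarrow> F v - F u \<ge> (L - \<epsilon>) * (v - u)"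
    \<comment> \<open>The rationals in \<open>osc\<close> must be positive; for L - \<epsilon> \<le>
      0 monotonicity alone gives the lower bound.\<close>
    proof (cases "L - \<epsilon> \<le> 0")
      case True
      have "F v - F u \<ge> (L - \<epsilon>) * (v - u)" if "u < v" "u \<le> x" "x \<le> v" "v - u < r" for u v
      proof -
        have "(L - \<epsilon>) * (v - u) \<le> 0" using True that by (simp add: mult_nonpos_nonneg)
        then show ?thesis using inc[OF that] by linarith
      qed
      then show ?thesis using that r by blast
    next
      case False
      obtain \<beta>' where b': "\<beta>' \<in> \<rat>" "L - \<epsilon> < \<beta>'" "\<beta>' < L" using Rats_dense_in_real[of "L - \<epsilon>" L] \<epsilon> by auto
      obtain \<alpha> where a: "\<alpha> \<in> \<rat>" "L - \<epsilon> < \<alpha>" "\<alpha> < \<beta>'" using Rats_dense_in_real[OF b'(2)] by auto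
      have "\<beta>' \<notin> Bs" using cInf_lower[OF _ bdd, of \<beta>'] b' unfolding L_def by force
      then have "x \<in> Upper_set F \<beta>'" using not_Upper by blast
      then have "x \<notin> Lower_set F \<alpha>" using osc[OF a(1) b'(1)] a False by auto
      then obtain e where e: "e > 0" "\<forall>u v. straddle x e u v \<longrightarrow> F v - F u > \<alpha> * (v - u)"
        unfolding Lower_set_def mem_Collect_eq by (meson not_le)
      show ?thesis
      proof (rule that[OF e(1)], intro allI impI)
        fix u v assume uv: "straddle x e u v"
        have "(L - \<epsilon>) * (v - u) \<le> \<alpha> * (v - u)" using a uv by (intro mult_right_mono) auto
        then show "F v - F u \<ge> (L - \<epsilon>) * (v - u)" using e(2)[rule_format, OF uv] by linarith
      qed
    qed
    show ?thesis
    proof (intro exI[of _ "min e1 e2"] conjI allI impI)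
      show "min e1 e2 > 0" using e1 e2 by simp
      fix u v assume uv: "straddle x (min e1 e2) u v"
      have "\<beta> * (v - u) \<le> (L + \<epsilon>) * (v - u)" using \<beta> uv by (intro mult_right_mono) auto
      then show "\<bar>F v - F u - L * (v - u)\<bar> \<le> \<epsilon> * (v - u)"
        using e1(2)[unfolded P_def, rule_format, of u v] e2(2)[rule_format, of u v] uv by (auto simp: algebra_simps abs_le_iff)
    qed
  qed
  have "(F has_real_derivative L) (at x)"
    unfolding has_field_derivative_def has_derivative_at_alt
  proof (intro conjI allI impI)
    show "bounded_linear ((*) L)" by (rule bounded_linear_mult_right)
    fix \<epsilon> :: real assume "\<epsilon> > 0"
    then obtain e where e: "e > 0" "\<And>u v. u < v \<Longrightarrow> u \<le> x \<Longrightarrow> x \<le> v \<Longrightarrow> v - u < e \<Longrightarrow> \<bar>F v - F u - L * (v - u)\<bar> \<le> \<epsilon> * (v - u)"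
      using est by meson
    show "\<exists>d>0. \<forall>y. norm (y - x) < d \<longrightarrow> norm (F y - F x - L * (y - x)) \<le> \<epsilon> * norm (y - x)"
    proof (intro exI[of _ e] conjI allI impI e(1))
      fix y assume y: "norm (y - x) < e"
      consider "y < x" | "y = x" | "x < y" by linarith
      then show "norm (F y - F x - L * (y - x)) \<le> \<epsilon> * norm (y - x)"
      proof cases
        case 1
        then show ?thesis using e(2)[of y x] y by (auto simp: algebra_simps abs_le_iff)
      next
        case 3
        then show ?thesis using e(2)[of x y] y by auto
      qed simp
    qed
  qed
  then show ?thesis using real_differentiable_def by blast
qed

theorem mono_differentiable_ae:
  fixes F :: "real \<Rightarrow> real"
  assumes F: "mono_on {c..d} F"
  shows "negligible {x \<in> {c<..<d}. \<not> F differentiable (at x)}"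
proof (rule negligible_subset)
  let ?Q = "{(\<alpha>,\<beta>). \<alpha> \<in> \<rat> \<and> \<beta> \<in> \<rat> \<and> 0 < \<alpha> \<and> \<alpha> < (\<beta>::real)}"
  let ?N = "\<lambda>q. {c<..<d} \<inter> Lower_set F (fst q) \<inter> Upper_set F (snd q)"
  have "countable ?Q"
    by (rule countable_subset[of _ "\<rat> \<times> \<rat>"]) (auto intro: countable_SIGMA countable_rat)
  then have "negligible (\<Union>(?N ` ?Q))"
    by (intro negligible_countable_Union) (auto intro!: negligible_oscillating_slopes[OF F])
  then show "negligible (({c<..<d} \<inter> (\<Inter>k::nat. Upper_set F (real (Suc k)))) \<union> \<Union>(?N ` ?Q))"
    using negligible_unbounded_slopes[OF F] by (rule negligible_Un[rotated])
  show "{x \<in> {c<..<d}. \<not> F differentiable (at x)}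
      \<subseteq> ({c<..<d} \<inter> (\<Inter>k::nat. Upper_set F (real (Suc k)))) \<union> \<Union>(?N ` ?Q)"
  proof (rule subsetI, rule ccontr)
    fix x assume x: "x \<in> {x \<in> {c<..<d}. \<not> F differentiable (at x)}"
      and n: "x \<notin> ({c<..<d} \<inter> (\<Inter>k::nat. Upper_set F (real (Suc k)))) \<union> \<Union>(?N ` ?Q)"
    from x n obtain k :: nat where k: "x \<notin> Upper_set F (real (Suc k))" by blast
    have "x \<notin> Lower_set F \<alpha> \<inter> Upper_set F \<beta>" if "\<alpha> \<in> \<rat>" "\<beta> \<in> \<rat>" "0 < \<alpha>" "\<alpha> < \<beta>" for \<alpha> \<beta>
    proof -
      have "(\<alpha>,\<beta>) \<in> ?Q" using that by simp
      then have "x \<notin> ?N (\<alpha>,\<beta>)" using n by blast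
      then show ?thesis using x by simp
    qed
    then have "F differentiable (at x)"
      using mono_differentiable_point[OF F _ _ k] x by simp
    with x show False by simp
  qed
qed


section \<open>Absolutely continuous functions\<close>

definition controls :: "real \<Rightarrow> real \<Rightarrow> (real \<Rightarrow> real) \<Rightarrow> real \<Rightarrow> real \<Rightarrow> 'i set \<Rightarrow> bool" where
  "controls a b g \<delta> \<epsilon> A \<longleftrightarrow> (\<forall>u v. nonoverlap A u v \<longrightarrow> (\<forall>i\<in>A. a \<le> u i \<and> v i \<le> b) \<longrightarrow>
     (\<Sum>i\<in>A. v i - u i) < \<delta> \<longrightarrow> (\<Sum>i\<in>A. \<bar>g (v i) - g (u i)\<bar>) < \<epsilon>)"

lemma controlsD:
  "controls a b g \<delta> \<epsilon> A \<Longrightarrow> nonoverlap A u v \<Longrightarrow> (\<And>i. i \<in> A \<Longrightarrow> a \<le> u i \<and> v i \<le> b)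
    \<Longrightarrow> (\<Sum>i\<in>A. v i - u i) < \<delta> \<Longrightarrow> (\<Sum>i\<in>A. \<bar>g (v i) - g (u i)\<bar>) < \<epsilon>"
  by (simp add: controls_def)

lemma abs_cont_on_iff_controls:
  "abs_cont_on a b g \<longleftrightarrow> (\<forall>\<epsilon>>0. \<exists>\<delta>>0. \<forall>m::nat. controls a b g \<delta> \<epsilon> {..<m})"
proof -
  have "controls a b g \<delta> \<epsilon> {..<m} \<longleftrightarrow> (\<forall>u v.
      (\<forall>k<m. a \<le> u k \<and> u k \<le> v k \<and> v k \<le> b) \<and>
      (\<forall>k<m. \<forall>l<m. k \<noteq> l \<longrightarrow> v k \<le> u l \<or> v l \<le> u k) \<and>
      (\<Sum>k<m. v k - u k) < \<delta> \<longrightarrow> (\<Sum>k<m. \<bar>g (v k) - g (u k)\<bar>) < \<epsilon>)" for \<delta> \<epsilon> and m :: nat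
    unfolding controls_def nonoverlap_def by (intro all_cong1) auto
  then show ?thesis unfolding abs_cont_on_def by simp
qed

text \<open>The definition speaks of families indexed by initial segments of the naturals; a
  bijection carries the same \<delta> over to any finite index set.\<close>

lemma abs_cont_onE:
  assumes "abs_cont_on a b g" "\<epsilon> > 0"
  obtains \<delta> where "\<delta> > 0" "\<And>A :: 'i set. finite A \<Longrightarrow> controls a b g \<delta> \<epsilon> A"
proof -
  obtain \<delta> where \<delta>: "\<delta> > 0" and *: "\<And>m::nat. controls a b g \<delta> \<epsilon> {..<m}"
    using assms unfolding abs_cont_on_iff_controls by blast
  show ?thesis
  proof (rule that[OF \<delta>])
    fix A :: "'i set" assume A: "finite A"
    obtain h where h: "bij_betw h {..<card A} A"
      using ex_bij_betw_nat_finite[OF A] by (auto simp: atLeast0LessThan)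
    have hA: "h k \<in> A" if "k < card A" for k using h that by (auto simp: bij_betw_def)
    have hinj: "h k = h l \<longleftrightarrow> k = l" if "k < card A" "l < card A" for k l
      using h that by (auto simp: bij_betw_def inj_on_def)
    show "controls a b g \<delta> \<epsilon> A" unfolding controls_def
    proof (intro allI impI)
      fix u v assume no: "nonoverlap A u v" and ab: "\<forall>i\<in>A. a \<le> u i \<and> v i \<le> b" and less: "(\<Sum>i\<in>A. v i - u i) < \<delta>"
      have "(\<Sum>k<card A. \<bar>g (v (h k)) - g (u (h k))\<bar>) < \<epsilon>"
      proof (rule controlsD[OF *, where u="\<lambda>k. u (h k)" and v="\<lambda>k. v (h k)"])
        show "nonoverlap {..<card A} (\<lambda>k. u (h k)) (\<lambda>k. v (h k))" using no hA hinj by (simp add: nonoverlap_def)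
        show "(\<Sum>k<card A. v (h k) - u (h k)) < \<delta>"
          using less sum.reindex_bij_betw[OF h, of "\<lambda>i. v i - u i"] by simp
      qed (use ab hA in auto)
      then show "(\<Sum>i\<in>A. \<bar>g (v i) - g (u i)\<bar>) < \<epsilon>"
        using sum.reindex_bij_betw[OF h, of "\<lambda>i. \<bar>g (v i) - g (u i)\<bar>"] by simp
    qed
  qed
qed

text \<open>Jordan's decomposition. V is the variation from c, a supremum over finite families of
  intervals; adding [x,y] to a family on [c,x] raises its sum by |g y - g x|, so both V and V - g
  increase.\<close>

lemma abs_cont_on_short_mono_diff:
  fixes g :: "real \<Rightarrow> real"
  assumes bnd: "\<And>(A :: nat set) u v. finite A \<Longrightarrow> nonoverlap A u v \<Longrightarrow> (\<And>i. i \<in> A \<Longrightarrow> c \<le> u i \<and> v i \<le> d)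
      \<Longrightarrow> (\<Sum>i\<in>A. \<bar>g (v i) - g (u i)\<bar>) \<le> B"
  obtains V where "mono_on {c..d} V" "mono_on {c..d} (\<lambda>x. V x - g x)"
proof -
  define Vs where "Vs x = {(\<Sum>i\<in>A. \<bar>g (v i) - g (u i)\<bar>) | (A :: nat set) u v.
      finite A \<and> nonoverlap A u v \<and> (\<forall>i\<in>A. c \<le> u i \<and> v i \<le> x)}" for x
  define V where "V x = Sup (Vs x)" for x
  have Vs_le: "s \<le> B" if "s \<in> Vs x" "x \<le> d" for s x
  proof -
    obtain A :: "nat set" and u v where *: "s = (\<Sum>i\<in>A. \<bar>g (v i) - g (u i)\<bar>)" "finite A" "nonoverlap A u v"
      "\<forall>i\<in>A. c \<le> u i \<and> v i \<le> x" using \<open>s \<in> Vs x\<close> unfolding Vs_def by blast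
    show ?thesis unfolding *(1)
      by (rule bnd[OF *(2,3)]) (use *(4) \<open>x \<le> d\<close> in force)
  qed
  have Vs_ne: "Vs x \<noteq> {}" for x
    unfolding Vs_def by (auto intro!: exI[of _ "{}"] simp: nonoverlap_def)
  have step: "V x + \<bar>g y - g x\<bar> \<le> V y" if xy: "c \<le> x" "x \<le> y" "y \<le> d" for x y
  proof -
    have "s + \<bar>g y - g x\<bar> \<le> V y" if s: "s \<in> Vs x" for s
    proof -
      obtain A :: "nat set" and u v where A: "s = (\<Sum>i\<in>A. \<bar>g (v i) - g (u i)\<bar>)" "finite A" "nonoverlap A u v"
        "\<forall>i\<in>A. c \<le> u i \<and> v i \<le> x" using s unfolding Vs_def by blast
      obtain n :: nat where n: "n \<notin> A" using ex_new_if_finite[OF infinite_UNIV_nat A(2)] by blast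
      define u' where "u' = u(n := x)"
      define v' where "v' = v(n := y)"
      have eq: "(\<Sum>i\<in>insert n A. \<bar>g (v' i) - g (u' i)\<bar>) = s + \<bar>g y - g x\<bar>"
      proof -
        have "(\<Sum>i\<in>A. \<bar>g (v' i) - g (u' i)\<bar>) = s"
          unfolding A(1) by (rule sum.cong) (use n in \<open>auto simp: u'_def v'_def\<close>)
        then show ?thesis using A(2) n by (simp add: u'_def v'_def)
      qed
      have "nonoverlap (insert n A) u' v'"
        using A(3,4) xy n by (auto simp: nonoverlap_def u'_def v'_def)
      moreover have "\<forall>i\<in>insert n A. c \<le> u' i \<and> v' i \<le> y"
        using A(4) xy n by (force simp: u'_def v'_def)
      ultimately have "s + \<bar>g y - g x\<bar> \<in> Vs y"
        unfolding Vs_def eq[symmetric] using A(2) by blast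
      then show ?thesis unfolding V_def
        by (rule cSup_upper) (auto intro: bdd_aboveI[of _ B] Vs_le[OF _ xy(3)])
    qed
    then have "s \<le> V y - \<bar>g y - g x\<bar>" if "s \<in> Vs x" for s using that by fastforce
    then have "V x \<le> V y - \<bar>g y - g x\<bar>" unfolding V_def[of x] by (rule cSup_least[OF Vs_ne])
    then show ?thesis by linarith
  qed
  show ?thesis
  proof (rule that[of V])
    show "mono_on {c..d} V"
    proof (rule mono_onI)
      fix x y assume "x \<in> {c..d}" "y \<in> {c..d}" "x \<le> y"
      then show "V x \<le> V y" using step[of x y] by auto
    qed
    show "mono_on {c..d} (\<lambda>x. V x - g x)"
    proof (rule mono_onI)
      fix x y assume "x \<in> {c..d}" "y \<in> {c..d}" "x \<le> y"
      then show "V x - g x \<le> V y - g y" using step[of x y] by auto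
    qed
  qed
qed

text \<open>For \<epsilon> = 1, every interval shorter than \<delta> has variation at most 1, so the
  Jordan decomposition reduces the claim there to monotone functions; countably many short rational
  intervals cover the rest.\<close>

theorem abs_cont_on_differentiable_ae:
  fixes g :: "real \<Rightarrow> real"
  assumes g: "abs_cont_on a b g"
  shows "negligible {x \<in> {a<..<b}. \<not> g differentiable (at x)}"
proof -
  obtain \<delta> where \<delta>: "\<delta> > 0" and
    *: "\<And>A :: nat set. finite A \<Longrightarrow> controls a b g \<delta> 1 A"
    by (rule abs_cont_onE[OF g, of 1, where 'i=nat]) (simp, blast)
  have short: "negligible {x \<in> {c<..<d}. \<not> g differentiable (at x)}"
    if cd: "a \<le> c" "c \<le> d" "d \<le> b" "d - c < \<delta>" for c d
  proof -
    have "(\<Sum>i\<in>A. \<bar>g (v i) - g (u i)\<bar>) \<le> 1"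
      if A: "finite A" "nonoverlap A u v" "\<And>i. i \<in> A \<Longrightarrow> c \<le> u i \<and> v i \<le> d" for A :: "nat set" and u v
    proof -
      \<comment> \<open>The identity, taken as the monotone function, bounds the total length of the
        family by d - c.\<close>
      have "(\<Sum>i\<in>A. id (v i) - id (u i)) \<le> id d - id c"
        by (rule mono_sum_nonoverlap[where F=id and u=u and v=v]) (use A cd in \<open>auto intro: mono_onI\<close>)
      then have "(\<Sum>i\<in>A. v i - u i) < \<delta>" using cd by simp
      moreover have "a \<le> u i \<and> v i \<le> b" if "i \<in> A" for i using A(3)[OF that] cd by simp
      ultimately show ?thesis using controlsD[OF *[OF A(1)] A(2)] by (simp add: less_imp_le)
    qed
    then obtain V where V: "mono_on {c..d} V" "mono_on {c..d} (\<lambda>x. V x - g x)"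
      by (rule abs_cont_on_short_mono_diff)
    have sub: "g differentiable (at x)" if "V differentiable (at x)" "(\<lambda>x. V x - g x) differentiable (at x)" for x
    proof -
      have "(\<lambda>x. V x - (V x - g x)) differentiable (at x)" using that by (rule differentiable_diff)
      then show ?thesis by simp
    qed
    show ?thesis
      by (rule negligible_subset[OF negligible_Un[OF mono_differentiable_ae[OF V(1)] mono_differentiable_ae[OF V(2)]]])
        (use sub in blast)
  qed
  let ?Q = "{(c,d). c \<in> \<rat> \<and> d \<in> \<rat> \<and> a \<le> c \<and> c \<le> d \<and> d \<le> b \<and> d - c < \<delta>}"
  let ?N = "\<lambda>q. {x \<in> {fst q<..<snd q}. \<not> g differentiable (at x)}"
  have "countable ?Q"
    by (rule countable_subset[of _ "\<rat> \<times> \<rat>"]) (auto intro: countable_SIGMA countable_rat)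
  then have "negligible (\<Union>(?N ` ?Q))"
    by (intro negligible_countable_Union) (auto intro!: short[simplified])
  then show ?thesis
  proof (rule negligible_subset)
    show "{x \<in> {a<..<b}. \<not> g differentiable (at x)} \<subseteq> \<Union>(?N ` ?Q)"
    proof
      fix x assume x: "x \<in> {x \<in> {a<..<b}. \<not> g differentiable (at x)}"
      obtain c where c: "c \<in> \<rat>" "max a (x - \<delta>/2) < c" "c < x"
        using Rats_dense_in_real[of "max a (x - \<delta>/2)" x] x \<delta> by auto
      obtain d where d: "d \<in> \<rat>" "x < d" "d < min b (x + \<delta>/2)"
        using Rats_dense_in_real[of x "min b (x + \<delta>/2)"] x \<delta> by auto
      have "(c,d) \<in> ?Q" using c d by auto
      moreover have "x \<in> ?N (c,d)" using c d x by simp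
      ultimately show "x \<in> \<Union>(?N ` ?Q)" by blast
    qed
  qed
qed

text \<open>The gauge is a straddle-lemma gauge off the exceptional set \<open>E\<close>; on \<open>E\<close> it confines the
  intervals to an open set so small that absolute continuity makes their contribution negligible.\<close>

theorem abs_cont_on_FTC:
  fixes g :: "real \<Rightarrow> real"
  assumes g: "abs_cont_on a b g" and ab: "a \<le> b" and E: "negligible E"
    and der: "\<And>x. x \<in> {a..b} - E \<Longrightarrow> (g has_real_derivative g' x) (at x within {a..b})"
  shows "(g' has_integral (g b - g a)) {a..b}"
proof -
  \<comment> \<open>Resetting g' to 0 on E removes its uncontrolled values: a term tagged in E then
    contributes only an increment of g.\<close>
  define h where "h x = (if x \<in> E then 0 else g' x)" for x
  have "(h has_integral (g b - g a)) {a..b}"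
    unfolding has_integral_real
  proof (intro allI impI)
    fix e :: real assume e: "e > 0"
    define \<epsilon> where "\<epsilon> = e / (2 * (b - a + 1))"
    have \<epsilon>: "\<epsilon> > 0" "\<epsilon> * (b - a) < e / 2" using e ab by (auto simp: \<epsilon>_def field_simps)
    obtain \<delta> where \<delta>: "\<delta> > 0" and
      small: "\<And>A :: (real \<times> real set) set. finite A \<Longrightarrow> controls a b g \<delta> (e / 2) A"
      by (rule abs_cont_onE[OF g half_gt_zero[OF e], where 'i="real \<times> real set"]) blast
    obtain U where U: "open U" "E \<subseteq> U" "U \<in> lmeasurable" "measure lebesgue U < \<delta>"
    proof -
      obtain T where "open T" "E \<subseteq> T" "T \<in> lmeasurable" "measure lebesgue T \<le> measure lebesgue E + \<delta>/2"
        using open_outer_approx[OF negligible_imp_measurable[OF E], of "\<delta>/2"] \<delta> by auto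
      then show ?thesis using that \<delta> negligible_imp_measure0[OF E] by force
    qed
    have "\<exists>r>0. (x \<in> E \<longrightarrow> ball x r \<subseteq> U) \<and> (x \<in> {a..b} - E \<longrightarrow>
        (\<forall>u v. a \<le> u \<and> u \<le> x \<and> x \<le> v \<and> v \<le> b \<and> {u..v} \<subseteq> ball x r \<longrightarrow> \<bar>h x * (v - u) - (g v - g u)\<bar> \<le> \<epsilon> * (v - u)))" for x
    proof (cases "x \<in> E")
      case True
      then show ?thesis using U open_contains_ball by blast
    next
      case nE: False
      show ?thesis
      proof (cases "x \<in> {a..b}")
        case True
        then have "(g has_real_derivative h x) (at x within {a..b})" using der nE by (simp add: h_def)
        then obtain r where r: "r > 0" "\<forall>y\<in>{a..b}. norm (y - x) < r \<longrightarrow> norm (g y - g x - h x * (y - x)) \<le> \<epsilon> * norm (y - x)"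
          unfolding has_field_derivative_def has_derivative_within_alt using \<epsilon>(1) by blast
        have "\<bar>h x * (v - u) - (g v - g u)\<bar> \<le> \<epsilon> * (v - u)"
          if uv: "a \<le> u" "u \<le> x" "x \<le> v" "v \<le> b" "{u..v} \<subseteq> ball x r" for u v
        proof -
          have "u \<in> {u..v}" "v \<in> {u..v}" using uv by auto
          then have "u \<in> ball x r" "v \<in> ball x r" using uv(5) by blast+
          then have "\<bar>g u - g x - h x * (u - x)\<bar> \<le> \<epsilon> * (x - u)" "\<bar>g v - g x - h x * (v - x)\<bar> \<le> \<epsilon> * (v - x)"
            using r(2)[rule_format, of u] r(2)[rule_format, of v] uv by (auto simp: dist_real_def)
          then show ?thesis by (simp add: algebra_simps abs_le_iff)
        qed
        then show ?thesis using r(1) nE by blast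
      qed (use nE in \<open>auto intro!: exI[of _ 1]\<close>)
    qed
    then obtain r where r: "\<And>x. r x > 0" "\<And>x. x \<in> E \<Longrightarrow> ball x (r x) \<subseteq> U"
      and r3: "\<And>x u v. x \<in> {a..b} - E \<Longrightarrow> a \<le> u \<Longrightarrow> u \<le> x \<Longrightarrow> x \<le> v \<Longrightarrow> v \<le> b \<Longrightarrow> {u..v} \<subseteq> ball x (r x)
        \<Longrightarrow> \<bar>h x * (v - u) - (g v - g u)\<bar> \<le> \<epsilon> * (v - u)" by metis
    show "\<exists>\<gamma>. gauge \<gamma> \<and> (\<forall>\<D>. \<D> tagged_division_of {a..b} \<and> \<gamma> fine \<D> \<longrightarrow>
           norm ((\<Sum>(x, k)\<in>\<D>. Henstock_Kurzweil_Integration.content k *\<^sub>R h x) - (g b - g a)) < e)"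
    proof (intro exI[of _ "\<lambda>x. ball x (r x)"] conjI allI impI)
      show "gauge (\<lambda>x. ball x (r x))" using r(1) by (simp add: gauge_def)
      fix \<D> assume "\<D> tagged_division_of {a..b} \<and> (\<lambda>x. ball x (r x)) fine \<D>"
      then have D: "\<D> tagged_division_of {a..b}" and fine: "(\<lambda>x. ball x (r x)) fine \<D>" by auto
      have finD: "finite \<D>" using D by (rule tagged_division_of_finite)
      define u :: "real \<times> real set \<Rightarrow> real" where "u = (\<lambda>i. Inf (snd i))"
      define v :: "real \<times> real set \<Rightarrow> real" where "v = (\<lambda>i. Sup (snd i))"
      have uv: "snd i = {u i..v i}" "u i \<le> fst i" "fst i \<le> v i" "a \<le> u i" "v i \<le> b" "{u i..v i} \<subseteq> ball (fst i) (r (fst i))"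
        "fst i \<in> {a..b}" if i: "i \<in> \<D>" for i
      proof -
        obtain x k where ik: "i = (x,k)" "(x,k) \<in> \<D>" using i by (cases i) auto
        obtain s t where st: "k = cbox s t" using tagged_division_ofD(4)[OF D ik(2)] by blast
        have "x \<in> k" "k \<subseteq> {a..b}" using tagged_division_ofD(2,3)[OF D ik(2)] by auto
        moreover have "k \<subseteq> ball x (r x)" using fine ik(2) by (auto simp: fine_def)
        ultimately show "snd i = {u i..v i}" "u i \<le> fst i" "fst i \<le> v i" "a \<le> u i" "v i \<le> b"
          "{u i..v i} \<subseteq> ball (fst i) (r (fst i))" "fst i \<in> {a..b}"
          using ik st by (auto simp: u_def v_def)
      qed
      have le: "u i \<le> v i" if "i \<in> \<D>" for i using uv(2,3)[OF that] by linarith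
      define D1 where "D1 = {i\<in>\<D>. fst i \<notin> E}"
      define D2 where "D2 = {i\<in>\<D>. fst i \<in> E}"
      \<comment> \<open>A tagged division may contain degenerate intervals, whose empty interiors do
        not keep them apart from the others; dropping them restores \<open>nonoverlap\<close> and
        changes no sum.\<close>
      define D3 where "D3 = {i\<in>\<D>. fst i \<in> E \<and> u i < v i}"
      have no: "nonoverlap {i\<in>\<D>. u i < v i} u v"
        unfolding nonoverlap_def
      proof (intro conjI ballI impI)
        fix i j assume i: "i \<in> {i\<in>\<D>. u i < v i}" and j: "j \<in> {i\<in>\<D>. u i < v i}" and "i \<noteq> j"
        then have "interior (snd i) \<inter> interior (snd j) = {}"
          using tagged_division_ofD(5)[OF D, of "fst i" "snd i" "fst j" "snd j"] by (simp add: prod_eq_iff)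
        then have "{u i<..<v i} \<inter> {u j<..<v j} = {}" using uv(1)[of i] uv(1)[of j] i j by simp
        \<comment> \<open>If the intervals overlapped, the midpoint of the overlap would be interior
          to both.\<close>
        then have "(max (u i) (u j) + min (v i) (v j)) / 2 \<notin> {u i<..<v i} \<inter> {u j<..<v j}" by blast
        then show "v i \<le> u j \<or> v j \<le> u i" using i j by (auto simp: max_def min_def field_simps split: if_splits)
      qed auto
      define err where "err = (\<lambda>i. h (fst i) * (v i - u i) - (g (v i) - g (u i)))"
      have tot: "(\<Sum>i\<in>\<D>. g (v i) - g (u i)) = g b - g a"
        using additive_tagged_division_1[OF ab D, of g] by (simp add: u_def v_def case_prod_beta)
      have "(\<Sum>(x, k)\<in>\<D>. Henstock_Kurzweil_Integration.content k *\<^sub>R h x) = (\<Sum>i\<in>\<D>. h (fst i) * (v i - u i))"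
        by (rule sum.cong) (use uv(1) le in \<open>auto simp: case_prod_beta\<close>)
      then have "(\<Sum>(x, k)\<in>\<D>. Henstock_Kurzweil_Integration.content k *\<^sub>R h x) - (g b - g a) = (\<Sum>i\<in>\<D>. err i)"
        unfolding tot[symmetric] by (simp add: err_def sum_subtractf)
      also have "\<dots> = (\<Sum>i\<in>D1. err i) + (\<Sum>i\<in>D2. err i)"
      proof -
        have "\<D> = D1 \<union> D2" "D1 \<inter> D2 = {}" by (auto simp: D1_def D2_def)
        moreover have "finite D1" "finite D2" using finD by (auto simp: D1_def D2_def)
        ultimately show ?thesis by (simp add: sum.union_disjoint)
      qed
      finally have split: "\<bar>(\<Sum>(x, k)\<in>\<D>. Henstock_Kurzweil_Integration.content k *\<^sub>R h x) - (g b - g a)\<bar>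
          \<le> (\<Sum>i\<in>D1. \<bar>err i\<bar>) + (\<Sum>i\<in>D2. \<bar>err i\<bar>)"
        using sum_abs[of "err" D1]
          sum_abs[of "err" D2] by linarith
      have "(\<Sum>i\<in>D1. \<bar>err i\<bar>) \<le> (\<Sum>i\<in>D1. \<epsilon> * (v i - u i))"
      proof (rule sum_mono)
        fix i assume i: "i \<in> D1"
        then have "i \<in> \<D>" "fst i \<notin> E" by (auto simp: D1_def)
        note uvi = uv[OF this(1)]
        show "\<bar>err i\<bar> \<le> \<epsilon> * (v i - u i)"
          unfolding err_def by (rule r3) (use uvi \<open>fst i \<notin> E\<close> in blast)+
      qed
      also have "\<dots> \<le> (\<Sum>i\<in>\<D>. \<epsilon> * (v i - u i))"
        by (rule sum_mono2) (use finD le \<epsilon> in \<open>auto simp: D1_def\<close>)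
      also have "\<dots> = \<epsilon> * (b - a)"
        using additive_tagged_division_1[OF ab D, of id] by (simp add: u_def v_def case_prod_beta flip: sum_distrib_left)
      finally have one: "(\<Sum>i\<in>D1. \<bar>err i\<bar>) < e / 2" using \<epsilon>(2) by linarith
      have "(\<Sum>i\<in>D2. \<bar>err i\<bar>) = (\<Sum>i\<in>D3. \<bar>g (v i) - g (u i)\<bar>)"
      proof (rule sum.mono_neutral_cong_right)
        show "finite D2" using finD by (simp add: D2_def)
        show "D3 \<subseteq> D2" by (auto simp: D2_def D3_def)
        show "\<forall>i\<in>D2 - D3. \<bar>err i\<bar> = 0"
        proof
          fix i assume "i \<in> D2 - D3"
          then have "u i = v i" using le[of i] by (auto simp: D2_def D3_def)
          then show "\<bar>err i\<bar> = 0" by (simp add: err_def)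
        qed
      qed (auto simp: D3_def h_def err_def)
      also have "\<dots> < e / 2"
      proof -
        have fin3: "finite D3" using finD by (simp add: D3_def)
        have no3: "nonoverlap D3 u v" by (rule nonoverlap_subset[OF no]) (auto simp: D3_def)
        have "(\<Sum>i\<in>D3. v i - u i) \<le> measure lebesgue U"
        proof (rule nonoverlap_measure[OF fin3 no3 _ U(3)])
          fix i assume "i \<in> D3"
          then have "i \<in> \<D>" "fst i \<in> E" by (auto simp: D3_def)
          then have "{u i..v i} \<subseteq> U" using uv(6)[of i] r(2)[of "fst i"] by blast
          then show "{u i<..<v i} \<subseteq> U" by (meson greaterThanLessThan_subseteq_atLeastAtMost_iff order_refl subset_trans)
        qed
        then have "(\<Sum>i\<in>D3. v i - u i) < \<delta>" using U(4) by linarith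
        then show ?thesis by (intro controlsD[OF small[OF fin3] no3]) (use uv(4,5) in \<open>simp_all add: D3_def\<close>)
      qed
      finally show "norm ((\<Sum>(x, k)\<in>\<D>. Henstock_Kurzweil_Integration.content k *\<^sub>R h x) - (g b - g a)) < e"
        using split one by simp
    qed
  qed
  then show ?thesis
    by (rule has_integral_spike[OF E, rotated]) (simp add: h_def)
qed

section \<open>Closure properties of absolute continuity\<close>

text \<open>A single comparison principle from which constants, sums, products, inverses and
  antiderivatives all follow by estimating one increment.\<close>

lemma abs_cont_on_dominated:
  assumes g: "abs_cont_on a b g" and h: "abs_cont_on a b h"
    and dom: "\<And>u v. a \<le> u \<Longrightarrow> u \<le> v \<Longrightarrow> v \<le> b \<Longrightarrow> \<bar>k v - k u\<bar> \<le> M * (\<bar>g v - g u\<bar> + \<bar>h v - h u\<bar>)"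
  shows "abs_cont_on a b k"
  unfolding abs_cont_on_iff_controls
proof (intro allI impI)
  fix e :: real assume e: "e > 0"
  define e' where "e' = e / (2 * (\<bar>M\<bar> + 1))"
  have e': "e' > 0" "\<bar>M\<bar> * (2 * e') < e" using e by (auto simp: e'_def field_simps)
  obtain d1 where d1: "d1 > 0" "\<And>A :: nat set. finite A \<Longrightarrow> controls a b g d1 e' A"
    by (rule abs_cont_onE[OF g e'(1), where 'i=nat]) blast
  obtain d2 where d2: "d2 > 0" "\<And>A :: nat set. finite A \<Longrightarrow> controls a b h d2 e' A"
    by (rule abs_cont_onE[OF h e'(1), where 'i=nat]) blast
  show "\<exists>\<delta>>0. \<forall>m::nat. controls a b k \<delta> e {..<m}"
    unfolding controls_def
  proof (intro exI[of _ "min d1 d2"] conjI allI impI)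
    show "min d1 d2 > 0" using d1 d2 by simp
    fix m :: nat and u v
    assume no: "nonoverlap {..<m} u v" and ab: "\<forall>i\<in>{..<m}. a \<le> u i \<and> v i \<le> b" and lt: "(\<Sum>i<m. v i - u i) < min d1 d2"
    have 1: "(\<Sum>i<m. \<bar>g (v i) - g (u i)\<bar>) < e'" by (rule controlsD[OF d1(2)]) (use no ab lt in auto)
    have 2: "(\<Sum>i<m. \<bar>h (v i) - h (u i)\<bar>) < e'" by (rule controlsD[OF d2(2)]) (use no ab lt in auto)
    have "(\<Sum>i<m. \<bar>k (v i) - k (u i)\<bar>) \<le> (\<Sum>i<m. \<bar>M\<bar> * (\<bar>g (v i) - g (u i)\<bar> + \<bar>h (v i) - h (u i)\<bar>))"
    proof (rule sum_mono)
      fix i assume "i \<in> {..<m}"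
      then have "\<bar>k (v i) - k (u i)\<bar> \<le> M * (\<bar>g (v i) - g (u i)\<bar> + \<bar>h (v i) - h (u i)\<bar>)"
        using no ab by (intro dom) (auto simp: nonoverlap_def)
      also have "\<dots> \<le> \<bar>M\<bar> * (\<bar>g (v i) - g (u i)\<bar> + \<bar>h (v i) - h (u i)\<bar>)"
        by (intro mult_right_mono) auto
      finally show "\<bar>k (v i) - k (u i)\<bar> \<le> \<bar>M\<bar> * (\<bar>g (v i) - g (u i)\<bar> + \<bar>h (v i) - h (u i)\<bar>)" .
    qed
    also have "\<dots> = \<bar>M\<bar> * ((\<Sum>i<m. \<bar>g (v i) - g (u i)\<bar>) + (\<Sum>i<m. \<bar>h (v i) - h (u i)\<bar>))"
      by (simp only: sum.distrib sum_distrib_left[symmetric])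
    also have "\<dots> \<le> \<bar>M\<bar> * (2 * e')" using 1 2 by (intro mult_left_mono) auto
    finally show "(\<Sum>i<m. \<bar>k (v i) - k (u i)\<bar>) < e" using e'(2) by linarith
  qed
qed

lemma abs_cont_on_ident: "abs_cont_on a b (\<lambda>x. x)"
proof -
  have "controls a b (\<lambda>x. x) e e {..<m}" for e and m :: nat
    unfolding controls_def nonoverlap_def by simp
  then show ?thesis unfolding abs_cont_on_iff_controls by blast
qed

lemma abs_cont_on_imp_continuous_on:
  assumes g: "abs_cont_on a b g"
  shows "continuous_on {a..b} g"
  unfolding continuous_on_iff
proof (intro ballI allI impI)
  fix x e :: real assume x: "x \<in> {a..b}" and e: "e > 0"
  obtain d where d: "d > 0" "\<And>A :: nat set. finite A \<Longrightarrow> controls a b g d e A"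
    by (rule abs_cont_onE[OF g e, where 'i=nat]) blast
  have lt: "\<bar>g v - g u\<bar> < e" if "a \<le> u" "u \<le> v" "v \<le> b" "v - u < d" for u v
    using controlsD[OF d(2), of "{0}" "\<lambda>_. u" "\<lambda>_. v"] that by (simp add: nonoverlap_def)
  have "dist (g x') (g x) < e" if "x' \<in> {a..b}" "dist x' x < d" for x'
    using that x lt[of x x'] lt[of x' x] by (cases "x \<le> x'") (auto simp: dist_real_def)
  then show "\<exists>d>0. \<forall>x'\<in>{a..b}. dist x' x < d \<longrightarrow> dist (g x') (g x) < e" using d(1) by blast
qed

lemma abs_cont_on_bounded:
  assumes "abs_cont_on a b g"
  obtains M where "M > 0" "\<And>x. a \<le> x \<Longrightarrow> x \<le> b \<Longrightarrow> \<bar>g x\<bar> \<le> M"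
proof -
  have "bounded (g ` {a..b})"
    by (intro compact_imp_bounded compact_continuous_image abs_cont_on_imp_continuous_on[OF assms]) simp
  then obtain M where "M > 0" "\<forall>y\<in>g ` {a..b}. norm y \<le> M" using bounded_pos by blast
  then show ?thesis using that by auto
qed

lemma abs_cont_on_const: "abs_cont_on a b (\<lambda>_. c)"
  by (rule abs_cont_on_dominated[where M=0, OF abs_cont_on_ident abs_cont_on_ident]) simp

lemma abs_cont_on_add:
  assumes "abs_cont_on a b g" "abs_cont_on a b h"
  shows "abs_cont_on a b (\<lambda>x. g x + h x)"
  by (rule abs_cont_on_dominated[where M=1, OF assms]) auto

lemma abs_cont_on_mult:
  assumes "abs_cont_on a b g" "abs_cont_on a b h"
  shows "abs_cont_on a b (\<lambda>x. g x * h x)"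
proof -
  obtain M where M: "M > 0" "\<And>x. a \<le> x \<Longrightarrow> x \<le> b \<Longrightarrow> \<bar>g x\<bar> \<le> M" using abs_cont_on_bounded[OF assms(1)] by blast
  obtain N where N: "N > 0" "\<And>x. a \<le> x \<Longrightarrow> x \<le> b \<Longrightarrow> \<bar>h x\<bar> \<le> N" using abs_cont_on_bounded[OF assms(2)] by blast
  show ?thesis
  proof (rule abs_cont_on_dominated[where M="M + N", OF assms])
    fix u v assume uv: "a \<le> u" "u \<le> v" "v \<le> b"
    have "g v * h v - g u * h u = g v * (h v - h u) + h u * (g v - g u)" by (simp add: algebra_simps)
    then have "\<bar>g v * h v - g u * h u\<bar> \<le> \<bar>g v\<bar> * \<bar>h v - h u\<bar> + \<bar>h u\<bar> * \<bar>g v - g u\<bar>"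
      by (metis abs_mult abs_triangle_ineq)
    also have "\<dots> \<le> (M + N) * \<bar>h v - h u\<bar> + (M + N) * \<bar>g v - g u\<bar>"
      using M(2)[of v] N(2)[of u] M(1) N(1) uv by (intro add_mono mult_right_mono) auto
    finally show "\<bar>g v * h v - g u * h u\<bar> \<le> (M + N) * (\<bar>g v - g u\<bar> + \<bar>h v - h u\<bar>)"
      by (simp add: algebra_simps)
  qed
qed

lemma abs_cont_on_inverse:
  assumes g: "abs_cont_on a b g" and nz: "\<And>x. a \<le> x \<Longrightarrow> x \<le> b \<Longrightarrow> g x \<noteq> 0"
  shows "abs_cont_on a b (\<lambda>x. inverse (g x))"
proof -
  have c: "continuous_on {a..b} (\<lambda>x. inverse (g x))"
    by (intro continuous_on_inverse abs_cont_on_imp_continuous_on[OF g]) (use nz in auto)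
  have "bounded ((\<lambda>x. inverse (g x)) ` {a..b})"
    by (rule compact_imp_bounded[OF compact_continuous_image[OF c compact_Icc]])
  then obtain M where "M > 0" "\<forall>y\<in>(\<lambda>x. inverse (g x)) ` {a..b}. norm y \<le> M" using bounded_pos by blast
  then have M: "M > 0" "\<And>x. a \<le> x \<Longrightarrow> x \<le> b \<Longrightarrow> \<bar>inverse (g x)\<bar> \<le> M" by auto
  show ?thesis
  proof (rule abs_cont_on_dominated[where M="M * M", OF g g])
    fix u v assume uv: "a \<le> u" "u \<le> v" "v \<le> b"
    then have nz': "g u \<noteq> 0" "g v \<noteq> 0" using nz by auto
    have "\<bar>inverse (g v) - inverse (g u)\<bar> = \<bar>inverse (g v)\<bar> * \<bar>inverse (g u)\<bar> * \<bar>g v - g u\<bar>"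
      using nz' by (simp add: inverse_diff_inverse abs_mult abs_minus_commute)
    also have "\<dots> \<le> (M * M) * \<bar>g v - g u\<bar>"
      using M uv by (intro mult_right_mono mult_mono) auto
    also have "\<dots> \<le> (M * M) * (\<bar>g v - g u\<bar> + \<bar>g v - g u\<bar>)" by (intro mult_left_mono) auto
    finally show "\<bar>inverse (g v) - inverse (g u)\<bar> \<le> (M * M) * (\<bar>g v - g u\<bar> + \<bar>g v - g u\<bar>)" .
  qed
qed


section \<open>Iterated derivatives and Wronskians\<close>

declare hder.simps(2) [simp del]

text \<open>Without isolated points a derivative within S is unique, so the value picked by
  \<open>vector_derivative\<close> is the derivative whenever one exists.\<close>

locale perfect_set =
  fixes S :: "real set"
  assumes perfect: "x \<in> S \<Longrightarrow> at x within S \<noteq> bot"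
begin

lemma hder_Suc_eq:
  "x \<in> S \<Longrightarrow> (hder S k g has_real_derivative D) (at x within S) \<Longrightarrow> hder S (Suc k) g x = D"
  using perfect[of x]
  by (simp add: hder.simps(2) has_real_derivative_iff_has_vector_derivative vector_derivative_within)

lemma vector_derivative_cong_on:
  assumes "\<And>y. y \<in> S \<Longrightarrow> g y = h y" and x: "x \<in> S"
  shows "vector_derivative g (at x within S) = vector_derivative h (at x within S)"
proof -
  have "(g has_vector_derivative D) (at x within S) \<longleftrightarrow> (h has_vector_derivative D) (at x within S)" for D
    using has_vector_derivative_transform[OF x, of g h] has_vector_derivative_transform[OF x, of h g] assms(1)
    by metis
  then show ?thesis by (simp add: vector_derivative_def)
qed

lemma has_real_derivative_cong_on:
  assumes "\<And>y. y \<in> S \<Longrightarrow> g y = h y" and x: "x \<in> S"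
    and "(g has_real_derivative D) (at x within S)"
  shows "(h has_real_derivative D) (at x within S)"
  using assms(3) by (rule has_field_derivative_transform_within[where d=1]) (use assms in auto)

lemma hder_cong:
  assumes "\<And>y. y \<in> S \<Longrightarrow> g y = h y"
  shows "x \<in> S \<Longrightarrow> hder S k g x = hder S k h x"
proof (induction k arbitrary: x)
  case (Suc k)
  then show ?case using vector_derivative_cong_on[of "hder S k g" "hder S k h" x] by (simp add: hder.simps(2))
qed (use assms in simp)

lemma hder_shift: "hder S k (hder S (Suc 0) g) = hder S (Suc k) g"
  by (induction k) (simp_all add: hder.simps(2))

lemma hder_const: "x \<in> S \<Longrightarrow> hder S k (\<lambda>_. c) x = (if k = 0 then c else 0)"
proof (induction k arbitrary: x)
  case (Suc k)
  have "hder S (Suc k) (\<lambda>_. c) x = 0"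
  proof (rule hder_Suc_eq[OF Suc.prems])
    have "((\<lambda>_. if k = 0 then c else 0) has_real_derivative 0) (at x within S)" by simp
    then show "(hder S k (\<lambda>_. c) has_real_derivative 0) (at x within S)"
      by (rule has_real_derivative_cong_on[rotated -1]) (use Suc in auto)
  qed
  then show ?case by simp
qed simp

abbreviation "D1 \<equiv> hder S (Suc 0)"

text \<open>B is kept abstract because two notions of top regularity pass through the same calculus:
  local absolute continuity, and differentiability at one given point.\<close>

definition Reg :: "((real \<Rightarrow> real) \<Rightarrow> bool) \<Rightarrow> nat \<Rightarrow> (real \<Rightarrow> real) \<Rightarrow> bool" where
  "Reg B k g \<longleftrightarrow> (\<forall>j<k. \<forall>x\<in>S. (hder S j g has_real_derivative hder S (Suc j) g x) (at x within S))
      \<and> B (hder S k g)"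

definition rd :: "(real \<Rightarrow> real) \<Rightarrow> (real \<Rightarrow> real) \<Rightarrow> real \<Rightarrow> real" where
  "rd h g = hder S 1 (\<lambda>x. g x / h x)"

lemma Reg_0 [simp]: "Reg B 0 g \<longleftrightarrow> B g"
  by (simp add: Reg_def)

lemma Reg_Suc: "Reg B (Suc k) g \<longleftrightarrow>
   (\<forall>x\<in>S. (g has_real_derivative D1 g x) (at x within S)) \<and> Reg B k (D1 g)"
  unfolding Reg_def hder_shift All_less_Suc2 by simp

end

text \<open>These are the closure rules that quotients and their derivatives need;
  \<open>B_antiderivative\<close> is what lets the order of regularity be lowered.\<close>

locale regularity_class = perfect_set +
  fixes B :: "(real \<Rightarrow> real) \<Rightarrow> bool"
  assumes B_cong: "(\<And>x. x \<in> S \<Longrightarrow> g x = h x) \<Longrightarrow> B g \<Longrightarrow> B h"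
    and B_antiderivative: "(\<And>x. x \<in> S \<Longrightarrow> (g has_real_derivative g' x) (at x within S)) \<Longrightarrow> B g' \<Longrightarrow> B g"
    and B_const: "B (\<lambda>_. c)"
    and B_add: "B g \<Longrightarrow> B h \<Longrightarrow> B (\<lambda>x. g x + h x)"
    and B_mult: "B g \<Longrightarrow> B h \<Longrightarrow> B (\<lambda>x. g x * h x)"
    and B_inverse: "B g \<Longrightarrow> (\<And>x. x \<in> S \<Longrightarrow> g x \<noteq> 0) \<Longrightarrow> B (\<lambda>x. inverse (g x))"
begin

abbreviation "R \<equiv> Reg B"

lemma R_cong: "(\<And>x. x \<in> S \<Longrightarrow> g x = h x) \<Longrightarrow> R k g \<Longrightarrow> R k h"
proof (induction k arbitrary: g h)
  case 0
  then show ?case using B_cong[of g h] by simp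
next
  case (Suc k)
  have eq: "D1 g x = D1 h x" if "x \<in> S" for x
    using hder_cong[of g h x "Suc 0"] Suc.prems(1) that by blast
  have "R k (D1 h)"
    by (rule Suc.IH[OF eq]) (use Suc.prems(2) in \<open>simp_all only: Reg_Suc\<close>)
  moreover have "(h has_real_derivative D1 h x) (at x within S)" if x: "x \<in> S" for x
  proof (rule has_real_derivative_cong_on[of g h, OF Suc.prems(1) x])
    have "(g has_real_derivative D1 g x) (at x within S)"
      using Suc.prems(2) x unfolding Reg_Suc by blast
    then show "(g has_real_derivative D1 h x) (at x within S)" by (simp only: eq[OF x])
  qed
  ultimately show ?case unfolding Reg_Suc by blast
qed

lemma R_SucI:
  assumes "\<And>x. x \<in> S \<Longrightarrow> (g has_real_derivative g' x) (at x within S)" "R k g'"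
  shows "R (Suc k) g"
proof -
  have eq: "D1 g x = g' x" if "x \<in> S" for x
    using hder_Suc_eq[OF that, of 0 g] assms(1)[OF that] by simp
  have "R k (D1 g)" by (rule R_cong[OF _ assms(2)]) (simp only: eq)
  with assms(1) eq show ?thesis unfolding Reg_Suc by simp
qed

lemma R_SucD: "R (Suc k) g \<Longrightarrow> R k g"
proof (induction k arbitrary: g)
  case 0
  then show ?case using B_antiderivative[of g "D1 g"] unfolding Reg_Suc by simp
next
  case (Suc k)
  then have "R k (D1 g)" using Reg_Suc by blast
  moreover have "\<forall>x\<in>S. (g has_real_derivative D1 g x) (at x within S)"
    using Suc.prems Reg_Suc by blast
  ultimately show ?case using Reg_Suc by blast
qed

lemma R_mono: "R k g \<Longrightarrow> j \<le> k \<Longrightarrow> R j g"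
  by (rule inc_induct[where P="\<lambda>j. R j g"]) (auto dest: R_SucD)

lemma R_const: "R k (\<lambda>_. c)"
proof (induction k arbitrary: c)
  case (Suc k)
  show ?case by (rule R_SucI[of _ "\<lambda>_. 0"]) (auto intro: Suc)
qed (simp add: B_const)

lemma R_add: "R k g \<Longrightarrow> R k h \<Longrightarrow> R k (\<lambda>x. g x + h x)"
proof (induction k arbitrary: g h)
  case (Suc k)
  show ?case
    by (rule R_SucI[of _ "\<lambda>x. D1 g x + D1 h x"])
      (use Suc in \<open>auto simp: Reg_Suc intro!: derivative_intros\<close>)
qed (simp add: B_add)

lemma R_mult: "R k g \<Longrightarrow> R k h \<Longrightarrow> R k (\<lambda>x. g x * h x)"
proof (induction k arbitrary: g h)
  case (Suc k)
  have lo: "R k g" "R k h" using Suc.prems R_SucD by auto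
  show ?case
  proof (rule R_SucI[of _ "\<lambda>x. D1 g x * h x + D1 h x * g x"])
    show "((\<lambda>x. g x * h x) has_real_derivative D1 g x * h x + D1 h x * g x) (at x within S)"
      if "x \<in> S" for x
      using Suc.prems that unfolding Reg_Suc by (intro DERIV_mult) auto
    show "R k (\<lambda>x. D1 g x * h x + D1 h x * g x)"
      using Suc.prems lo unfolding Reg_Suc by (intro R_add Suc.IH) auto
  qed
qed (simp add: B_mult)

lemma R_inverse: "R k g \<Longrightarrow> (\<And>x. x \<in> S \<Longrightarrow> g x \<noteq> 0) \<Longrightarrow> R k (\<lambda>x. inverse (g x))"
proof (induction k arbitrary: g)
  case (Suc k)
  have lo: "R k g" using Suc.prems R_SucD by auto
  show ?case
  proof (rule R_SucI[of _ "\<lambda>x. (- 1) * (inverse (g x) * (D1 g x * inverse (g x)))"])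
    show "((\<lambda>x. inverse (g x)) has_real_derivative (- 1) * (inverse (g x) * (D1 g x * inverse (g x)))) (at x within S)"
      if "x \<in> S" for x
      using Suc.prems that DERIV_inverse'[of g "D1 g x" x S] unfolding Reg_Suc
      by (simp add: mult.assoc)
    show "R k (\<lambda>x. (- 1) * (inverse (g x) * (D1 g x * inverse (g x))))"
      using Suc.prems lo Suc.IH[OF lo Suc.prems(2)] unfolding Reg_Suc by (intro R_mult R_const) auto
  qed
qed (simp add: B_inverse)

lemma R_divide: "R k g \<Longrightarrow> R k h \<Longrightarrow> (\<And>x. x \<in> S \<Longrightarrow> h x \<noteq> 0) \<Longrightarrow> R k (\<lambda>x. g x / h x)"
  unfolding divide_inverse by (intro R_mult R_inverse)

lemma R_rd: "R (Suc k) g \<Longrightarrow> R (Suc k) h \<Longrightarrow> (\<And>x. x \<in> S \<Longrightarrow> h x \<noteq> 0) \<Longrightarrow> R k (rd h g)"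
  using R_divide[of "Suc k" g h] unfolding rd_def One_nat_def Reg_Suc by blast

lemma rd_deriv: "R (Suc k) g \<Longrightarrow> R (Suc k) h \<Longrightarrow> (\<And>x. x \<in> S \<Longrightarrow> h x \<noteq> 0) \<Longrightarrow> x \<in> S
    \<Longrightarrow> ((\<lambda>x. g x / h x) has_real_derivative rd h g x) (at x within S)"
  using R_divide[of "Suc k" g h] unfolding rd_def One_nat_def Reg_Suc by blast

end

section \<open>Pointwise differentiability, Leibniz's rule and Wronskians\<close>

context perfect_set
begin

text \<open>This instance serves the points where the n-th derivatives happen to exist, without any
  control of them at neighbouring points.\<close>

lemma regularity_differentiable:
  assumes x: "x \<in> S"
  shows "regularity_class S (\<lambda>g. g differentiable (at x within S))"
proof
  fix g h :: "real \<Rightarrow> real" and g' c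
  show "h differentiable (at x within S)" if "\<And>x. x \<in> S \<Longrightarrow> g x = h x" "g differentiable (at x within S)"
    using has_real_derivative_cong_on[of g h x, OF that(1) x] that(2) unfolding real_differentiable_def by blast
  show "g differentiable (at x within S)"
    if "\<And>x. x \<in> S \<Longrightarrow> (g has_real_derivative g' x) (at x within S)"
    using that x unfolding real_differentiable_def by blast
  show "(\<lambda>x. inverse (g x)) differentiable (at x within S)"
    if "g differentiable (at x within S)" "\<And>x. x \<in> S \<Longrightarrow> g x \<noteq> 0"
    using that x by (intro differentiable_inverse) auto
qed auto

text \<open>\<open>g\<close> is \<open>k\<close> times differentiable on \<open>S\<close>, except that the last derivative need only exist at \<open>x\<close>.\<close>

definition diff_upto :: "nat \<Rightarrow> real \<Rightarrow> (real \<Rightarrow> real) \<Rightarrow> bool" where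
  "diff_upto k x g \<longleftrightarrow> (\<forall>l y. l < k \<longrightarrow> y \<in> S \<longrightarrow> y = x \<or> Suc l < k \<longrightarrow>
     (hder S l g has_real_derivative hder S (Suc l) g y) (at y within S))"

lemma diff_upto_0 [simp]: "diff_upto 0 x g"
  by (simp add: diff_upto_def)

text \<open>Through this link to the class of functions differentiable at x,
  \<open>diff_upto\<close> inherits the rules for quotients and reductions.\<close>

lemma diff_upto_Suc:
  assumes "x \<in> S"
  shows "diff_upto (Suc k) x g \<longleftrightarrow> Reg (\<lambda>g. g differentiable (at x within S)) k g"
proof
  assume "diff_upto (Suc k) x g"
  then show "Reg (\<lambda>g. g differentiable (at x within S)) k g"
    using assms unfolding diff_upto_def Reg_def real_differentiable_def by (auto)
next
  assume r: "Reg (\<lambda>g. g differentiable (at x within S)) k g"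
  then obtain D where "(hder S k g has_real_derivative D) (at x within S)"
    unfolding Reg_def real_differentiable_def by blast
  then have "(hder S k g has_real_derivative hder S (Suc k) g x) (at x within S)"
    using hder_Suc_eq[OF assms] by metis
  with r show "diff_upto (Suc k) x g" unfolding diff_upto_def Reg_def by (auto simp: less_Suc_eq)
qed

lemma diff_upto_SucD: "diff_upto (Suc k) x g \<Longrightarrow> y \<in> S \<Longrightarrow> diff_upto k y g"
  unfolding diff_upto_def by (auto)

lemma diff_upto_divide:
  assumes "x \<in> S" "diff_upto k x g" "diff_upto k x h" "\<And>y. y \<in> S \<Longrightarrow> h y \<noteq> 0"
  shows "diff_upto k x (\<lambda>y. g y / h y)"
proof (cases k)
  case (Suc m)
  interpret regularity_class S "\<lambda>g. g differentiable (at x within S)"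
    by (rule regularity_differentiable[OF assms(1)])
  show ?thesis using R_divide[of m g h] assms unfolding Suc diff_upto_Suc[OF assms(1)] by blast
qed simp

lemma diff_upto_rd:
  assumes "x \<in> S" "diff_upto (Suc k) x g" "diff_upto (Suc k) x h" "\<And>y. y \<in> S \<Longrightarrow> h y \<noteq> 0"
  shows "diff_upto k x (rd h g)"
proof (cases k)
  case (Suc m)
  interpret regularity_class S "\<lambda>g. g differentiable (at x within S)"
    by (rule regularity_differentiable[OF assms(1)])
  show ?thesis using R_rd[of m g h] assms unfolding Suc diff_upto_Suc[OF assms(1)] by blast
qed simp

text \<open>The induction step of Leibniz's rule on abstract sequences: an index shift and Pascal's
  rule.\<close>

lemma leibniz_binomial_sum:
  fixes a b :: "nat \<Rightarrow> real"
  shows "(\<Sum>l\<le>j. real (j choose l) * (a (Suc (j - l)) * b l + b (Suc l) * a (j - l)))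
    = (\<Sum>l\<le>Suc j. real (Suc j choose l) * (a (Suc j - l) * b l))"
proof -
  have "(\<Sum>l\<le>Suc j. real (Suc j choose l) * (a (Suc j - l) * b l))
      = a (Suc j) * b 0 + (\<Sum>l\<le>j. real (j choose l) * (a (j - l) * b (Suc l))) + (\<Sum>l\<le>j. real (j choose Suc l) * (a (j - l) * b (Suc l)))"
    by (subst sum.atMost_Suc_shift) (simp add: sum.distrib algebra_simps)
  also have "a (Suc j) * b 0 + (\<Sum>l\<le>j. real (j choose l) * (a (j - l) * b (Suc l))) + (\<Sum>l\<le>j. real (j choose Suc l) * (a (j - l) * b (Suc l)))
      = (\<Sum>l\<le>j. real (j choose l) * (a (j - l) * b (Suc l))) + (\<Sum>l\<le>Suc j. real (j choose l) * (a (Suc j - l) * b l))"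
    by (subst sum.atMost_Suc_shift[where g="\<lambda>l. real (j choose l) * (a (Suc j - l) * b l)"]) simp
  also have "(\<Sum>l\<le>Suc j. real (j choose l) * (a (Suc j - l) * b l)) = (\<Sum>l\<le>j. real (j choose l) * (a (Suc (j - l)) * b l))"
    by (simp add: Suc_diff_le)
  finally show ?thesis by (simp add: sum.distrib algebra_simps)
qed

lemma hder_mult:
  assumes "x \<in> S" "diff_upto j x h" "diff_upto j x g"
  shows "hder S j (\<lambda>y. h y * g y) x = (\<Sum>l\<le>j. real (j choose l) * (hder S (j - l) h x * hder S l g x))"
  using assms
proof (induction j arbitrary: x)
  case (Suc j)
  have IH: "hder S j (\<lambda>y. h y * g y) y = (\<Sum>l\<le>j. real (j choose l) * (hder S (j - l) h y * hder S l g y))" if "y \<in> S" for y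
    using Suc diff_upto_SucD that by blast
  have d: "(hder S l h has_real_derivative hder S (Suc l) h x) (at x within S)"
     "(hder S l g has_real_derivative hder S (Suc l) g x) (at x within S)" if "l \<le> j" for l
    using Suc.prems that unfolding diff_upto_def by (auto simp: less_Suc_eq_le)
  have "((\<lambda>y. \<Sum>l\<le>j. real (j choose l) * (hder S (j - l) h y * hder S l g y)) has_real_derivative
      (\<Sum>l\<le>j. real (j choose l) * (hder S (Suc (j - l)) h x * hder S l g x + hder S (Suc l) g x * hder S (j - l) h x))) (at x within S)"
    by (intro DERIV_sum DERIV_cmult DERIV_mult d) auto
  then have "(hder S j (\<lambda>y. h y * g y) has_real_derivative
      (\<Sum>l\<le>j. real (j choose l) * (hder S (Suc (j - l)) h x * hder S l g x + hder S (Suc l) g x * hder S (j - l) h x))) (at x within S)"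
    by (rule has_real_derivative_cong_on[rotated -1]) (use IH Suc.prems in auto)
  from hder_Suc_eq[OF Suc.prems(1) this] show ?case
    using leibniz_binomial_sum[where a="\<lambda>k. hder S k h x" and b="\<lambda>k. hder S k g x"] by simp
qed simp

text \<open>Functions index the rows and orders of differentiation the columns, so reordering
  functions permutes rows and Leibniz's rule becomes multiplication from the right.\<close>

lemma wronsk_det:
  "wronsk S gs x = Determinant.det (Matrix.mat (length gs) (length gs) (\<lambda>(i,j). hder S j (gs ! i) x))"
proof -
  have "(\<Prod>j<length gs. hder S (p j) (gs ! j) x)
      = (\<Prod>i = 0..<length gs. Matrix.mat (length gs) (length gs) (\<lambda>(i,j). hder S j (gs ! i) x) $$ (i, p i))"
    if "p permutes {0..<length gs}" for p
    unfolding atLeast0LessThan[symmetric] using permutes_in_image[OF that] by (intro prod.cong) auto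
  then show ?thesis
    unfolding wronsk_def by (subst det_def'[of _ "length gs"]) (auto simp: atLeast0LessThan intro!: sum.cong)
qed

lemma wronsk_Nil [simp]: "wronsk S [] x = 1"
  by (simp add: wronsk_det det_dim_zero)

lemma wronsk_single [simp]: "wronsk S [g] x = g x"
  by (simp add: wronsk_det det_single)

text \<open>Dividing all entries by \<open>h\<close> multiplies the Wronskian matrix by a triangular matrix
  (Leibniz rule); afterwards the first row is \<open>(1, 0, \<dots>, 0)\<close>.\<close>

lemma wronsk_Cons:
  assumes x: "x \<in> S" and h0: "\<And>y. y \<in> S \<Longrightarrow> h y \<noteq> 0"
    and dh: "diff_upto (length gs) x h" and dg: "\<And>g. g \<in> set gs \<Longrightarrow> diff_upto (length gs) x g"
  shows "wronsk S (h # gs) x = h x ^ Suc (length gs) * wronsk S (map (rd h) gs) x"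
proof -
  define m where "m = length gs"
  define ys where "ys = map (\<lambda>g y. g y / h y) (h # gs)"
  define N where "N = Matrix.mat (Suc m) (Suc m) (\<lambda>(i,l). hder S l (ys ! i) x)"
  define A where "A = Matrix.mat (Suc m) (Suc m) (\<lambda>(l,j). if l \<le> j then real (j choose l) * hder S (j - l) h x else 0)"
  have carr: "N \<in> carrier_mat (Suc m) (Suc m)" "A \<in> carrier_mat (Suc m) (Suc m)" by (auto simp: N_def A_def)
  have lower: "diff_upto j x g" if "diff_upto m x g" "j \<le> m" for j g
    using that(2,1) by (induction rule: inc_induct) (use x diff_upto_SucD in blast)+
  have entry: "hder S j ((h # gs) ! i) x = (\<Sum>l\<le>j. hder S l (ys ! i) x * (real (j choose l) * hder S (j - l) h x))"
    if ij: "i < Suc m" "j < Suc m" for i j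
  proof -
    have yi: "ys ! i = (\<lambda>y. ((h # gs) ! i) y / h y)" using ij unfolding ys_def m_def by (subst nth_map) auto
    have "hder S j ((h # gs) ! i) x = hder S j (\<lambda>y. h y * (ys ! i) y) x"
      by (rule hder_cong[OF _ x]) (simp add: yi h0)
    also have "\<dots> = (\<Sum>l\<le>j. real (j choose l) * (hder S (j - l) h x * hder S l (ys ! i) x))"
    proof (rule hder_mult[OF x])
      show "diff_upto j x h" using dh ij lower by (simp add: m_def)
      have "(h # gs) ! i \<in> set (h # gs)" using ij by (intro nth_mem) (simp add: m_def)
      then have "diff_upto j x ((h # gs) ! i)" using dh dg ij lower by (auto simp: m_def)
      then show "diff_upto j x (ys ! i)"
        unfolding yi using \<open>diff_upto j x h\<close> h0 x by (intro diff_upto_divide)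
    qed
    finally show ?thesis by (simp add: mult_ac)
  qed
  have "Matrix.mat (Suc m) (Suc m) (\<lambda>(i,j). hder S j ((h # gs) ! i) x) = N * A"
  proof (rule eq_matI)
    fix i j assume "i < dim_row (N * A)" "j < dim_col (N * A)"
    then have ij: "i < Suc m" "j < Suc m" by (auto simp: N_def A_def)
    have "(N * A) $$ (i,j) = (\<Sum>l<Suc m. N $$ (i,l) * A $$ (l,j))"
      using ij carr by (simp add: scalar_prod_def lessThan_atLeast0)
    also have "\<dots> = (\<Sum>l\<le>j. hder S l (ys ! i) x * (real (j choose l) * hder S (j - l) h x))"
      by (rule sum.mono_neutral_cong_right) (use ij in \<open>auto simp: N_def A_def\<close>)
    finally show "Matrix.mat (Suc m) (Suc m) (\<lambda>(i,j). hder S j ((h # gs) ! i) x) $$ (i,j) = (N * A) $$ (i,j)"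
      using entry[OF ij] ij by simp
  qed (auto simp: N_def A_def)
  then have "wronsk S (h # gs) x = Determinant.det N * Determinant.det A"
    using carr by (simp add: wronsk_det m_def[symmetric] det_mult)
  moreover have "Determinant.det A = h x ^ Suc m"
  proof -
    have "upper_triangular A" by (auto simp: upper_triangular_def A_def)
    then have "Determinant.det A = prod_list (diag_mat A)" using carr by (intro det_upper_triangular)
    also have "\<dots> = (\<Prod>i = 0..<Suc m. A $$ (i,i))" using carr by (simp add: prod_list_diag_prod)
    also have "\<dots> = (\<Prod>i = 0..<Suc m. h x)" by (rule prod.cong) (auto simp: A_def)
    finally show ?thesis by simp
  qed
  moreover have "Determinant.det N = wronsk S (map (rd h) gs) x"
  proof -
    have row0: "N $$ (0,j) = (if j = 0 then 1 else 0)" if "j < Suc m" for j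
    proof -
      have "N $$ (0,j) = hder S j (\<lambda>y. h y / h y) x" using that by (simp add: N_def ys_def)
      also have "\<dots> = hder S j (\<lambda>y. 1) x" by (rule hder_cong[OF _ x]) (simp add: h0)
      finally show ?thesis using hder_const[OF x] by simp
    qed
    have "Determinant.det N = (\<Sum>j<Suc m. N $$ (0,j) * cofactor N 0 j)"
      using carr by (intro laplace_expansion_row) auto
    also have "\<dots> = cofactor N 0 0"
      by (subst sum.lessThan_Suc_shift) (simp add: row0)
    also have "\<dots> = Determinant.det (mat_delete N 0 0)" by (simp add: cofactor_def)
    also have "mat_delete N 0 0 = Matrix.mat m m (\<lambda>(i,j). hder S j (map (rd h) gs ! i) x)" (is "_ = ?M")
    proof (rule eq_matI)
      fix i j assume "i < dim_row ?M"
        "j < dim_col ?M"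
      then have ij: "i < m" "j < m" by auto
      have "mat_delete N 0 0 $$ (i,j) = N $$ (Suc i, Suc j)"
        using ij by (simp add: mat_delete_def N_def)
      also have "\<dots> = hder S (Suc j) (ys ! Suc i) x" using ij by (simp add: N_def)
      also have "ys ! Suc i = (\<lambda>y. (gs ! i) y / h y)" using ij by (simp add: ys_def m_def)
      also have "hder S (Suc j) (\<lambda>y. (gs ! i) y / h y) x = hder S j (map (rd h) gs ! i) x"
        using ij by (simp add: m_def rd_def hder_shift)
      finally show "mat_delete N 0 0 $$ (i,j) = ?M $$ (i,j)"
        using ij by simp
    qed (auto simp: mat_delete_def N_def)
    finally show ?thesis by (simp add: wronsk_det m_def)
  qed
  ultimately show ?thesis by (simp add: m_def)
qed

text \<open>The tail \<open>hs\<close> stays in place so that W(phi_1, ..., phi_n, f) and W(phi_1,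
  ..., phi_n) change by the same sign, which cancels in their quotient.\<close>

lemma wronsk_permute_append:
  assumes p: "p permutes {..<length gs}"
  shows "wronsk S (permute_list p gs @ hs) x = of_int (sign p) * wronsk S (gs @ hs) x"
proof -
  let ?n = "length gs + length hs"
  let ?A = "Matrix.mat ?n ?n (\<lambda>(i,j). hder S j ((gs @ hs) ! i) x)"
  have p': "p permutes {0..<?n}" using p by (rule permutes_subset) auto
  have idx: "(permute_list p gs @ hs) ! i = (gs @ hs) ! p i" if "i < ?n" for i
  proof (cases "i < length gs")
    case True
    then show ?thesis using permute_list_nth[OF p True] permutes_in_image[OF p, of i] by (simp add: nth_append)
  next
    case False
    then have "p i = i" using p by (simp add: permutes_def)
    then show ?thesis using False by (simp add: nth_append)
  qed
  have "wronsk S (permute_list p gs @ hs) x = Determinant.det (Matrix.mat ?n ?n (\<lambda>(i,j). ?A $$ (p i, j)))"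
    unfolding wronsk_det using idx permutes_in_image[OF p'] 
    by (intro arg_cong[where f=Determinant.det] eq_matI) auto
  also have "\<dots> = of_int (sign p) * Determinant.det ?A"
    by (rule det_permute_rows[OF _ p']) simp
  finally show ?thesis by (simp add: wronsk_det)
qed

section \<open>Iterated reduction by a list of functions\<close>

text \<open>The remaining divisors are reduced along with u. Up to the product of the successive
  divisors this is W(xs, u) / W(xs), as \<open>wronsk_append\<close> shows.\<close>

function Dl :: "(real \<Rightarrow> real) list \<Rightarrow> (real \<Rightarrow> real) \<Rightarrow> real \<Rightarrow> real" where
  "Dl [] u = u"
| "Dl (h # hs) u = Dl (map (rd h) hs) (rd h u)"
  by pat_completeness auto
termination by (relation "Wellfounded.measure (\<lambda>(xs, u). length xs)") auto

text \<open>Unfolding from the right exposes the most recent divisor and so gives the recursion in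
  the number of reductions.\<close>

lemma Dl_append: "Dl (xs @ [h]) u = rd (Dl xs h) (Dl xs u)"
  by (induction xs u arbitrary: h rule: Dl.induct) simp_all

text \<open>Pulling out the head h costs one power of h more in W(h, hs, u) than in W(h, hs), so
  each reduction leaves exactly one factor, its own divisor.\<close>

lemma wronsk_append:
  assumes "x \<in> S" "\<And>g. g \<in> set xs \<Longrightarrow> diff_upto (length xs) x g" "diff_upto (length xs) x u"
    and "\<And>j y. j < length xs \<Longrightarrow> y \<in> S \<Longrightarrow> Dl (take j xs) (xs ! j) y \<noteq> 0"
  shows "wronsk S (xs @ [u]) x = wronsk S xs x * (\<Prod>j<length xs. Dl (take j xs) (xs ! j) x) * Dl xs u x"
  using assms
proof (induction xs u rule: Dl.induct)
  case (2 h hs u)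
  let ?m = "length hs" and ?ks = "map (rd h) hs"
  note x = "2.prems"(1)
  have h0: "h y \<noteq> 0" if "y \<in> S" for y using "2.prems"(4)[of 0 y] that by simp
  have dSuc: "diff_upto (Suc ?m) x g" if "g \<in> set (h # hs) \<or> g = u" for g
    using "2.prems"(2)[of g] "2.prems"(3) that by auto
  have IH: "wronsk S (?ks @ [rd h u]) x = wronsk S (?ks) x *
     (\<Prod>j<?m. Dl (take j (?ks)) (?ks ! j) x) * Dl (?ks) (rd h u) x"
  proof -
    have "wronsk S (?ks @ [rd h u]) x = wronsk S (?ks) x *
      (\<Prod>j<length (?ks). Dl (take j (?ks)) (?ks ! j) x) * Dl (?ks) (rd h u) x"
    proof (rule "2.IH"[OF x])
      show "diff_upto (length (?ks)) x g" if "g \<in> set (?ks)" for g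
        using that dSuc h0 x by (auto intro!: diff_upto_rd)
      show "diff_upto (length (?ks)) x (rd h u)"
        using dSuc h0 x by (auto intro!: diff_upto_rd)
      show "Dl (take j (?ks)) (?ks ! j) y \<noteq> 0" if "j < length (?ks)" "y \<in> S" for j y
        using "2.prems"(4)[of "Suc j" y] that by (simp add: take_map)
    qed
    then show ?thesis by simp
  qed
  have "wronsk S (h # (hs @ [u])) x = h x ^ Suc (length (hs @ [u])) * wronsk S (map (rd h) (hs @ [u])) x"
    by (rule wronsk_Cons[OF x h0]) (use dSuc in auto)
  also have "\<dots> = h x ^ Suc (Suc ?m) * wronsk S (?ks @ [rd h u]) x" by simp
  finally have 1: "wronsk S (h # (hs @ [u])) x = h x ^ Suc (Suc ?m) * wronsk S (?ks @ [rd h u]) x" .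
  have 2: "wronsk S (h # hs) x = h x ^ Suc ?m * wronsk S (?ks) x"
    by (rule wronsk_Cons[OF x h0]) (use dSuc diff_upto_SucD[OF _ x] in auto)
  have 3: "(\<Prod>j<length (h # hs). Dl (take j (h # hs)) ((h # hs) ! j) x)
      = h x * (\<Prod>j<?m. Dl (take j (?ks)) (?ks ! j) x)"
    by (simp add: prod.lessThan_Suc_shift take_map del: prod.lessThan_Suc)
  show ?case unfolding append_Cons 1 2 3 IH by (simp add: mult_ac)
qed simp

end


section \<open>Asymptotics on a half-open interval\<close>

definition locally_abs_cont :: "real set \<Rightarrow> (real \<Rightarrow> real) \<Rightarrow> bool" where
  "locally_abs_cont S g \<longleftrightarrow> (\<forall>a b. {a..b} \<subseteq> S \<longrightarrow> abs_cont_on a b g)"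

locale half_open =
  fixes T :: real and x0 :: ereal
  assumes T_less: "ereal T < x0"
begin

abbreviation "S \<equiv> Ivl T x0"
abbreviation "F \<equiv> lnbhd x0"

lemma T_in: "T \<in> S"
  using T_less by (simp add: Ivl_def)

lemma S_ge: "x \<in> S \<Longrightarrow> T \<le> x"
  by (simp add: Ivl_def)

lemma S_down: "y \<in> S \<Longrightarrow> T \<le> x \<Longrightarrow> x \<le> y \<Longrightarrow> x \<in> S"
  unfolding Ivl_def by (auto intro: le_less_trans[of "ereal x" "ereal y"])

lemma S_sub: "a \<in> S \<Longrightarrow> b \<in> S \<Longrightarrow> {a..b} \<subseteq> S"
  using S_down S_ge by (meson atLeastAtMost_iff order_trans subsetI)

lemma S_no_max: "x \<in> S \<Longrightarrow> \<exists>y\<in>S. x < y"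
proof -
  assume x: "x \<in> S"
  then have "ereal x < x0" by (simp add: Ivl_def)
  then obtain y where "ereal x < ereal y" "ereal y < x0" using ereal_dense2 by blast
  then show ?thesis using S_ge[OF x] by (intro bexI[of _ y]) (auto simp: Ivl_def)
qed

text \<open>Finite and infinite x0 are distinguished only here; afterwards a neighbourhood of the
  end point is simply everything in S beyond some b.\<close>

lemma eventually_F: "eventually P F \<longleftrightarrow> (\<exists>b\<in>S. \<forall>x\<in>S. b \<le> x \<longrightarrow> P x)"
proof (cases "x0 = \<infinity>")
  case True
  show ?thesis
  proof
    assume "eventually P F"
    then obtain N where N: "\<forall>n\<ge>N. P n" using True by (auto simp: lnbhd_def eventually_at_top_linorder)
    show "\<exists>b\<in>S. \<forall>x\<in>S. b \<le> x \<longrightarrow> P x"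
      by (rule bexI[of _ "max N T"]) (use N True in \<open>auto simp: Ivl_def\<close>)
  next
    assume "\<exists>b\<in>S. \<forall>x\<in>S. b \<le> x \<longrightarrow> P x"
    then obtain b where b: "b \<in> S" "\<forall>x\<in>S. b \<le> x \<longrightarrow> P x" by blast
    have "\<forall>x\<ge>b. P x" using b True by (auto simp: Ivl_def)
    then show "eventually P F" using True by (auto simp: lnbhd_def eventually_at_top_linorder)
  qed
next
  case False
  then obtain r where r: "x0 = ereal r" using T_less by (cases x0) auto
  have S: "S = {T..<r}" by (auto simp: Ivl_def r)
  have Tr: "T < r" using T_less r by simp
  have F: "F = at_left r" by (simp add: lnbhd_def r)
  show ?thesis unfolding F eventually_at_left[OF Tr] S
  proof
    assume "\<exists>b<r. \<forall>y>b. y < r \<longrightarrow> P y"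
    then obtain b where b: "b < r" "\<forall>y>b. y < r \<longrightarrow> P y" by blast
    show "\<exists>b\<in>{T..<r}. \<forall>x\<in>{T..<r}. b \<le> x \<longrightarrow> P x"
    proof (rule bexI[of _ "max T ((b + r) / 2)"])
      show "max T ((b + r) / 2) \<in> {T..<r}" using b Tr by auto
      show "\<forall>x\<in>{T..<r}. max T ((b + r) / 2) \<le> x \<longrightarrow> P x"
      proof (intro ballI impI)
        fix x assume x: "x \<in> {T..<r}" "max T ((b + r) / 2) \<le> x"
        then have "(b + r) / 2 \<le> x" by simp
        then have "b < x" using b(1) by (simp add: field_simps)
        then show "P x" using b(2) x(1) by simp
      qed
    qed
  next
    assume "\<exists>b\<in>{T..<r}. \<forall>x\<in>{T..<r}. b \<le> x \<longrightarrow> P x"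
    then obtain b where b: "b \<in> {T..<r}" "\<forall>x\<in>{T..<r}. b \<le> x \<longrightarrow> P x" by blast
    show "\<exists>b<r. \<forall>y>b. y < r \<longrightarrow> P y"
      by (rule exI[of _ b]) (use b in auto)
  qed
qed

lemma eventually_F_I: "(\<And>x. x \<in> S \<Longrightarrow> P x) \<Longrightarrow> eventually P F"
  unfolding eventually_F using T_in by blast

lemma eventually_F_ge: "b \<in> S \<Longrightarrow> (\<And>x. x \<in> S \<Longrightarrow> b \<le> x \<Longrightarrow> P x) \<Longrightarrow> eventually P F"
  unfolding eventually_F by blast

lemma F_neq_bot [simp]: "F \<noteq> bot"
proof -
  have "\<not> eventually (\<lambda>_. False) F" unfolding eventually_F by blast
  then show ?thesis by (simp add: trivial_limit_def)
qed

lemma eventually_F_obtain: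
  assumes "eventually P F" "c \<in> S"
  obtains b where "b \<in> S" "c \<le> b" "\<And>x. x \<in> S \<Longrightarrow> b \<le> x \<Longrightarrow> P x"
proof -
  obtain b where b: "b \<in> S" "\<forall>x\<in>S. b \<le> x \<longrightarrow> P x" using assms(1) unfolding eventually_F by blast
  show ?thesis by (rule that[of "max b c"]) (use b assms(2) in \<open>auto simp: max_def split: if_splits\<close>)
qed

sublocale perfect_set S
proof
  fix x assume x: "x \<in> S"
  obtain y where y: "y \<in> S" "x < y" using S_no_max[OF x] by blast
  have "at x within {x..y} \<le> at x within S" by (rule at_le[OF S_sub[OF x y(1)]])
  moreover have "at x within {x..y} \<noteq> bot" using y(2) by (simp add: at_within_Icc_at_right)
  ultimately show "at x within S \<noteq> bot" by (metis bot.extremum_unique)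
qed

lemma locally_abs_cont_continuous:
  assumes g: "locally_abs_cont S g"
  shows "continuous_on S g"
  unfolding continuous_on_iff
proof (intro ballI allI impI)
  fix x e :: real assume x: "x \<in> S" and e: "e > 0"
  obtain y where y: "y \<in> S" "x < y" using S_no_max[OF x] by blast
  have "continuous_on {T..y} g"
    using g S_sub[OF T_in y(1)] unfolding locally_abs_cont_def by (blast intro: abs_cont_on_imp_continuous_on)
  then obtain d where d: "d > 0" "\<forall>x'\<in>{T..y}. dist x' x < d \<longrightarrow> dist (g x') (g x) < e"
    unfolding continuous_on_iff using x y e S_ge[OF x] by (meson atLeastAtMost_iff less_imp_le)
  show "\<exists>d>0. \<forall>x'\<in>S. dist x' x < d \<longrightarrow> dist (g x') (g x) < e"
  proof (intro exI[of _ "min d (y - x)"] conjI ballI impI)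
    show "min d (y - x) > 0" using d y by simp
    fix x' assume "x' \<in> S" "dist x' x < min d (y - x)"
    then show "dist (g x') (g x) < e" using d(2) S_ge by (auto simp: dist_real_def)
  qed
qed

lemma interior_at: "x \<in> S \<Longrightarrow> T < x \<Longrightarrow> at x within S = at x"
proof -
  assume x: "x \<in> S" "T < x"
  obtain y where y: "y \<in> S" "x < y" using S_no_max[OF x(1)] by blast
  have "{T<..<y} \<subseteq> S" using S_sub[OF T_in y(1)] by auto
  then have "x \<in> interior S" using x y by (intro interiorI[of "{T<..<y}"]) auto
  then show ?thesis by (rule at_within_interior)
qed

lemma mean_value:
  assumes "\<And>x. x \<in> S \<Longrightarrow> (f has_real_derivative f' x) (at x within S)" "x \<in> S" "y \<in> S" "x < y"
  obtains z where "x < z" "z < y" "z \<in> S" "f y - f x = (y - x) * f' z"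
proof -
  have sub: "{x..y} \<subseteq> S" using assms S_sub by blast
  have "continuous_on S f" using assms(1) DERIV_continuous continuous_on_eq_continuous_within by blast
  then have c: "continuous_on {x..y} f" using sub continuous_on_subset by blast
  have d: "(f has_real_derivative f' z) (at z)" if "x < z" "z < y" for z
  proof -
    have "z \<in> S" "T < z" using sub that S_ge[OF assms(2)] by auto
    then show ?thesis using assms(1)[of z] interior_at by simp
  qed
  obtain l z where z: "x < z" "z < y" "(f has_real_derivative l) (at z)" "f y - f x = (y - x) * l"
    using MVT[OF assms(4) c] d real_differentiable_def by blast
  have "l = f' z" using DERIV_unique[OF z(3) d[OF z(1,2)]] .
  moreover have "z \<in> S" using z(1,2) sub by auto
  ultimately show ?thesis using that[of z] z by simp
qed

sublocale regularity_class S "locally_abs_cont S"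
proof
  fix g h g' :: "real \<Rightarrow> real" and c
  show "locally_abs_cont S h" if "\<And>x. x \<in> S \<Longrightarrow> g x = h x" "locally_abs_cont S g"
    unfolding locally_abs_cont_def
  proof (intro allI impI)
    fix a b assume ab: "{a..b} \<subseteq> S"
    then have g: "abs_cont_on a b g" using that(2) by (simp add: locally_abs_cont_def)
    show "abs_cont_on a b h"
    proof (rule abs_cont_on_dominated[where M=1, OF g g])
      fix u v assume "a \<le> u" "u \<le> v" "v \<le> b"
      then have "u \<in> S" "v \<in> S" using ab by auto
      then show "\<bar>h v - h u\<bar> \<le> 1 * (\<bar>g v - g u\<bar> + \<bar>g v - g u\<bar>)" using that(1) by simp
    qed
  qed
  show "locally_abs_cont S g"
    if der: "\<And>x. x \<in> S \<Longrightarrow> (g has_real_derivative g' x) (at x within S)" and g': "locally_abs_cont S g'"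
    unfolding locally_abs_cont_def
  proof (intro allI impI)
    fix a b assume ab: "{a..b} \<subseteq> S"
    \<comment> \<open>A bound for g' on the compact interval makes g Lipschitz there by the mean
      value theorem.\<close>
    obtain M where M: "M > 0" "\<And>x. a \<le> x \<Longrightarrow> x \<le> b \<Longrightarrow> \<bar>g' x\<bar> \<le> M"
      using abs_cont_on_bounded g' ab unfolding locally_abs_cont_def by blast
    show "abs_cont_on a b g"
    proof (rule abs_cont_on_dominated[where M=M, OF abs_cont_on_ident abs_cont_on_ident])
      fix u v assume uv: "a \<le> u" "u \<le> v" "v \<le> b"
      then have uvS: "u \<in> S" "v \<in> S" using ab by auto
      show "\<bar>g v - g u\<bar> \<le> M * (\<bar>v - u\<bar> + \<bar>v - u\<bar>)"
      proof (cases "u < v")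
        case True
        obtain z where z: "u < z" "z < v" "g v - g u = (v - u) * g' z"
          using mean_value[OF der uvS True] by blast
        have "\<bar>g v - g u\<bar> = \<bar>g' z\<bar> * (v - u)" using z True by (simp add: abs_mult)
        also have "\<dots> \<le> M * (v - u)" using M(2)[of z] z uv by (intro mult_right_mono) auto
        also have "\<dots> \<le> M * (\<bar>v - u\<bar> + \<bar>v - u\<bar>)" using M(1) uv by (intro mult_left_mono) auto
        finally show ?thesis .
      qed (use uv in simp)
    qed
  qed
  show "locally_abs_cont S (\<lambda>_. c)" by (simp add: locally_abs_cont_def abs_cont_on_const)
  show "locally_abs_cont S (\<lambda>x. g x + h x)" if "locally_abs_cont S g" "locally_abs_cont S h"
    using that by (simp add: locally_abs_cont_def abs_cont_on_add)
  show "locally_abs_cont S (\<lambda>x. g x * h x)" if "locally_abs_cont S g" "locally_abs_cont S h"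
    using that by (simp add: locally_abs_cont_def abs_cont_on_mult)
  show "locally_abs_cont S (\<lambda>x. inverse (g x))" if "locally_abs_cont S g" "\<And>x. x \<in> S \<Longrightarrow> g x \<noteq> 0"
    using that unfolding locally_abs_cont_def by (auto intro!: abs_cont_on_inverse)
qed

lemma ACk_iff_R: "ACk S k g \<longleftrightarrow> R k g"
  by (simp add: ACk_def Reg_def locally_abs_cont_def)

lemma R_continuous: "R k g \<Longrightarrow> continuous_on S g"
  using R_mono[of k g 0] locally_abs_cont_continuous by simp

lemma R_diff_upto: "R k g \<Longrightarrow> l \<le> k \<Longrightarrow> x \<in> S \<Longrightarrow> diff_upto l x g"
  unfolding Reg_def diff_upto_def by simp

section \<open>Signs and zeros near the end point\<close>

lemma sgn_constant:
  assumes c: "continuous_on S f" and b: "b \<in> S" and nz: "\<And>x. x \<in> S \<Longrightarrow> b \<le> x \<Longrightarrow> f x \<noteq> 0"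
    and x: "x \<in> S" "b \<le> x"
  shows "sgn (f x) = sgn (f b :: real)"
proof (rule ccontr)
  assume ne: "sgn (f x) \<noteq> sgn (f b)"
  have c': "continuous_on {b..x} f" using c S_sub[OF b x(1)] continuous_on_subset by blast
  have "f b \<le> 0 \<and> 0 \<le> f x \<or> f x \<le> 0 \<and> 0 \<le> f b" using ne by (auto simp: sgn_if split: if_splits)
  then obtain z where "b \<le> z" "z \<le> x" "f z = 0"
    using IVT'[of f b 0 x] IVT2'[of f x 0 b] c' x(2) by blast
  then show False using nz[of z] S_sub[OF b x(1)] by auto
qed

lemma eventually_const_sign:
  fixes f :: "real \<Rightarrow> real"
  assumes c: "continuous_on S f" and nz: "eventually (\<lambda>x. f x \<noteq> 0) F"
  shows "eventually (\<lambda>x. f x > 0) F \<or> eventually (\<lambda>x. f x < 0) F"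
proof -
  obtain b where b: "b \<in> S" "\<And>x. x \<in> S \<Longrightarrow> b \<le> x \<Longrightarrow> f x \<noteq> 0" using nz unfolding eventually_F by blast
  have sg: "sgn (f x) = sgn (f b)" if "x \<in> S" "b \<le> x" for x by (rule sgn_constant[OF c b that])
  have "f b > 0 \<or> f b < 0" using b(2)[OF b(1)] by auto
  then show ?thesis
  proof
    assume "f b > 0"
    then have "f x > 0" if "x \<in> S" "b \<le> x" for x using sg[OF that] by (simp add: sgn_1_pos)
    then show ?thesis using b(1) by (blast intro: eventually_F_ge)
  next
    assume "f b < 0"
    then have "f x < 0" if "x \<in> S" "b \<le> x" for x using sg[OF that] by (simp add: sgn_1_neg)
    then show ?thesis using b(1) by (blast intro: eventually_F_ge)
  qed
qed

text \<open>By Rolle, f has at most one zero beyond the last zero of f', and S continues past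
  it.\<close>

lemma eventually_nonzero_antiderivative:
  assumes d: "\<And>x. x \<in> S \<Longrightarrow> (f has_real_derivative f' x) (at x within S)"
    and nz: "eventually (\<lambda>x. f' x \<noteq> 0) F"
  shows "eventually (\<lambda>x. f x \<noteq> 0) F"
proof -
  obtain b where b: "b \<in> S" "\<forall>x\<in>S. b \<le> x \<longrightarrow> f' x \<noteq> 0" using nz unfolding eventually_F by blast
  have inj: False if xy: "x \<in> S" "y \<in> S" "b \<le> x" "x < y" "f x = 0" "f y = 0" for x y
  proof -
    obtain z where "x < z" "z \<in> S" "f y - f x = (y - x) * f' z" using mean_value[OF d xy(1,2,4)] by blast
    then show False using xy b(2) by auto
  qed
  show ?thesis
  proof (cases "\<exists>z\<in>S. b \<le> z \<and> f z = 0")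
    case True
    then obtain z where z: "z \<in> S" "b \<le> z" "f z = 0" by blast
    obtain y where y: "y \<in> S" "z < y" using S_no_max[OF z(1)] by blast
    show ?thesis
      by (rule eventually_F_ge[OF y(1)]) (use inj[OF z(1) _ z(2) _ z(3)] y in force)
  next
    case False
    then show ?thesis using b(1) by (blast intro: eventually_F_ge)
  qed
qed

lemma increasing_from:
  assumes d: "\<And>x. x \<in> S \<Longrightarrow> (f has_real_derivative f' x) (at x within S)"
    and pos: "\<And>x. x \<in> S \<Longrightarrow> b \<le> x \<Longrightarrow> f' x > 0" and "x \<in> S" "y \<in> S" "b \<le> x" "x < y"
  shows "f x < f y"
proof -
  obtain z where z: "x < z" "z \<in> S" "f y - f x = (y - x) * f' z" using mean_value[OF d assms(3,4,6)] by blast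
  have "(y - x) * f' z > 0" using pos[OF z(2)] z(1) assms by auto
  then show ?thesis using z(3) by linarith
qed

lemma increasing_to_zero_neg:
  assumes inc: "\<And>x y. x \<in> S \<Longrightarrow> y \<in> S \<Longrightarrow> b \<le> x \<Longrightarrow> x < y \<Longrightarrow> f x < f y"
    and lim: "(f \<longlongrightarrow> (0::real)) F" and x: "x \<in> S" "b \<le> x"
  shows "f x < 0"
proof -
  obtain y where y: "y \<in> S" "x < y" using S_no_max[OF x(1)] by blast
  have "eventually (\<lambda>z. f y \<le> f z) F"
  proof (rule eventually_F_ge[OF y(1)])
    fix z assume "z \<in> S" "y \<le> z"
    then show "f y \<le> f z" using inc[of y z] y x by (cases "y = z") auto
  qed
  then have "f y \<le> 0" using tendsto_lowerbound[OF lim] by simp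
  then show ?thesis using inc[of x y] x y by auto
qed

section \<open>L'Hospital's rule in the reverse direction\<close>

text \<open>The only alternative is G' > c H' near the end point, which makes G - c H and H both
  increasing. If G and H tend to 0, then G < c H < 0; if |H| is unbounded, then H becomes large and
  positive while G \<ge> c H + const. Either way |G| < (c/2) |H| fails.\<close>

lemma deriv_ratio_less:
  assumes dG: "\<And>x. x \<in> S \<Longrightarrow> (G has_real_derivative G' x) (at x within S)"
    and dH: "\<And>x. x \<in> S \<Longrightarrow> (H has_real_derivative H' x) (at x within S)"
    and cont: "continuous_on S G'" "continuous_on S H'"
    and lim: "((\<lambda>x. G x / H x) \<longlongrightarrow> 0) F"
    and alt: "(G \<longlongrightarrow> 0) F \<and> (H \<longlongrightarrow> 0) F \<or> filterlim (\<lambda>x. \<bar>H x\<bar>) at_top F"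
    and pos: "eventually (\<lambda>x. H' x > 0) F" and c: "c > 0"
    and nz: "eventually (\<lambda>x. G' x - c * H' x \<noteq> 0) F"
  shows "eventually (\<lambda>x. G' x < c * H' x) F"
proof -
  have "continuous_on S (\<lambda>x. G' x - c * H' x)" using cont by (intro continuous_intros)
  then consider "eventually (\<lambda>x. G' x - c * H' x > 0) F" | "eventually (\<lambda>x. G' x - c * H' x < 0) F"
    using eventually_const_sign[OF _ nz] by blast
  then show ?thesis
  proof cases
    case 1
    have small: "eventually (\<lambda>x. \<bar>G x / H x\<bar> < c / 2) F"
      using lim c by (auto dest: tendstoD[of _ _ _ "c/2"] simp: dist_real_def)
    obtain b where b: "b \<in> S" "\<And>x. x \<in> S \<Longrightarrow> b \<le> x \<Longrightarrow> G' x - c * H' x > 0 \<and> H' x > 0 \<and> \<bar>G x / H x\<bar> < c / 2"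
      using eventually_conj[OF 1 eventually_conj[OF pos small]] unfolding eventually_F by blast
    define K where "K = (\<lambda>x. G x - c * H x)"
    have dK: "(K has_real_derivative G' x - c * H' x) (at x within S)" if "x \<in> S" for x
      unfolding K_def using dG dH that by (intro DERIV_diff DERIV_cmult)
    have incK: "K x < K y" if "x \<in> S" "y \<in> S" "b \<le> x" "x < y" for x y
      by (rule increasing_from[OF dK _ that]) (use b in auto)
    have incH: "H x < H y" if "x \<in> S" "y \<in> S" "b \<le> x" "x < y" for x y
      by (rule increasing_from[OF dH _ that]) (use b in auto)
    have GH: "\<bar>G x\<bar> < c / 2 * \<bar>H x\<bar>" if "x \<in> S" "b \<le> x" "H x \<noteq> 0" for x
      using b(2)[OF that(1,2)] that(3) by (simp add: abs_divide divide_less_eq)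
    from alt have False
    proof
      assume z: "(G \<longlongrightarrow> 0) F \<and> (H \<longlongrightarrow> 0) F"
      have "(K \<longlongrightarrow> 0 - c * 0) F" unfolding K_def using z by (intro tendsto_intros) auto
      then have Kb: "K b < 0" using increasing_to_zero_neg[where f=K, OF incK _ b(1) order_refl] by simp
      have Hb: "H b < 0" using increasing_to_zero_neg[where f=H, OF incH _ b(1) order_refl] z by simp
      have "c * H b < 0" using c Hb by (simp add: mult_pos_neg)
      then show False using GH[OF b(1)] Kb Hb unfolding K_def by (simp add: abs_if)
    next
      assume "filterlim (\<lambda>x. \<bar>H x\<bar>) at_top F"
      \<comment> \<open>Since H increases, exceeding |H b| in modulus forces H x > 0; the remaining
        terms make (c/2) H x larger than |K b|.\<close>
      then have "eventually (\<lambda>x. \<bar>H x\<bar> \<ge> \<bar>H b\<bar> + 2 * \<bar>K b\<bar> / c + 1) F" by (simp add: filterlim_at_top)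
      then obtain x where x: "x \<in> S" "b \<le> x" "\<bar>H x\<bar> \<ge> \<bar>H b\<bar> + 2 * \<bar>K b\<bar> / c + 1"
        using eventually_F_obtain[OF _ b(1)] by (metis order_refl)
      have k0: "2 * \<bar>K b\<bar> / c \<ge> 0" using c by simp
      have "H b \<le> H x" "K b \<le> K x" using incH[OF b(1) x(1) order_refl] incK[OF b(1) x(1) order_refl] x(2)
        by (cases "b = x"; simp)+
      then have Hx: "H x \<ge> 2 * \<bar>K b\<bar> / c + 1" "H x > 0" using x(3) k0 by linarith+
      have "G x < c / 2 * H x" using GH[OF x(1,2)] Hx by auto
      moreover have "G x \<ge> c * H x + K b" using \<open>K b \<le> K x\<close> by (simp add: K_def)
      ultimately have "c / 2 * H x < \<bar>K b\<bar>" by (simp add: field_simps)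
      moreover have "c / 2 * H x \<ge> c / 2 * (2 * \<bar>K b\<bar> / c + 1)" using Hx c by (intro mult_left_mono) auto
      moreover have "c / 2 * (2 * \<bar>K b\<bar> / c + 1) = \<bar>K b\<bar> + c / 2" using c by (simp add: field_simps)
      ultimately show False using c by linarith
    qed
    then show ?thesis ..
  next
    case 2
    then show ?thesis by (rule eventually_mono) simp
  qed
qed

lemma deriv_ratio_abs_less:
  assumes dG: "\<And>x. x \<in> S \<Longrightarrow> (G has_real_derivative G' x) (at x within S)"
    and dH: "\<And>x. x \<in> S \<Longrightarrow> (H has_real_derivative H' x) (at x within S)"
    and cont: "continuous_on S G'" "continuous_on S H'"
    and lim: "((\<lambda>x. G x / H x) \<longlongrightarrow> 0) F"
    and alt: "(G \<longlongrightarrow> 0) F \<and> (H \<longlongrightarrow> 0) F \<or> filterlim (\<lambda>x. \<bar>H x\<bar>) at_top F"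
    and pos: "eventually (\<lambda>x. H' x > 0) F" and e: "e > 0"
    and nz: "\<And>c. eventually (\<lambda>x. G' x - c * H' x \<noteq> 0) F"
  shows "eventually (\<lambda>x. \<bar>G' x\<bar> < e * H' x) F"
proof -
  have "eventually (\<lambda>x. G' x < e * H' x) F"
    by (rule deriv_ratio_less[OF dG dH cont lim alt pos e nz])
  moreover have "eventually (\<lambda>x. - G' x < e * H' x) F"
  proof (rule deriv_ratio_less[OF _ dH _ cont(2) _ _ pos e])
    show "((\<lambda>x. - G x) has_real_derivative - G' x) (at x within S)" if "x \<in> S" for x
      using dG[OF that] by (rule DERIV_minus)
    show "((\<lambda>x. - G x / H x) \<longlongrightarrow> 0) F" using tendsto_minus[OF lim] by simp
    show "((\<lambda>x. - G x) \<longlongrightarrow> 0) F \<and> (H \<longlongrightarrow> 0) F \<or> filterlim (\<lambda>x. \<bar>H x\<bar>) at_top F"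
      using alt tendsto_minus[of G 0 F] by auto
    show "eventually (\<lambda>x. - G' x - e * H' x \<noteq> 0) F" by (rule eventually_mono[OF nz[of "-e"]]) auto
  qed (use cont in \<open>auto intro: continuous_on_minus\<close>)
  ultimately show ?thesis by eventually_elim auto
qed

lemma deriv_ratio_tendsto:
  assumes dG: "\<And>x. x \<in> S \<Longrightarrow> (G has_real_derivative G' x) (at x within S)"
    and dH: "\<And>x. x \<in> S \<Longrightarrow> (H has_real_derivative H' x) (at x within S)"
    and cont: "continuous_on S G'" "continuous_on S H'"
    and lim: "((\<lambda>x. G x / H x) \<longlongrightarrow> 0) F"
    and alt: "(G \<longlongrightarrow> 0) F \<and> (H \<longlongrightarrow> 0) F \<or> filterlim (\<lambda>x. \<bar>H x\<bar>) at_top F"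
    and nzH: "eventually (\<lambda>x. H' x \<noteq> 0) F"
    and nz: "\<And>c. eventually (\<lambda>x. G' x - c * H' x \<noteq> 0) F"
  shows "((\<lambda>x. G' x / H' x) \<longlongrightarrow> 0) F"
proof (rule tendstoI)
  fix e :: real assume e: "e > 0"
  consider "eventually (\<lambda>x. H' x > 0) F" | "eventually (\<lambda>x. H' x < 0) F"
    using eventually_const_sign[OF cont(2) nzH] by blast
  then have "eventually (\<lambda>x. \<bar>G' x\<bar> < e * \<bar>H' x\<bar>) F"
  proof cases
    case 1
    have "eventually (\<lambda>x. \<bar>G' x\<bar> < e * H' x) F"
      by (rule deriv_ratio_abs_less[OF dG dH cont lim alt 1 e nz])
    with 1 show ?thesis by eventually_elim auto
  next
    case 2
    have "eventually (\<lambda>x. \<bar>G' x\<bar> < e * - H' x) F"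
    proof (rule deriv_ratio_abs_less[OF dG _ cont(1) _ _ _ _ e])
      show "((\<lambda>x. - H x) has_real_derivative - H' x) (at x within S)" if "x \<in> S" for x
        using dH[OF that] by (rule DERIV_minus)
      show "((\<lambda>x. G x / - H x) \<longlongrightarrow> 0) F" using tendsto_minus[OF lim] by simp
      show "(G \<longlongrightarrow> 0) F \<and> ((\<lambda>x. - H x) \<longlongrightarrow> 0) F \<or> filterlim (\<lambda>x. \<bar>- H x\<bar>) at_top F"
        using alt tendsto_minus[of H 0 F] by auto
      show "eventually (\<lambda>x. - H' x > 0) F" using 2 by (rule eventually_mono) simp
      show "eventually (\<lambda>x. G' x - c * - H' x \<noteq> 0) F" for c using nz[of "-c"] by simp
    qed (use cont in \<open>auto intro: continuous_on_minus\<close>)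
    with 2 show ?thesis by eventually_elim auto
  qed
  then show "eventually (\<lambda>x. dist (G' x / H' x) 0 < e) F"
    using nzH by eventually_elim (simp add: abs_divide divide_less_eq)
qed

end


context half_open
begin

section \<open>Chebyshev asymptotic scales\<close>

text \<open>The required smoothness is tied to the length of the list, so that a reduction, which
  costs one derivative and one function, stays within the definition.\<close>

definition cheb :: "(real \<Rightarrow> real) list \<Rightarrow> bool" where
  "cheb gs \<longleftrightarrow> (\<forall>g\<in>set gs. R (length gs - 1) g) \<and> (\<forall>i\<le>length gs. \<forall>x\<in>S. wronsk S (take i gs) x \<noteq> 0)"

lemma cheb_hd_nonzero: "cheb (h # gs) \<Longrightarrow> x \<in> S \<Longrightarrow> h x \<noteq> 0"
  unfolding cheb_def by (auto dest!: spec[of _ 1])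

lemma wronsk_Cons_R:
  assumes "x \<in> S" "\<And>y. y \<in> S \<Longrightarrow> h y \<noteq> 0" "R (length gs) h" "\<And>g. g \<in> set gs \<Longrightarrow> R (length gs) g"
  shows "wronsk S (h # gs) x = h x ^ Suc (length gs) * wronsk S (map (rd h) gs) x"
  by (rule wronsk_Cons) (use assms R_diff_upto in blast)+

lemma cheb_rd:
  assumes c: "cheb (h # gs)"
  shows "cheb (map (rd h) gs)"
  unfolding cheb_def
proof (intro conjI ballI allI impI)
  note h0 = cheb_hd_nonzero[OF c]
  have R: "R (length gs) g" if "g \<in> set (h # gs)" for g using c that unfolding cheb_def by auto
  show "R (length (map (rd h) gs) - 1) g" if g: "g \<in> set (map (rd h) gs)" for g
  proof -
    obtain g' where g': "g' \<in> set gs" "g = rd h g'" using g by auto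
    then obtain m where m: "length gs = Suc m" by (cases gs) auto
    show ?thesis unfolding g'(2) using R_rd[of m g' h] R[of g'] R[of h] g'(1) h0 m by simp
  qed
  fix i x assume i: "i \<le> length (map (rd h) gs)" and x: "x \<in> S"
  have "wronsk S (h # take i gs) x = h x ^ Suc (length (take i gs)) * wronsk S (map (rd h) (take i gs)) x"
  proof (rule wronsk_Cons_R[OF x h0])
    show "R (length (take i gs)) h" by (rule R_mono[OF R]) auto
    show "R (length (take i gs)) g" if "g \<in> set (take i gs)" for g
      by (rule R_mono[OF R]) (use that in \<open>auto dest: in_set_takeD\<close>)
  qed
  moreover have "wronsk S (take (Suc i) (h # gs)) x \<noteq> 0" using c i x unfolding cheb_def by auto
  ultimately show "wronsk S (take i (map (rd h) gs)) x \<noteq> 0" by (simp add: take_map)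
qed

lemma cheb_R: "cheb gs \<Longrightarrow> i < length gs \<Longrightarrow> R (length gs - 1) (gs ! i)"
  unfolding cheb_def by simp

text \<open>Dividing by the head and differentiating kills its coefficient and leaves a combination
  of the reduced list; Rolle carries nonvanishing back. If no other coefficient is nonzero, the
  quotient is a nonzero constant.\<close>

lemma cheb_combination_nonzero:
  assumes "cheb gs" "i < length gs" "c i \<noteq> 0"
  shows "eventually (\<lambda>x. (\<Sum>j<length gs. c j * (gs ! j) x) \<noteq> 0) F"
  using assms
proof (induction "length gs" arbitrary: gs c i)
  case (Suc m)
  then obtain h hs where gs: "gs = h # hs" by (cases gs) auto
  have m: "m = length hs" using Suc.hyps(2) gs by simp
  note h0 = cheb_hd_nonzero[OF Suc.prems(1)[unfolded gs]]
  define K where "K = (\<lambda>x. c 0 + (\<Sum>j<length hs. c (Suc j) * ((hs ! j) x / h x)))"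
  have expand: "(\<Sum>j<length gs. c j * (gs ! j) x) = h x * (K x)" if "x \<in> S" for x
    using h0[OF that] unfolding gs K_def
    by (simp add: sum.lessThan_Suc_shift sum_distrib_left distrib_left mult.left_commute mult.commute del: sum.lessThan_Suc)
  have "eventually (\<lambda>x. K x \<noteq> 0) F"
  proof (cases "\<exists>j<length hs. c (Suc j) \<noteq> 0")
    case True
    then obtain j where j: "j < length hs" "c (Suc j) \<noteq> 0" by blast
    then obtain l where l: "length hs = Suc l" by (cases "length hs") auto
    have "eventually (\<lambda>x. (\<Sum>j<length (map (rd h) hs). c (Suc j) * (map (rd h) hs ! j) x) \<noteq> 0) F"
      by (rule Suc.hyps(1)[where i=j]) (use m j cheb_rd[OF Suc.prems(1)[unfolded gs]] in auto)
    then have ev: "eventually (\<lambda>x. (\<Sum>j<length hs. c (Suc j) * rd h (hs ! j) x) \<noteq> 0) F" by simp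
    have Rh: "R (Suc l) h" "R (Suc l) (hs ! j)" if "j < length hs" for j
      using cheb_R[OF Suc.prems(1), of 0] cheb_R[OF Suc.prems(1), of "Suc j"] that unfolding gs l[symmetric] by auto
    show ?thesis
    proof (rule eventually_nonzero_antiderivative[OF _ ev])
      fix x assume x: "x \<in> S"
      have "(K has_real_derivative 0 + (\<Sum>j<length hs. c (Suc j) * rd h (hs ! j) x)) (at x within S)"
        unfolding K_def by (intro DERIV_add DERIV_const DERIV_sum DERIV_cmult rd_deriv[of l] Rh h0 x) auto
      then show "(K has_real_derivative
          (\<Sum>j<length hs. c (Suc j) * rd h (hs ! j) x)) (at x within S)" by simp
    qed
  next
    case False
    then have "i = 0" using Suc.prems gs by (cases i) auto
    then have "c 0 \<noteq> 0" using Suc.prems by simp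
    then show ?thesis unfolding K_def using False by (intro eventually_F_I) auto
  qed
  then obtain b where b: "b \<in> S" "\<And>x. x \<in> S \<Longrightarrow> b \<le> x \<Longrightarrow> K x \<noteq> 0"
    unfolding eventually_F by blast
  show ?case
    by (rule eventually_F_ge[OF b(1)]) (use expand b(2) h0 in simp)
qed simp

text \<open>Applied to a reduced list, this provides for every c the nonvanishing of G' - c H' on
  which the reversed l'Hospital rule rests.\<close>

lemma cheb_two_nonzero:
  assumes "cheb gs" "i < length gs" "j < length gs" "i \<noteq> j"
  shows "eventually (\<lambda>x. (gs ! j) x - c * (gs ! i) x \<noteq> 0) F"
proof -
  let ?c = "\<lambda>k. if k = j then 1 else if k = i then - c else 0"
  have "eventually (\<lambda>x. (\<Sum>k<length gs. ?c k * (gs ! k) x) \<noteq> 0) F"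
    by (rule cheb_combination_nonzero[OF assms(1,3)]) simp
  moreover have "(\<Sum>k<length gs. ?c k * (gs ! k) x) = (gs ! j) x - c * (gs ! i) x" for x
  proof -
    have "(\<Sum>k<length gs. ?c k * (gs ! k) x) = (\<Sum>k\<in>{i,j}. ?c k * (gs ! k) x)"
      by (rule sum.mono_neutral_right) (use assms in auto)
    then show ?thesis using assms(4) by simp
  qed
  ultimately show ?thesis by simp
qed

lemma cheb_one_nonzero:
  assumes "cheb gs" "i < length gs"
  shows "eventually (\<lambda>x. (gs ! i) x \<noteq> 0) F"
proof -
  let ?c = "\<lambda>k. if k = i then 1 else 0 :: real"
  have "eventually (\<lambda>x. (\<Sum>k<length gs. ?c k * (gs ! k) x) \<noteq> 0) F"
    by (rule cheb_combination_nonzero[OF assms(1,2)]) simp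
  moreover have "(\<Sum>k<length gs. ?c k * (gs ! k) x) = (gs ! i) x" for x
    using assms(2) by (simp add: if_distrib[of "\<lambda>u. u * _"] cong: if_cong)
  ultimately show ?thesis by simp
qed

definition scale :: "(real \<Rightarrow> real) list \<Rightarrow> bool" where
  "scale gs \<longleftrightarrow> cheb gs \<and> (\<forall>i. Suc i < length gs \<longrightarrow> ((\<lambda>x. (gs ! Suc i) x / (gs ! i) x) \<longlongrightarrow> 0) F)"

lemma scale_cheb: "scale gs \<Longrightarrow> cheb gs"
  by (simp add: scale_def)

lemma scale_ratio:
  assumes "scale gs" "i < j" "j < length gs"
  shows "((\<lambda>x. (gs ! j) x / (gs ! i) x) \<longlongrightarrow> 0) F"
  using assms(2,3)
proof (induction j)
  case (Suc j)
  have step: "((\<lambda>x. (gs ! Suc j) x / (gs ! j) x) \<longlongrightarrow> 0) F" using assms(1) Suc.prems by (simp add: scale_def)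
  show ?case
  proof (cases "i = j")
    case False
    then have "((\<lambda>x. (gs ! j) x / (gs ! i) x) \<longlongrightarrow> 0) F" using Suc by simp
    then have "((\<lambda>x. ((gs ! Suc j) x / (gs ! j) x) * ((gs ! j) x / (gs ! i) x)) \<longlongrightarrow> 0 * 0) F"
      by (intro tendsto_mult step)
    then have lim: "((\<lambda>x. ((gs ! Suc j) x / (gs ! j) x) * ((gs ! j) x / (gs ! i) x)) \<longlongrightarrow> 0) F" by simp
    have "eventually (\<lambda>x. (gs ! j) x \<noteq> 0) F" using cheb_one_nonzero[of gs j] assms(1) Suc.prems by (simp add: scale_def)
    then have "eventually (\<lambda>x. ((gs ! Suc j) x / (gs ! j) x) * ((gs ! j) x / (gs ! i) x) = (gs ! Suc j) x / (gs ! i) x) F"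
      by (rule eventually_mono) simp
    then show ?thesis using lim by (rule Lim_transform_eventually[rotated])
  qed (use step in simp)
qed simp

lemma ratio_quotient_tendsto:
  assumes "((\<lambda>x. g x / k x) \<longlongrightarrow> 0) F" "\<And>x. x \<in> S \<Longrightarrow> h x \<noteq> 0"
  shows "((\<lambda>x. (g x / h x) / (k x / h x)) \<longlongrightarrow> (0::real)) F"
  using assms(1)
  by (rule Lim_transform_eventually) (use assms(2) in \<open>auto intro!: eventually_F_I\<close>)

lemma reciprocal_unbounded:
  assumes lim: "((\<lambda>x. f x / g x) \<longlongrightarrow> 0) F" and f: "\<And>x. x \<in> S \<Longrightarrow> f x \<noteq> 0" and g: "eventually (\<lambda>x. g x \<noteq> 0) F"
  shows "filterlim (\<lambda>x. \<bar>g x / f x :: real\<bar>) at_top F"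
proof -
  have "eventually (\<lambda>x. f x \<noteq> 0) F" by (rule eventually_F_I) (rule f)
  with g have "eventually (\<lambda>x. f x / g x \<noteq> 0) F" by eventually_elim simp
  then have "filterlim (\<lambda>x. f x / g x) (at 0) F" using lim by (simp add: filterlim_at)
  then have "filterlim (\<lambda>x. inverse (f x / g x)) at_infinity F"
    by (rule filterlim_compose[OF filterlim_inverse_at_infinity])
  then show ?thesis by (auto dest: filterlim_at_infinity_imp_norm_at_top)
qed

text \<open>Shared by both kinds of reduction: dividing by the first function leads to the 0/0
  alternative, dividing by the last one to the unbounded alternative.\<close>

lemma rd_ratio_tendsto:
  assumes c: "cheb (map (rd h) gs)" and i: "Suc i < length gs"
    and R: "R (length gs) h" "\<And>j. j < length gs \<Longrightarrow> R (length gs) (gs ! j)" and h0: "\<And>x. x \<in> S \<Longrightarrow> h x \<noteq> 0"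
    and lim: "((\<lambda>x. (gs ! Suc i) x / (gs ! i) x) \<longlongrightarrow> 0) F"
    and alt: "((\<lambda>x. (gs ! Suc i) x / h x) \<longlongrightarrow> 0) F \<and> ((\<lambda>x. (gs ! i) x / h x) \<longlongrightarrow> 0) F
      \<or> filterlim (\<lambda>x. \<bar>(gs ! i) x / h x\<bar>) at_top F"
  shows "((\<lambda>x. (map (rd h) gs ! Suc i) x / (map (rd h) gs ! i) x) \<longlongrightarrow> 0) F"
proof -
  obtain l where l: "length gs = Suc l" using i by (cases "length gs") auto
  have Rg: "R (Suc l) h" "R (Suc l) (gs ! j)" if "j < length gs" for j using R that l by auto
  have "((\<lambda>x. rd h (gs ! Suc i) x / rd h (gs ! i) x) \<longlongrightarrow> 0) F"
  proof (rule deriv_ratio_tendsto[where G="\<lambda>x. (gs ! Suc i) x / h x" and H="\<lambda>x. (gs ! i) x / h x"])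
    have d: "((\<lambda>x. (gs ! j) x / h x) has_real_derivative rd h (gs ! j) x) (at x within S)" if "j < length gs" "x \<in> S" for j x
      by (rule rd_deriv[of l]) (use Rg h0 that in auto)
    show "((\<lambda>x. (gs ! Suc i) x / h x) has_real_derivative rd h (gs ! Suc i) x) (at x within S)"
      "((\<lambda>x. (gs ! i) x / h x) has_real_derivative rd h (gs ! i) x) (at x within S)" if "x \<in> S" for x
      using d i that by auto
    show "continuous_on S (rd h (gs ! Suc i))" "continuous_on S (rd h (gs ! i))"
      by (rule R_continuous[of l], rule R_rd; use Rg i h0 in auto)+
    show "((\<lambda>x. (gs ! Suc i) x / h x / ((gs ! i) x / h x)) \<longlongrightarrow> 0) F"
      by (rule ratio_quotient_tendsto[OF lim h0])
    show "eventually (\<lambda>x. rd h (gs ! i) x \<noteq> 0) F" using cheb_one_nonzero[OF c, of i] i by simp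
    show "eventually (\<lambda>x. rd h (gs ! Suc i) x - c * rd h (gs ! i) x \<noteq> 0) F" for c
      using cheb_two_nonzero[OF assms(1), of i "Suc i" c] i by simp
  qed (rule alt)
  then show ?thesis using i by simp
qed

section \<open>Reduction of a scale by its first and by its last function\<close>

lemma scale_rd_hd:
  assumes sc: "scale (h # gs)"
  shows "scale (map (rd h) gs)"
  unfolding scale_def
proof (intro conjI allI impI)
  have c: "cheb (h # gs)" using sc by (rule scale_cheb)
  note h0 = cheb_hd_nonzero[OF c]
  show c': "cheb (map (rd h) gs)" using c by (rule cheb_rd)
  fix i assume "Suc i < length (map (rd h) gs)"
  then have i: "Suc i < length gs" by simp
  show "((\<lambda>x. (map (rd h) gs ! Suc i) x / (map (rd h) gs ! i) x) \<longlongrightarrow> 0) F"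
  proof (rule rd_ratio_tendsto[OF c' i _ _ h0])
    show "R (length gs) h" using cheb_R[OF c, of 0] by simp
    show "R (length gs) (gs ! j)" if "j < length gs" for j using cheb_R[OF c, of "Suc j"] that by simp
    show "((\<lambda>x. (gs ! Suc i) x / (gs ! i) x) \<longlongrightarrow> 0) F"
      using scale_ratio[OF sc, of "Suc i" "Suc (Suc i)"] i by simp
    have "((\<lambda>x. (gs ! j) x / h x) \<longlongrightarrow> 0) F" if "j < length gs" for j
      using scale_ratio[OF sc, of 0 "Suc j"] that by simp
    then show "((\<lambda>x. (gs ! Suc i) x / h x) \<longlongrightarrow> 0) F \<and> ((\<lambda>x. (gs ! i) x / h x) \<longlongrightarrow> 0) F
        \<or> filterlim (\<lambda>x. \<bar>(gs ! i) x / h x\<bar>) at_top F" using i by simp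
  qed
qed

text \<open>Rolle with one zero placed at x0: f' has one sign on S, so f is strictly monotone and
  can reach 0 only in the limit. This gives nonvanishing on all of S, not merely near the end
  point.\<close>

lemma nonzero_of_vanishing_at_end:
  assumes d: "\<And>x. x \<in> S \<Longrightarrow> (f has_real_derivative f' x) (at x within S)"
    and c: "continuous_on S f'" and nz: "\<And>x. x \<in> S \<Longrightarrow> f' x \<noteq> 0" and lim: "(f \<longlongrightarrow> 0) F" and x: "x \<in> S"
  shows "f x \<noteq> 0"
proof -
  have "sgn (f' y) = sgn (f' T)" if "y \<in> S" for y
    using sgn_constant[OF c T_in _ that S_ge[OF that]] nz by blast
  moreover have "f' T > 0 \<or> f' T < 0" using nz[OF T_in] by auto
  ultimately have "(\<forall>y\<in>S. f' y > 0) \<or> (\<forall>y\<in>S. f' y < 0)" by (auto simp: sgn_1_pos sgn_1_neg)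
  then show ?thesis
  proof
    assume "\<forall>y\<in>S. f' y > 0"
    then have inc: "f u < f v" if "u \<in> S" "v \<in> S" "T \<le> u" "u < v" for u v
      by (intro increasing_from[where f=f and f'=f' and b=T, OF d _ that]) auto
    show ?thesis using increasing_to_zero_neg[where f=f and b=T, OF inc lim x S_ge[OF x]] by simp
  next
    assume neg: "\<forall>y\<in>S. f' y < 0"
    have dm: "((\<lambda>x. - f x) has_real_derivative - f' x) (at x within S)" if "x \<in> S" for x
      using d[OF that] by (rule DERIV_minus)
    have inc: "- f u < - f v" if "u \<in> S" "v \<in> S" "T \<le> u" "u < v" for u v
      by (rule increasing_from[where f="\<lambda>x. - f x" and f'="\<lambda>x. - f' x" and b=T, OF dm _ that]) (use neg in auto)
    have "((\<lambda>x. - f x) \<longlongrightarrow> 0) F" using tendsto_minus[OF lim] by simp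
    from increasing_to_zero_neg[where f="\<lambda>x. - f x" and b=T, OF inc this x S_ge[OF x]] show ?thesis by simp
  qed
qed

text \<open>Reducing by the head h shortens the list, and for i > 0 the powers of h split off. For i
  = 0 the claim is that p itself has no zero: p/h tends to 0 and its derivative does not vanish, by
  the induction hypothesis for the reduced list.\<close>

lemma scale_wronsk_last:
  assumes "scale (gs @ [p])" "i \<le> length gs" "x \<in> S"
  shows "wronsk S (take i gs @ [p]) x \<noteq> 0"
  using assms
proof (induction "length gs" arbitrary: gs p i x)
  case 0
  then show ?case using cheb_hd_nonzero[of p "[]" x] by (simp add: scale_def)
next
  case (Suc m)
  then obtain h hs where gs: "gs = h # hs" by (cases gs) auto
  have m: "m = length hs" using Suc.hyps(2) gs by simp
  have c: "cheb (h # hs @ [p])" using Suc.prems(1) gs by (simp add: scale_def)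
  note h0 = cheb_hd_nonzero[OF c]
  have sc: "scale (map (rd h) hs @ [rd h p])" using scale_rd_hd[of h "hs @ [p]"] Suc.prems(1) gs by simp
  have R: "R (Suc m) g" if "g \<in> set (h # hs @ [p])" for g using c that m unfolding cheb_def by auto
  have IH: "wronsk S (take j (map (rd h) hs) @ [rd h p]) y \<noteq> 0" if "j \<le> m" "y \<in> S" for j y
    by (rule Suc.hyps(1)[OF _ sc]) (use m that in auto)
  show ?case
  proof (cases i)
    case 0
    have Rp: "R (Suc m) h" "R (Suc m) p" using R by auto
    have "(\<lambda>x. p x / h x) x \<noteq> 0"
    proof (rule nonzero_of_vanishing_at_end[where f="\<lambda>x. p x / h x" and f'="rd h p"])
      show "((\<lambda>x. p x / h x) has_real_derivative rd h p y) (at y within S)" if "y \<in> S" for y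
        by (rule rd_deriv[OF Rp(2,1) h0 that])
      show "continuous_on S (rd h p)" by (rule R_continuous[of m], rule R_rd[OF Rp(2,1) h0])
      show "rd h p y \<noteq> 0" if "y \<in> S" for y using IH[of 0 y] that by simp
      show "((\<lambda>x. p x / h x) \<longlongrightarrow> 0) F"
        using scale_ratio[OF Suc.prems(1), of 0 "Suc m"] gs m by (simp add: nth_append)
    qed (rule Suc.prems(3))
    then show ?thesis using 0 by simp
  next
    case (Suc j)
    have j: "j \<le> m" using Suc Suc.prems(2) gs m by simp
    have "wronsk S (h # (take j hs @ [p])) x = h x ^ Suc (length (take j hs @ [p])) * wronsk S (map (rd h) (take j hs @ [p])) x"
    proof (rule wronsk_Cons_R[OF Suc.prems(3) h0])
      show "R (length (take j hs @ [p])) h" by (rule R_mono[OF R]) (use j m in auto)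
      show "R (length (take j hs @ [p])) g" if "g \<in> set (take j hs @ [p])" for g
        by (rule R_mono[OF R]) (use that j m in \<open>auto dest: in_set_takeD\<close>)
    qed
    then show ?thesis using IH[OF j Suc.prems(3)] h0[OF Suc.prems(3)] Suc gs by (simp add: take_map)
  qed
qed

lemma wronsk_mset_zero_iff:
  assumes "mset gs = mset hs"
  shows "wronsk S gs x = 0 \<longleftrightarrow> wronsk S hs x = 0"
proof -
  obtain p where "p permutes {..<length hs}" "permute_list p hs = gs"
    using mset_eq_permutation[OF assms] by blast
  then have "wronsk S gs x = of_int (sign p) * wronsk S hs x"
    using wronsk_permute_append[of p hs "[]" x] by simp
  then show ?thesis by (simp add: sign_def)
qed

lemma scale_last_nonzero: "scale (gs @ [p]) \<Longrightarrow> x \<in> S \<Longrightarrow> p x \<noteq> 0"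
  using scale_wronsk_last[of gs p 0 x] by simp

text \<open>Division by the last function reverses the roles: the quotients are unbounded, so the
  \<open>\<infinity>/\<infinity>\<close> form of l'Hospital's rule applies, and the new Wronskians are,
  up to sign, Wronskians of initial segments followed by \<open>p\<close>.\<close>

lemma scale_rd_last:
  assumes sc: "scale (gs @ [p])"
  shows "scale (map (rd p) gs)"
  unfolding scale_def
proof (intro conjI allI impI)
  have c: "cheb (gs @ [p])" using sc by (rule scale_cheb)
  note p0 = scale_last_nonzero[OF sc]
  have R: "R (length gs) g" if "g \<in> set (gs @ [p])" for g using c that unfolding cheb_def by auto
  show c': "cheb (map (rd p) gs)" unfolding cheb_def
  proof (intro conjI ballI allI impI)
    show "R (length (map (rd p) gs) - 1) g" if g: "g \<in> set (map (rd p) gs)" for g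
    proof -
      obtain g' where g': "g' \<in> set gs" "g = rd p g'" using g by auto
      then obtain m where m: "length gs = Suc m" by (cases gs) auto
      show ?thesis unfolding g'(2) using R_rd[of m g' p] R[of g'] R[of p] g'(1) p0 m by simp
    qed
    fix i x assume i: "i \<le> length (map (rd p) gs)" and x: "x \<in> S"
    have "wronsk S (p # take i gs) x = p x ^ Suc (length (take i gs)) * wronsk S (map (rd p) (take i gs)) x"
    proof (rule wronsk_Cons_R[OF x p0])
      show "R (length (take i gs)) p" by (rule R_mono[OF R]) auto
      show "R (length (take i gs)) g" if "g \<in> set (take i gs)" for g
        by (rule R_mono[OF R]) (use that in \<open>auto dest: in_set_takeD\<close>)
    qed
    moreover have "wronsk S (p # take i gs) x \<noteq> 0"
      using scale_wronsk_last[OF sc, of i x] i x wronsk_mset_zero_iff[of "p # take i gs" "take i gs @ [p]" x] by simp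
    ultimately show "wronsk S (take i (map (rd p) gs)) x \<noteq> 0" by (simp add: take_map)
  qed
  fix i assume "Suc i < length (map (rd p) gs)"
  then have i: "Suc i < length gs" by simp
  show "((\<lambda>x. (map (rd p) gs ! Suc i) x / (map (rd p) gs ! i) x) \<longlongrightarrow> 0) F"
  proof (rule rd_ratio_tendsto[OF c' i _ _ p0])
    show "R (length gs) p" using R by simp
    show "R (length gs) (gs ! j)" if "j < length gs" for j using R that by simp
    show "((\<lambda>x. (gs ! Suc i) x / (gs ! i) x) \<longlongrightarrow> 0) F"
      using scale_ratio[OF sc, of i "Suc i"] i by (simp add: nth_append)
    have "((\<lambda>x. p x / (gs ! i) x) \<longlongrightarrow> 0) F"
      using scale_ratio[OF sc, of i "length gs"] i by (simp add: nth_append)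
    moreover have "eventually (\<lambda>x. (gs ! i) x \<noteq> 0) F"
      using cheb_one_nonzero[OF c, of i] i by (simp add: nth_append)
    ultimately show "((\<lambda>x. (gs ! Suc i) x / p x) \<longlongrightarrow> 0) F \<and> ((\<lambda>x. (gs ! i) x / p x) \<longlongrightarrow> 0) F
        \<or> filterlim (\<lambda>x. \<bar>(gs ! i) x / p x\<bar>) at_top F"
      using reciprocal_unbounded[of p "gs ! i"] p0 by blast
  qed
qed

text \<open>The reductions consume the list from its end, so the surviving functions keep their
  order and the next divisor is always the last of them.\<close>

lemma scale_Dl_rev:
  assumes "scale gs" "k \<le> length gs"
  shows "scale (map (Dl (take k (rev gs))) (take (length gs - k) gs))"
  using assms(2)
proof (induction k)
  case 0
  have "Dl [] = (\<lambda>u. u)" by (rule ext) simp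
  then show ?case using assms(1) by simp
next
  case (Suc k)
  define n where "n = length gs"
  have k: "k < n" using Suc.prems by (simp add: n_def)
  define q where "q = gs ! (n - Suc k)"
  have rk: "rev gs ! k = q" using k by (simp add: rev_nth n_def q_def)
  have t: "take (n - k) gs = take (n - Suc k) gs @ [q]"
    using k take_Suc_conv_app_nth[of "n - Suc k" gs] by (simp add: Suc_diff_Suc n_def q_def)
  have "scale (map (Dl (take k (rev gs))) (take (n - Suc k) gs) @ [Dl (take k (rev gs)) q])"
    using Suc t by (simp add: n_def)
  then have "scale (map (rd (Dl (take k (rev gs)) q)) (map (Dl (take k (rev gs))) (take (n - Suc k) gs)))"
    by (rule scale_rd_last)
  moreover have "take (Suc k) (rev gs) = take k (rev gs) @ [q]"
    using k rk by (simp add: take_Suc_conv_app_nth n_def)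
  ultimately show ?case by (simp add: n_def Dl_append comp_def)
qed

end


context regularity_class
begin

lemma R_Dl:
  assumes "length xs \<le> m" "\<And>g. g \<in> set xs \<Longrightarrow> R m g" "R m u"
    and "\<And>j y. j < length xs \<Longrightarrow> y \<in> S \<Longrightarrow> Dl (take j xs) (xs ! j) y \<noteq> 0"
  shows "R (m - length xs) (Dl xs u)"
  using assms
proof (induction xs u arbitrary: m rule: Dl.induct)
  case (2 h hs u)
  then obtain l where l: "m = Suc l" by (cases m) auto
  have h0: "h y \<noteq> 0" if "y \<in> S" for y using "2.prems"(4)[of 0 y] that by simp
  have "R (l - length (map (rd h) hs)) (Dl (map (rd h) hs) (rd h u))"
  proof (rule "2.IH")
    show "length (map (rd h) hs) \<le> l" using "2.prems"(1) l by simp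
    show "R l g" if "g \<in> set (map (rd h) hs)" for g
      using that "2.prems"(2) h0 unfolding l by (auto intro!: R_rd)
    show "R l (rd h u)" using "2.prems"(2,3) h0 unfolding l by (auto intro!: R_rd)
    show "Dl (take j (map (rd h) hs)) (map (rd h) hs ! j) y \<noteq> 0" if "j < length (map (rd h) hs)" "y \<in> S" for j y
      using "2.prems"(4)[of "Suc j" y] that by (simp add: take_map)
  qed
  then show ?case by (simp add: l)
qed simp

end

context half_open
begin

text \<open>Rational right ends exhaust S up to the single point T; at interior points derivatives
  within S are ordinary ones.\<close>

lemma locally_abs_cont_differentiable_ae:
  assumes g: "locally_abs_cont S g"
  shows "negligible {x \<in> S. \<not> g differentiable (at x within S)}"
proof -
  let ?N = "\<lambda>b. {x \<in> {T<..<b}. \<not> g differentiable (at x)}"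
  have "countable {b \<in> S. b \<in> \<rat>}" by (rule countable_subset[OF _ countable_rat]) auto
  then have "negligible (\<Union>(?N ` {b \<in> S. b \<in> \<rat>}))"
    using g S_sub[OF T_in] unfolding locally_abs_cont_def
    by (intro negligible_countable_Union) (auto intro!: abs_cont_on_differentiable_ae[simplified])
  then have "negligible ({T} \<union> \<Union>(?N ` {b \<in> S. b \<in> \<rat>}))" by (intro negligible_Un) auto
  then show ?thesis
  proof (rule negligible_subset)
    show "{x \<in> S. \<not> g differentiable (at x within S)} \<subseteq> {T} \<union> \<Union>(?N ` {b \<in> S. b \<in> \<rat>})"
    proof
      fix x assume x: "x \<in> {x \<in> S. \<not> g differentiable (at x within S)}"
      show "x \<in> {T} \<union> \<Union>(?N ` {b \<in> S. b \<in> \<rat>})"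
      proof (cases "x = T")
        case False
        then have Tx: "T < x" using x S_ge[of x] by auto
        obtain y where y: "y \<in> S" "x < y" using S_no_max[of x] x by blast
        obtain b where b: "b \<in> \<rat>" "x < b" "b < y" using Rats_dense_in_real[OF y(2)] by auto
        have "b \<in> S" using S_down[OF y(1), of b] b Tx by simp
        moreover have "x \<in> ?N b" using x Tx b interior_at[of x] by simp
        ultimately show ?thesis using b(1) by blast
      qed simp
    qed
  qed
qed

section \<open>L'Hospital's rule for unbounded denominators, and improper integrals\<close>

text \<open>Beyond b both (c/2) H + G and (c/2) H - G are nondecreasing, so |G| \<le> (c/2) |H| + M;
  the constant M is absorbed once |H| is large. Nothing is asked of the growth of G.\<close>

lemma lhospital_smallo_pos:
  assumes dG: "\<And>x. x \<in> S \<Longrightarrow> (G has_real_derivative G' x) (at x within S)"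
    and dH: "\<And>x. x \<in> S \<Longrightarrow> (H has_real_derivative H' x) (at x within S)"
    and pos: "eventually (\<lambda>x. H' x > 0) F"
    and inf: "filterlim (\<lambda>x. \<bar>H x\<bar>) at_top F"
    and o: "G' \<in> o[F](H')"
  shows "G \<in> o[F](H)"
proof (rule landau_o.smallI)
  fix c :: real assume c: "c > 0"
  have "eventually (\<lambda>x. norm (G' x) \<le> c / 2 * norm (H' x)) F" using landau_o.smallD[OF o, of "c/2"] c by simp
  then have "eventually (\<lambda>x. norm (G' x) \<le> c / 2 * norm (H' x) \<and> H' x > 0) F" using pos by (rule eventually_conj)
  then obtain b where b: "b \<in> S" "\<And>x. x \<in> S \<Longrightarrow> b \<le> x \<Longrightarrow> norm (G' x) \<le> c / 2 * norm (H' x) \<and> H' x > 0"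
    unfolding eventually_F by blast
  have est: "\<bar>G x\<bar> \<le> c / 2 * \<bar>H x\<bar> + (\<bar>G b\<bar> + c / 2 * \<bar>H b\<bar>)" if x: "x \<in> S" "b \<le> x" for x
  proof (cases "x = b")
    case True
    then show ?thesis using c by simp
  next
    case False
    then have bx: "b < x" using x by simp
    have d1: "((\<lambda>x. c / 2 * H x - G x) has_real_derivative c / 2 * H' x - G' x) (at x within S)" if "x \<in> S" for x
      using dG dH that by (intro DERIV_diff DERIV_cmult)
    have d2: "((\<lambda>x. c / 2 * H x + G x) has_real_derivative c / 2 * H' x + G' x) (at x within S)" if "x \<in> S" for x
      using dG dH that by (intro DERIV_add DERIV_cmult)
    have ge: "c / 2 * H' z - G' z \<ge> 0 \<and> c / 2 * H' z + G' z \<ge> 0" if "z \<in> S" "b \<le> z" for z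
      using b(2)[OF that] by (auto simp: abs_le_iff)
    obtain z1 where "b < z1" "z1 \<in> S" "(c / 2 * H x - G x) - (c / 2 * H b - G b) = (x - b) * (c / 2 * H' z1 - G' z1)"
      using mean_value[OF d1 b(1) x(1) bx] by blast
    then have 1: "(c / 2 * H x - G x) - (c / 2 * H b - G b) \<ge> 0" using ge[of z1] bx by simp
    obtain z2 where "b < z2" "z2 \<in> S" "(c / 2 * H x + G x) - (c / 2 * H b + G b) = (x - b) * (c / 2 * H' z2 + G' z2)"
      using mean_value[OF d2 b(1) x(1) bx] by blast
    then have 2: "(c / 2 * H x + G x) - (c / 2 * H b + G b) \<ge> 0" using ge[of z2] bx by simp
    have "c / 2 * H x \<le> c / 2 * \<bar>H x\<bar>" "- (c / 2 * H b) \<le> c / 2 * \<bar>H b\<bar>" using c by (auto simp: abs_if)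
    then show ?thesis using 1 2 by linarith
  qed
  define M where "M = \<bar>G b\<bar> + c / 2 * \<bar>H b\<bar>"
  have "eventually (\<lambda>x. \<bar>H x\<bar> \<ge> 2 * M / c) F" using inf by (simp add: filterlim_at_top)
  moreover have "eventually (\<lambda>x. \<bar>G x\<bar> \<le> c / 2 * \<bar>H x\<bar> + M) F"
    by (rule eventually_F_ge[OF b(1)]) (use est in \<open>simp add: M_def\<close>)
  ultimately show "eventually (\<lambda>x. norm (G x) \<le> c * norm (H x)) F"
  proof eventually_elim
    case (elim x)
    have "M \<le> c / 2 * \<bar>H x\<bar>" using elim(1) c by (simp add: field_simps)
    then show ?case using elim(2) by simp
  qed
qed

lemma lhospital_smallo:
  assumes dG: "\<And>x. x \<in> S \<Longrightarrow> (G has_real_derivative G' x) (at x within S)"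
    and dH: "\<And>x. x \<in> S \<Longrightarrow> (H has_real_derivative H' x) (at x within S)"
    and cont: "continuous_on S H'" and nz: "eventually (\<lambda>x. H' x \<noteq> 0) F"
    and inf: "filterlim (\<lambda>x. \<bar>H x\<bar>) at_top F"
    and o: "G' \<in> o[F](H')"
  shows "G \<in> o[F](H)"
  using eventually_const_sign[OF cont nz]
proof
  assume pos: "eventually (\<lambda>x. H' x > 0) F"
  show ?thesis by (rule lhospital_smallo_pos[OF dG dH pos inf o])
next
  assume "eventually (\<lambda>x. H' x < 0) F"
  then have pos: "eventually (\<lambda>x. - H' x > 0) F" by (rule eventually_mono) simp
  have dm: "((\<lambda>x. - H x) has_real_derivative - H' x) (at x within S)" if "x \<in> S" for x
    using dH[OF that] by (rule DERIV_minus)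
  have "G \<in> o[F](\<lambda>x. - H x)"
    by (rule lhospital_smallo_pos[where H="\<lambda>x. - H x" and H'="\<lambda>x. - H' x", OF dG dm pos]) (use inf o in simp_all)
  then show ?thesis by simp
qed

text \<open>G is a primitive only through its increments, so derivatives existing almost everywhere
  and derivatives existing everywhere are treated alike.\<close>

lemma improper_integral:
  assumes I: "\<And>x y. x \<in> S \<Longrightarrow> y \<in> S \<Longrightarrow> x \<le> y \<Longrightarrow> (g has_integral (G y - G x)) {x..y}" and a: "a \<in> S"
  shows imp_conv_iff: "imp_conv a x0 g \<longleftrightarrow> (\<exists>l. (G \<longlongrightarrow> l) F)"
    and imp_int_eq: "(G \<longlongrightarrow> l) F \<Longrightarrow> imp_int a x0 g = l - G a"
proof -
  have inS: "y \<in> S" if "a \<le> y" "ereal y < x0" for y using that S_ge[OF a] by (simp add: Ivl_def)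
  have ev: "eventually (\<lambda>y. integral {a..y} g = G y - G a) F"
    by (rule eventually_F_ge[OF a]) (use I[OF a] in \<open>auto intro: integral_unique\<close>)
  have lim: "((\<lambda>y. integral {a..y} g) \<longlongrightarrow> l - G a) F" if "(G \<longlongrightarrow> l) F" for l
    by (rule Lim_transform_eventually[OF _ eventually_mono[OF ev]]) (auto intro: tendsto_diff that)
  have lim': "(G \<longlongrightarrow> l + G a) F" if "((\<lambda>y. integral {a..y} g) \<longlongrightarrow> l) F" for l
    by (rule Lim_transform_eventually[OF tendsto_add[OF that tendsto_const] eventually_mono[OF ev]]) simp
  show "imp_conv a x0 g \<longleftrightarrow> (\<exists>l. (G \<longlongrightarrow> l) F)"
    unfolding imp_conv_def using lim lim' I[OF a inS] by (blast intro: has_integral_integrable)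
  show "imp_int a x0 g = l - G a" if "(G \<longlongrightarrow> l) F"
    unfolding imp_int_def by (rule tendsto_Lim[OF F_neq_bot lim[OF that]])
qed

lemma derivative_has_integral:
  assumes d: "\<And>x. x \<in> S \<Longrightarrow> (G has_real_derivative g x) (at x within S)" and xy: "x \<in> S" "y \<in> S" "x \<le> y"
  shows "(g has_integral (G y - G x)) {x..y}"
proof (rule fundamental_theorem_of_calculus[OF xy(3)])
  fix z assume "z \<in> {x..y}"
  then have z: "z \<in> S" "{x..y} \<subseteq> S" using S_sub[OF xy(1,2)] by auto
  show "(G has_vector_derivative g z) (at z within {x..y})"
    using has_field_derivative_subset[OF d[OF z(1)] z(2)] by (simp add: has_real_derivative_iff_has_vector_derivative)
qed

lemma integral_has_derivative:
  assumes c: "continuous_on S g" and x: "x \<in> S"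
  shows "((\<lambda>t. integral {T..t} g) has_real_derivative g x) (at x within S)"
proof -
  obtain y where y: "y \<in> S" "x < y" using S_no_max[OF x] by blast
  have cy: "continuous_on {T..y} g" using c S_sub[OF T_in y(1)] continuous_on_subset by blast
  have "((\<lambda>t. integral {T..t} g) has_real_derivative g x) (at x within {T..y})"
    using integral_has_real_derivative[OF cy, of x] y S_ge[OF x] by simp
  moreover have "at x within S = at x within {T..y}"
  proof (rule at_within_nhd[of x "{..<y}"])
    show "S \<inter> {..<y} - {x} = {T..y} \<inter> {..<y} - {x}"
      using S_ge S_sub[OF T_in y(1)] by auto
  qed (use y in auto)
  ultimately show ?thesis by simp
qed

lemma tendsto_zero_iff_smallo: "(f \<longlongrightarrow> (0::real)) F \<longleftrightarrow> f \<in> o[F](\<lambda>_. 1)"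
  using smalloI_tendsto[of f "\<lambda>_. 1" F] smalloD_tendsto[of f F "\<lambda>_. 1"] by auto

end

section \<open>The factorization and the operators \<open>L\<^sub>k\<close>\<close>

locale scale_family = half_open +
  fixes n :: nat and phi :: "nat \<Rightarrow> real \<Rightarrow> real"
  assumes n2: "n \<ge> 2"
    and cheb_scale: "cheb_scale T x0 n phi"
    and phi_ACk: "\<And>i. i \<in> {1..n} \<Longrightarrow> ACk (Ivl T x0) (n - 1) (phi i)"
begin

abbreviation "L \<equiv> Lk T x0 n phi"
abbreviation "W \<equiv> Wt T x0 n phi"
abbreviation "p \<equiv> pp T x0 n phi"

definition phis where "phis = map phi [1..<n + 1]"
abbreviation "gs k \<equiv> take k (rev phis)"
definition DD where "DD k = Dl (take k (rev phis))"
text \<open>What phi_(n-k) has become after k reductions, that is, the next divisor.\<close>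

definition q where "q k = DD k (phi (n - k))"

lemma length_phis [simp]: "length phis = n"
  by (simp add: phis_def)

lemma phis_nth: "i < n \<Longrightarrow> phis ! i = phi (Suc i)"
  by (simp add: phis_def nth_append del: upt_Suc)

lemma rev_phis_nth: "k < n \<Longrightarrow> rev phis ! k = phi (n - k)"
  by (simp add: rev_nth phis_nth Suc_diff_Suc)

lemma phi_R: "1 \<le> i \<Longrightarrow> i \<le> n \<Longrightarrow> R (n - 1) (phi i)"
  using phi_ACk[of i] by (simp add: ACk_iff_R)

lemma phis_R: "g \<in> set phis \<Longrightarrow> R (n - 1) g"
  unfolding phis_def using phi_R by auto

lemma scale_phis: "scale phis"
  unfolding scale_def cheb_def
proof (intro conjI allI impI ballI)
  show "R (length phis - 1) g" if "g \<in> set phis" for g using phis_R[OF that] by simp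
  fix i x assume i: "i \<le> length phis" and x: "x \<in> S"
  have t: "take i phis = map phi [1..<Suc i]" using i by (simp add: phis_def take_map take_upt del: upt_Suc)
  show "wronsk S (take i phis) x \<noteq> 0"
  proof (cases "i = 0")
    case False
    then show ?thesis using cheb_scale i x unfolding cheb_scale_def t by (simp del: upt_Suc)
  qed simp
next
  fix i assume "Suc i < length phis"
  then have i: "Suc i < n" by simp
  then show "((\<lambda>x. (phis ! Suc i) x / (phis ! i) x) \<longlongrightarrow> 0) F"
    using cheb_scale unfolding cheb_scale_def by (simp add: phis_nth)
qed

lemma scale_DD:
  assumes "k \<le> n"
  shows "scale (map (DD k) (take (n - k) phis))"
  using scale_Dl_rev[OF scale_phis, of k] assms by (simp add: DD_def)

lemma DD_0 [simp]: "DD 0 u = u"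
  by (simp add: DD_def)

lemma DD_Suc: "k < n \<Longrightarrow> DD (Suc k) u = rd (q k) (DD k u)"
  unfolding DD_def q_def by (simp add: take_Suc_conv_app_nth Dl_append rev_phis_nth)

lemma q_nonzero: "k < n \<Longrightarrow> x \<in> S \<Longrightarrow> q k x \<noteq> 0"
proof -
  assume k: "k < n" and x: "x \<in> S"
  have "take (n - k) phis = take (n - Suc k) phis @ [phi (n - k)]"
    using k take_Suc_conv_app_nth[of "n - Suc k" phis] by (simp add: Suc_diff_Suc phis_nth)
  then have "scale (map (DD k) (take (n - Suc k) phis) @ [q k])"
    using scale_DD[of k] k by (simp add: q_def)
  then show ?thesis using x by (rule scale_last_nonzero)
qed

text \<open>Stated for any class because it is applied both with local absolute continuity and, at a
  point off the exceptional set, with differentiability there.\<close>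

lemma DD_R_class:
  assumes "regularity_class S B" "m \<le> n - 1" "k \<le> m" "\<And>g. g \<in> set phis \<Longrightarrow> Reg B m g" "Reg B m u"
  shows "Reg B (m - k) (DD k u)"
proof -
  interpret c: regularity_class S B by fact
  have "Reg B (m - length (gs k)) (Dl (gs k) u)"
  proof (rule c.R_Dl)
    show "Dl (take j (gs k)) (gs k ! j) y \<noteq> 0"
      if "j < length (gs k)" "y \<in> S" for j y
      using q_nonzero[of j y] that by (simp add: q_def DD_def rev_phis_nth)
  qed (use assms in \<open>auto dest: in_set_takeD\<close>)
  moreover have "length (gs k) = k" using assms(2,3) by simp
  ultimately show ?thesis by (simp add: DD_def)
qed

lemma DD_R: "k \<le> n - 1 \<Longrightarrow> R (n - 1) u \<Longrightarrow> R (n - 1 - k) (DD k u)"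
  by (rule DD_R_class[OF regularity_class_axioms]) (use phis_R in auto)

lemma q_R: "k \<le> n - 1 \<Longrightarrow> R (n - 1 - k) (q k)"
  unfolding q_def using n2 by (intro DD_R phi_R) auto

lemma DD_ratio:
  assumes "1 \<le> i" "i < j" "j \<le> n - k" "k \<le> n"
  shows "((\<lambda>x. DD k (phi j) x / DD k (phi i) x) \<longlongrightarrow> 0) F"
  using scale_ratio[OF scale_DD[OF assms(4)], of "i - 1" "j - 1"] assms by (simp add: phis_nth)

lemma DD_nonzero:
  assumes "1 \<le> i" "i \<le> n - k" "k \<le> n"
  shows "eventually (\<lambda>x. DD k (phi i) x \<noteq> 0) F"
  using cheb_one_nonzero[OF scale_cheb[OF scale_DD[OF assms(3)]], of "i - 1"] assms by (simp add: phis_nth)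

text \<open>After n - j reductions phi_j is itself the divisor; the quotient is 1, its derivative 0,
  and 0 persists.\<close>

lemma DD_zero:
  assumes "1 \<le> j" "n - k < j" "j \<le> n" "k \<le> n" "x \<in> S"
  shows "DD k (phi j) x = 0"
  using assms(2,4,5)
proof (induction k arbitrary: x)
  case 0
  then show ?case using assms by simp
next
  case (Suc k)
  have "\<exists>c. \<forall>y\<in>S. DD k (phi j) y / q k y = c"
  proof (cases "n - k < j")
    case True
    then show ?thesis using Suc by (intro exI[of _ 0]) simp
  next
    case False
    then have "j = n - k" using Suc.prems by simp
    then show ?thesis using q_nonzero[of k] Suc.prems by (intro exI[of _ 1]) (simp add: q_def)
  qed
  then obtain c where c: "\<And>y. y \<in> S \<Longrightarrow> DD k (phi j) y / q k y = c" by blast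
  have "hder S 1 (\<lambda>y. DD k (phi j) y / q k y) x = hder S 1 (\<lambda>_. c) x"
    by (rule hder_cong[OF _ Suc.prems(3)]) (rule c)
  then show ?case using Suc.prems by (simp add: DD_Suc rd_def hder_const)
qed

section \<open>Reversed Wronskians, weights and signs\<close>

lemma Wt_eq: "k \<le> n \<Longrightarrow> W k = wronsk S (gs k)"
  unfolding Wt_def phis_def by (simp add: take_rev rev_map drop_map drop_upt take_map del: upt_Suc)

lemma wronsk_rev_append:
  assumes "k \<le> n" "x \<in> S" "\<And>g. g \<in> set phis \<Longrightarrow> diff_upto k x g" "diff_upto k x u"
  shows "wronsk S (gs k @ [u]) x = wronsk S (gs k) x * (\<Prod>j<k. q j x) * DD k u x"
proof -
  have "wronsk S (gs k @ [u]) x = wronsk S (gs k) x *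
     (\<Prod>j<length (gs k). Dl (take j (gs k)) (gs k ! j) x) * Dl (gs k) u x"
  proof (rule wronsk_append[OF assms(2)])
    show "Dl (take j (gs k)) (gs k ! j) y \<noteq> 0"
      if "j < length (gs k)" "y \<in> S" for j y
      using q_nonzero[of j y] that by (simp add: q_def DD_def rev_phis_nth)
  qed (use assms in \<open>auto dest: in_set_takeD simp: min_def\<close>)
  also have "(\<Prod>j<length (gs k). Dl (take j (gs k)) (gs k ! j) x) = (\<Prod>j<k. q j x)"
    using assms(1) by (intro prod.cong) (auto simp: q_def DD_def rev_phis_nth min_def)
  finally show ?thesis by (simp add: DD_def)
qed

lemma Wt_Suc: 
  assumes k: "k < n" and x: "x \<in> S"
  shows "W (Suc k) x = W k x * (\<Prod>j<Suc k. q j x)"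
proof -
  have "W (Suc k) x = wronsk S (gs k @ [phi (n - k)]) x"
    using k by (simp add: Wt_eq take_Suc_conv_app_nth rev_phis_nth)
  also have "\<dots> = wronsk S (gs k) x * (\<Prod>j<k. q j x) * DD k (phi (n - k)) x"
    using k x R_diff_upto[OF phis_R, of _ k x] R_diff_upto[OF phi_R, of "n - k" k x] by (intro wronsk_rev_append) auto
  finally show ?thesis using k by (simp add: Wt_eq q_def)
qed

lemma Wt_nonzero: "k \<le> n \<Longrightarrow> x \<in> S \<Longrightarrow> W k x \<noteq> 0"
proof (induction k)
  case (Suc k)
  then show ?case using Wt_Suc[of k x] q_nonzero by simp
qed (simp add: Wt_eq)

text \<open>Consecutive reversed Wronskians differ by the factor q_0 ... q_k, so W_(k-1) W_(k+1) =
  W_k^2 q_k.\<close>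

lemma pp_less:
  assumes k: "k < n" and x: "x \<in> S"
  shows "p k x = 1 / \<bar>q k x\<bar>"
proof (cases k)
  case 0
  then show ?thesis by (simp add: pp_def q_def)
next
  case (Suc m)
  have W1: "W k x = W m x * (\<Prod>j<k. q j x)" using Wt_Suc[of m x] Suc k x by simp
  have W2: "W (Suc k) x = W k x * ((\<Prod>j<k. q j x) * q k x)" using Wt_Suc[OF k x] by simp
  have "W m x * W (Suc k) x = (W k x)\<^sup>2 * q k x"
    unfolding W2 unfolding W1 by (simp add: power2_eq_square mult_ac)
  moreover have "W k x \<noteq> 0" "q k x \<noteq> 0" using Wt_nonzero q_nonzero k x by auto
  ultimately show ?thesis using Suc k by (simp add: pp_def abs_mult)
qed

lemma pp_last:
  assumes x: "x \<in> S"
  shows "p n x = \<bar>\<Prod>j<n. q j x\<bar>"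
proof -
  obtain m where m: "n = Suc m" using n2 by (cases n) auto
  have "W m x \<noteq> 0" using Wt_nonzero m x by simp
  then show ?thesis using Wt_Suc[of m x] x by (simp add: pp_def m)
qed

text \<open>The sign picked up from the absolute values in p_0, ..., p_k. It is read off at T, since
  no q_j changes sign on S.\<close>

definition sg where "sg k = (\<Prod>j\<le>k. sgn (q j T))"

lemma q_sgn: "k < n \<Longrightarrow> x \<in> S \<Longrightarrow> sgn (q k x) = sgn (q k T)"
  by (rule sgn_constant[OF R_continuous[OF q_R] T_in q_nonzero]) (use S_ge in auto)

lemma sg_sq: "k < n \<Longrightarrow> sg k * sg k = 1"
proof -
  assume k: "k < n"
  have "sgn (q j T) * sgn (q j T) = 1" if "j \<in> {..k}" for j
    using q_nonzero[OF _ T_in, of j] that k by (auto simp: sgn_if)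
  then show ?thesis unfolding sg_def by (simp flip: prod.distrib)
qed

lemma sg_nonzero: "k < n \<Longrightarrow> sg k \<noteq> 0"
  using sg_sq by fastforce

lemma abs_q: "k < n \<Longrightarrow> x \<in> S \<Longrightarrow> \<bar>q k x\<bar> = sgn (q k T) * q k x"
  using q_sgn[of k x] by (metis abs_sgn mult.commute)

lemma pp_pos: "k < n \<Longrightarrow> x \<in> S \<Longrightarrow> p k x > 0"
  using pp_less q_nonzero by simp

definition E where "E k u x = DD k u x / q k x"

lemma E_deriv:
  assumes "Suc k < n" "R (n - 1) u" "x \<in> S"
  shows "(E k u has_real_derivative DD (Suc k) u x) (at x within S)"
proof -
  obtain l where l: "n - 1 - k = Suc l" using assms(1) by (cases "n - 1 - k") auto
  have "((\<lambda>x. DD k u x / q k x) has_real_derivative rd (q k) (DD k u) x) (at x within S)"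
    by (rule rd_deriv[of l]) (use DD_R[of k u] q_R[of k] q_nonzero[of k] assms l in auto)
  then show ?thesis using assms(1) by (simp add: DD_Suc E_def[abs_def])
qed

text \<open>The formula for \<open>L k u\<close> is a hypothesis because this lemma serves the
  induction that proves it.\<close>

lemma L_deriv_aux:
  assumes "Suc k < n" "R (n - 1) u" "x \<in> S" "\<And>y. y \<in> S \<Longrightarrow> L k u y = sg k * E k u y"
  shows "(L k u has_real_derivative sg k * DD (Suc k) u x) (at x within S)"
proof (rule has_real_derivative_cong_on[of "\<lambda>x. sg k * E k u x"])
  show "((\<lambda>x. sg k * E k u x) has_real_derivative sg k * DD (Suc k) u x) (at x within S)"
    by (intro DERIV_cmult E_deriv assms)
qed (use assms in simp_all)

lemma L_eq: "k < n \<Longrightarrow> R (n - 1) u \<Longrightarrow> x \<in> S \<Longrightarrow> L k u x = sg k * E k u x"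
proof (induction k arbitrary: x)
  case 0
  have "1 / \<bar>q 0 x\<bar> = sgn (q 0 T) / q 0 x"
    using abs_q[of 0 x] q_nonzero[of 0 x] 0 by (auto simp: sgn_if split: if_splits)
  then show ?case using 0 by (simp add: pp_less sg_def E_def)
next
  case (Suc k)
  have "(L k u has_real_derivative sg k * DD (Suc k) u x) (at x within S)"
    by (rule L_deriv_aux) (use Suc in auto)
  then have "vector_derivative (L k u) (at x within S) = sg k * DD (Suc k) u x"
    using vector_derivative_within[OF perfect[OF Suc.prems(3)]] by (simp add: has_real_derivative_iff_has_vector_derivative)
  moreover have "1 / \<bar>q (Suc k) x\<bar> = sgn (q (Suc k) T) / q (Suc k) x"
    using abs_q[of "Suc k" x] q_nonzero[of "Suc k" x] Suc.prems by (auto simp: sgn_if split: if_splits)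
  ultimately show ?case using Suc.prems by (simp add: pp_less sg_def E_def)
qed

lemma L_deriv:
  assumes k: "Suc k < n" and u: "R (n - 1) u" and x: "x \<in> S"
  shows "(L k u has_real_derivative L (Suc k) u x / p (Suc k) x) (at x within S)"
proof -
  have "sgn (q (Suc k) T) * \<bar>q (Suc k) x\<bar> = q (Suc k) x" "q (Suc k) x \<noteq> 0"
    using abs_q[of "Suc k" x] q_nonzero[of "Suc k"] k x T_in by (auto simp: sgn_if)
  then have "sgn (q (Suc k) T) * DD (Suc k) u x / q (Suc k) x * \<bar>q (Suc k) x\<bar> = DD (Suc k) u x"
    by (metis mult.assoc mult.commute nonzero_mult_div_cancel_left times_divide_eq_left)
  moreover have "sg (Suc k) = sg k * sgn (q (Suc k) T)" by (simp add: sg_def)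
  then have "L (Suc k) u x / p (Suc k) x = sg k * (sgn (q (Suc k) T) * DD (Suc k) u x / q (Suc k) x * \<bar>q (Suc k) x\<bar>)"
    using L_eq[OF k u x] by (simp add: pp_less[OF k x] E_def mult_ac)
  ultimately show ?thesis using L_deriv_aux[OF k u x L_eq] k u by simp
qed

lemma divide_p_continuous:
  assumes "continuous_on S g" "k < n"
  shows "continuous_on S (\<lambda>s. g s / p k s)"
proof -
  have "continuous_on S (\<lambda>s. g s * \<bar>q k s\<bar>)"
    using R_continuous[OF q_R[of k]] assms by (intro continuous_intros) auto
  then show ?thesis using pp_less[OF assms(2)] by (simp cong: continuous_on_cong)
qed

lemma L_continuous:
  assumes k: "k < n" and u: "R (n - 1) u"
  shows "continuous_on S (L k u)" "continuous_on S (\<lambda>x. L k u x / p k x)" "locally_abs_cont S (L (n - 1) u)"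
proof -
  have cq: "continuous_on S (q k)" using R_continuous[OF q_R[of k]] k by simp
  have cD: "continuous_on S (DD k u)" using R_continuous[OF DD_R[of k u]] k u by simp
  have "continuous_on S (\<lambda>x. sg k * E k u x)"
    unfolding E_def by (intro continuous_intros cD cq) (use q_nonzero k in auto)
  then show c: "continuous_on S (L k u)" using L_eq[OF k u] by (simp cong: continuous_on_cong)
  then show "continuous_on S (\<lambda>x. L k u x / p k x)" using k by (rule divide_p_continuous)
  have "R (n - 1 - (n - 1)) (DD (n - 1) u)" "R (n - 1 - (n - 1)) (q (n - 1))" using DD_R[OF order_refl u] q_R[OF order_refl] by (simp_all only:)
  then have "R 0 (\<lambda>x. sg (n - 1) * (DD (n - 1) u x / q (n - 1) x))"
    using q_nonzero[of "n - 1"] n2 by (intro R_mult R_const R_divide) auto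
  then show "locally_abs_cont S (L (n - 1) u)"
    using L_eq[of "n - 1" u] n2 u by (auto intro: R_cong[of "\<lambda>x. sg (n - 1) * (DD (n - 1) u x / q (n - 1) x)" _ 0, simplified] simp: E_def)
qed

lemma L_const: "k < n \<Longrightarrow> x \<in> S \<Longrightarrow> L k (phi (n - k)) x = sg k"
  using L_eq[of k "phi (n - k)" x] phi_R[of "n - k"] q_nonzero[of k x] by (simp add: E_def q_def)

lemma L_zero: "k < n \<Longrightarrow> 1 \<le> j \<Longrightarrow> n - k < j \<Longrightarrow> j \<le> n \<Longrightarrow> x \<in> S \<Longrightarrow> L k (phi j) x = 0"
  using L_eq[of k "phi j" x] phi_R[of j] DD_zero[of j k x] by (simp add: E_def)

text \<open>After k reductions phi_j still dominates the divisor q_k, which stems from the later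
  function phi_(n-k).\<close>

lemma L_unbounded:
  assumes "1 \<le> j" "j < n - k" "k < n"
  shows "filterlim (\<lambda>x. \<bar>L k (phi j) x\<bar>) at_top F"
proof -
  have "((\<lambda>x. q k x / DD k (phi j) x) \<longlongrightarrow> 0) F"
    unfolding q_def using assms by (intro DD_ratio) auto
  then have lim: "filterlim (\<lambda>x. \<bar>DD k (phi j) x / q k x\<bar>) at_top F"
    using DD_nonzero[of j k] assms by (intro reciprocal_unbounded q_nonzero) auto
  have "\<bar>sg k\<bar> = 1" using sg_sq[OF assms(3)] by (auto simp: square_eq_1_iff)
  then have "\<bar>L k (phi j) x\<bar> = \<bar>DD k (phi j) x / q k x\<bar>" if "x \<in> S" for x
    using L_eq[OF assms(3) phi_R that, of j] assms by (simp add: E_def abs_mult)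
  then have "eventually (\<lambda>x. \<bar>DD k (phi j) x / q k x\<bar> = \<bar>L k (phi j) x\<bar>) F"
    by (intro eventually_F_I) simp
  then show ?thesis using lim filterlim_cong by fastforce
qed

text \<open>Wherever all n-th derivatives exist, \<open>LL\<close> equals q_0 ... q_(n-1) times the
  n-fold reduction of f, and dividing by p_n turns the product into a sign. The exceptional points
  form a null set, over which absolute continuity integrates.\<close>

lemma L_has_integral:
  assumes f: "R (n - 1) f" and xy: "x \<in> S" "y \<in> S" "x \<le> y"
  shows "((\<lambda>t. LL T x0 n phi f t / p n t) has_integral (L (n - 1) f y - L (n - 1) f x)) {x..y}"
proof -
  \<comment> \<open>\<open>LL\<close> also involves the n-th derivatives of the phi_j, so their
    exceptional points are removed as well.\<close>
  define N where "N = (\<Union>g\<in>insert f (set phis). {z \<in> S. \<not> hder S (n - 1) g differentiable (at z within S)})"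
  have Rn: "R (n - 1) g" if "g \<in> insert f (set phis)" for g using that f phis_R by auto
  have "negligible N"
    unfolding N_def
  proof (rule negligible_Union)
    fix t assume "t \<in> (\<lambda>g. {z \<in> S. \<not> hder S (n - 1) g differentiable (at z within S)}) ` insert f (set phis)"
    then obtain g where g: "g \<in> insert f (set phis)" "t = {z \<in> S. \<not> hder S (n - 1) g differentiable (at z within S)}" by blast
    show "negligible t" unfolding g(2)
      by (rule locally_abs_cont_differentiable_ae) (use Rn[OF g(1)] in \<open>simp add: Reg_def\<close>)
  qed simp
  moreover have "abs_cont_on x y (L (n - 1) f)"
    using L_continuous(3)[OF _ f, of 0] n2 S_sub[OF xy(1,2)] unfolding locally_abs_cont_def by auto
  moreover have "(L (n - 1) f has_real_derivative LL T x0 n phi f z / p n z) (at z within {x..y})"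
    if z: "z \<in> {x..y} - N" for z
  proof -
    have zS: "z \<in> S" using z S_sub[OF xy(1,2)] by auto
    let ?B = "\<lambda>g. g differentiable (at z within S)"
    have B: "Reg ?B (n - 1) g" if "g \<in> insert f (set phis)" for g
      using Rn[OF that] z zS that unfolding N_def Reg_def by auto
    have nSuc: "n = Suc (n - 1)" using n2 by simp
    have du: "diff_upto n z g" if "g \<in> insert f (set phis)" for g
      using B[OF that] diff_upto_Suc[OF zS, of "n - 1" g] nSuc by simp
    interpret c: regularity_class S ?B by (rule regularity_differentiable[OF zS])
    have "Reg ?B (n - 1 - (n - 1)) (DD (n - 1) f)" "Reg ?B (n - 1 - (n - 1)) (DD (n - 1) (phi 1))"
      using DD_R_class[OF c.regularity_class_axioms order_refl order_refl] B phi_R[of 1] n2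
      by (simp_all add: phis_def)
    moreover have "q (n - 1) = DD (n - 1) (phi 1)" using n2 by (simp add: q_def)
    ultimately have "?B (\<lambda>x. DD (n - 1) f x / q (n - 1) x)"
      using c.R_divide[of 0] q_nonzero[of "n - 1"] n2 by simp
    then obtain d where d: "((\<lambda>x. DD (n - 1) f x / q (n - 1) x) has_real_derivative d) (at z within S)"
      unfolding real_differentiable_def by blast
    then have "D1 (\<lambda>x. DD (n - 1) f x / q (n - 1) x) z = d" by (intro hder_Suc_eq[OF zS]) simp
    then have dD: "d = DD n f z" using DD_Suc[of "n - 1" f] nSuc n2 by (simp add: rd_def)
    have "(L (n - 1) f has_real_derivative sg (n - 1) * d) (at z within S)"
    proof (rule has_real_derivative_cong_on[of "\<lambda>x. sg (n - 1) * (DD (n - 1) f x / q (n - 1) x)"])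
      show "sg (n - 1) * (DD (n - 1) f y / q (n - 1) y) = L (n - 1) f y" if "y \<in> S" for y
        using L_eq[of "n - 1" f y] n2 f that by (simp add: E_def)
    qed (use zS DERIV_cmult[OF d] in auto)
    then have L': "(L (n - 1) f has_real_derivative sg (n - 1) * d) (at z within {x..y})"
      using has_field_derivative_subset S_sub[OF xy(1,2)] by blast
    have "LL T x0 n phi f z = (\<Prod>j<n. q j z) * DD n f z"
    proof -
      \<comment> \<open>\<open>LL\<close> lists the functions in increasing order, the reductions in
        decreasing order; the sign of the reversal cancels between numerator and
        denominator.\<close>
      have "mset (rev phis) = mset phis" by simp
      then obtain \<pi> where \<pi>: "\<pi> permutes {..<length phis}" "permute_list \<pi> phis = rev phis"
        using mset_eq_permutation by metis
      have s0: "real_of_int (sign \<pi>) \<noteq> 0" by (simp add: sign_def)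
      have w0: "wronsk S (rev phis) z \<noteq> 0" using Wt_nonzero[of n z] zS Wt_eq[of n] by simp
      have "LL T x0 n phi f z = wronsk S (phis @ [f]) z / wronsk S phis z" by (simp add: LL_def phis_def)
      also have "\<dots> = wronsk S (rev phis @ [f]) z / wronsk S (rev phis) z"
        using wronsk_permute_append[OF \<pi>(1), of "[f]" z] wronsk_permute_append[OF \<pi>(1), of "[]" z] s0 by (simp add: \<pi>(2))
      also have "wronsk S (rev phis @ [f]) z = wronsk S (rev phis) z * (\<Prod>j<n. q j z) * DD n f z"
        using wronsk_rev_append[of n z f] zS du by simp
      finally show ?thesis using w0 by simp
    qed
    moreover have "(\<Prod>j<n. q j z) / p n z = sg (n - 1)"
    proof -
      have "{..n - 1} = {..<n}" using n2 by auto
      then have "sg (n - 1) = (\<Prod>j<n. sgn (q j z))" unfolding sg_def by (intro prod.cong) (use q_sgn zS in auto)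
      also have "\<dots> = (\<Prod>j<n. q j z / \<bar>q j z\<bar>)" by (intro prod.cong) (auto simp: sgn_if)
      finally show ?thesis by (simp add: pp_last[OF zS] prod_dividef abs_prod)
    qed
    ultimately have "LL T x0 n phi f z / p n z = sg (n - 1) * d" using dD by (metis mult.commute times_divide_eq_right)
    then show ?thesis using L' by simp
  qed
  ultimately show ?thesis using xy(3) by (intro abs_cont_on_FTC) auto
qed

end


context scale_family
begin

abbreviation "RR \<equiv> Rr T x0 n phi"
abbreviation "I \<equiv> itg T x0 n phi"

section \<open>Asymptotic expansions and iterated integrals\<close>

lemma L_deriv_nonzero:
  assumes "1 \<le> j" "j \<le> n - Suc k" "Suc k < n"
  shows "eventually (\<lambda>x. L (Suc k) (phi j) x / p (Suc k) x \<noteq> 0) F"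
proof -
  have nz: "eventually (\<lambda>x. L (Suc k) (phi j) x \<noteq> 0) F"
  proof (cases "j = n - Suc k")
    case True
    then show ?thesis using L_const[OF assms(3)] sg_nonzero[OF assms(3)] by (intro eventually_F_I) simp
  next
    case False
    then have "filterlim (\<lambda>x. \<bar>L (Suc k) (phi j) x\<bar>) at_top F" using assms by (intro L_unbounded) auto
    then have "eventually (\<lambda>x. \<bar>L (Suc k) (phi j) x\<bar> \<ge> 1) F" by (simp add: filterlim_at_top)
    then show ?thesis by (rule eventually_mono) auto
  qed
  have pos: "eventually (\<lambda>x. p (Suc k) x > 0) F" by (intro eventually_F_I pp_pos assms)
  show ?thesis using nz pos by eventually_elim simp
qed

text \<open>One level down, j < n - k makes L_k phi_j unbounded, so the unknown constant of
  integration in G is negligible.\<close>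

lemma smallo_descend:
  assumes dG: "\<And>x. x \<in> S \<Longrightarrow> (G has_real_derivative G' x / p (Suc k) x) (at x within S)"
    and j: "1 \<le> j" "j \<le> n - Suc k" "Suc k < n" and o: "G' \<in> o[F](L (Suc k) (phi j))"
  shows "G \<in> o[F](L k (phi j))"
proof (rule lhospital_smallo[OF dG])
  have Rj: "R (n - 1) (phi j)" using j by (intro phi_R) auto
  show "(L k (phi j) has_real_derivative L (Suc k) (phi j) x / p (Suc k) x) (at x within S)" if "x \<in> S" for x
    by (rule L_deriv[OF j(3) Rj that])
  show "continuous_on S (\<lambda>x. L (Suc k) (phi j) x / p (Suc k) x)" by (rule L_continuous(2)[OF j(3) Rj])
  show "eventually (\<lambda>x. L (Suc k) (phi j) x / p (Suc k) x \<noteq> 0) F" by (rule L_deriv_nonzero[OF j])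
  show "filterlim (\<lambda>x. \<bar>L k (phi j) x\<bar>) at_top F" using j by (intro L_unbounded) auto
  show "(\<lambda>x. G' x / p (Suc k) x) \<in> o[F](\<lambda>x. L (Suc k) (phi j) x / p (Suc k) x)"
    using pp_pos[OF j(3)] by (intro landau_o.small.divide_right[OF _ o] eventually_F_I) fastforce
qed

section \<open>The constant b_1\<close>

lemma RR_continuous: "m \<le> n - 1 \<Longrightarrow> continuous_on S (RR m)"
proof (induction m)
  case (Suc m)
  then have "continuous_on S (\<lambda>s. RR m s / p (n - 1 - m) s)" by (intro divide_p_continuous) auto
  then show ?case
    using integral_has_derivative DERIV_continuous unfolding Rr.simps continuous_on_eq_continuous_within by blast
qed simp

lemma RR_deriv:
  assumes m: "Suc m \<le> n - 1" and x: "x \<in> S"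
  shows "(RR (Suc m) has_real_derivative RR m x / p (n - 1 - m) x) (at x within S)"
  unfolding Rr.simps using m RR_continuous[of m] by (intro integral_has_derivative divide_p_continuous x) auto

text \<open>Up to the sign, both functions start from the same constant and obey the same recursion
  of derivatives; they differ only by constants of integration, negligible at every level.\<close>

lemma RR_asymp:
  "m \<le> n - 1 \<Longrightarrow> (\<lambda>x. RR m x - sg (n - 1) * L (n - 1 - m) (phi 1) x) \<in> o[F](L (n - 1 - m) (phi 1))"
proof (induction m)
  case 0
  have "1 - sg (n - 1) * L (n - 1) (phi 1) x = 0" if "x \<in> S" for x
    using L_const[of "n - 1" x] sg_sq[of "n - 1"] n2 that by simp
  then show ?case by (intro landau_o.smallI eventually_F_I) simp
next
  case (Suc m)
  have k: "Suc (n - 1 - Suc m) = n - 1 - m" "Suc (n - 1 - Suc m) < n" using Suc.prems n2 by auto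
  show ?case
  proof (rule smallo_descend)
    show "((\<lambda>x. RR (Suc m) x - sg (n - 1) * L (n - 1 - Suc m) (phi 1) x) has_real_derivative
        (RR m x - sg (n - 1) * L (n - 1 - m) (phi 1) x) / p (Suc (n - 1 - Suc m)) x) (at x within S)"
      if "x \<in> S" for x
    proof -
      have "((\<lambda>x. RR (Suc m) x - sg (n - 1) * L (n - 1 - Suc m) (phi 1) x) has_real_derivative
        RR m x / p (n - 1 - m) x - sg (n - 1) * (L (Suc (n - 1 - Suc m)) (phi 1) x / p (Suc (n - 1 - Suc m)) x)) (at x within S)"
        using Suc.prems n2 k that by (intro DERIV_diff DERIV_cmult RR_deriv L_deriv phi_R) auto
      then show ?thesis unfolding k(1) by (simp add: diff_divide_distrib)
    qed
    show "(\<lambda>x. RR m x - sg (n - 1) * L (n - 1 - m) (phi 1) x) \<in> o[F](L (Suc (n - 1 - Suc m)) (phi 1))"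
      unfolding k(1) using Suc by simp
  qed (use k n2 Suc.prems in auto)
qed

text \<open>Multiplying numerator and denominator by p_0 turns phi_1 / P_(n-1) into the inverse of
  the ratio treated in \<open>RR_asymp\<close>, and a sign is its own inverse.\<close>

lemma b1_eq: "b1 T x0 n phi = sg (n - 1)"
proof -
  have s: "sg (n - 1) * sg (n - 1) = 1" "sg (n - 1) \<noteq> 0" using sg_sq[of "n - 1"] sg_nonzero[of "n - 1"] n2 by auto
  have "(\<lambda>x. RR (n - 1) x - sg (n - 1) * L 0 (phi 1) x) \<in> o[F](L 0 (phi 1))"
    using RR_asymp[of "n - 1"] by simp
  then have l0: "((\<lambda>x. (RR (n - 1) x - sg (n - 1) * L 0 (phi 1) x) / L 0 (phi 1) x) \<longlongrightarrow> 0) F"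
    by (rule smalloD_tendsto)
  have "filterlim (\<lambda>x. \<bar>L 0 (phi 1) x\<bar>) at_top F" using n2 by (intro L_unbounded) auto
  then have "eventually (\<lambda>x. \<bar>L 0 (phi 1) x\<bar> \<ge> 1) F" by (simp add: filterlim_at_top)
  then have nz: "eventually (\<lambda>x. L 0 (phi 1) x \<noteq> 0) F" by (rule eventually_mono) auto
  have "((\<lambda>x. (RR (n - 1) x - sg (n - 1) * L 0 (phi 1) x) / L 0 (phi 1) x + sg (n - 1)) \<longlongrightarrow> 0 + sg (n - 1)) F"
    by (intro tendsto_add l0 tendsto_const)
  then have "((\<lambda>x. RR (n - 1) x / L 0 (phi 1) x) \<longlongrightarrow> 0 + sg (n - 1)) F"
    by (rule Lim_transform_eventually) (rule eventually_mono[OF nz], simp add: field_simps)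
  then have "((\<lambda>x. inverse (RR (n - 1) x / L 0 (phi 1) x)) \<longlongrightarrow> inverse (sg (n - 1))) F"
    using s(2) by (intro tendsto_inverse) auto
  moreover have "inverse (sg (n - 1)) = sg (n - 1)" using s by (simp add: field_simps)
  moreover have "inverse (RR (n - 1) x / L 0 (phi 1) x) = phi 1 x / Pn1 T x0 n phi x" for x
    by (simp add: Pn1_def)
  ultimately show ?thesis unfolding b1_def by (simp add: tendsto_Lim)
qed

section \<open>Residuals of an expansion\<close>

text \<open>All i terms are kept at every level, so that differentiation maps one residual to the
  next; at levels k \<ge> n - i the surplus terms vanish identically.\<close>

definition res where "res f a i k x = L k f x - (\<Sum>j=1..i. a j * L k (phi j) x)"

lemma res_deriv:
  assumes "R (n - 1) f" "i \<le> n" "Suc k < n" "x \<in> S"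
  shows "(res f a i k has_real_derivative res f a i (Suc k) x / p (Suc k) x) (at x within S)"
proof -
  have "(res f a i k has_real_derivative L (Suc k) f x / p (Suc k) x - (\<Sum>j=1..i. a j * (L (Suc k) (phi j) x / p (Suc k) x))) (at x within S)"
    unfolding res_def using assms by (intro DERIV_diff DERIV_sum DERIV_cmult L_deriv phi_R) auto
  then show ?thesis by (simp add: res_def diff_divide_distrib sum_divide_distrib del: Lk.simps)
qed

lemma res_truncate:
  assumes "i \<le> n" "n - i \<le> k" "k < n" "x \<in> S"
  shows "res f a i k x = L k f x - (\<Sum>j=1..n - k. a j * L k (phi j) x)"
proof -
  have "(\<Sum>j=1..i. a j * L k (phi j) x) = (\<Sum>j=1..n - k. a j * L k (phi j) x)"
    by (rule sum.mono_neutral_right) (use assms L_zero[of k _ x] in auto)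
  then show ?thesis by (simp add: res_def)
qed

text \<open>At level n - i the modulus of L_(n-i) phi_i is 1, so o(1) is the claim itself; each
  lower level follows by one application of \<open>smallo_descend\<close>.\<close>

lemma res_smallo:
  assumes f: "R (n - 1) f" and i: "1 \<le> i" "i \<le> n" and lim: "(res f a i (n - i) \<longlongrightarrow> 0) F" and k: "k \<le> n - i"
  shows "res f a i k \<in> o[F](L k (phi i))"
  using k
proof (induction rule: inc_induct)
  case base
  have "res f a i (n - i) \<in> o[F](\<lambda>_. 1)" using lim by (simp add: tendsto_zero_iff_smallo)
  also have "(\<lambda>_. 1) \<in> O[F](L (n - i) (phi i))"
  proof (rule landau_o.bigI[of "1"])
    have "norm (L (n - i) (phi i) x) = 1" if "x \<in> S" for x
    proof -
      have "L (n - i) (phi i) x = sg (n - i)" using L_const[of "n - i" x] i that by simp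
      moreover have "\<bar>sg (n - i)\<bar> = 1" using sg_sq[of "n - i"] i by (auto simp: square_eq_1_iff)
      ultimately show ?thesis by simp
    qed
    then show "eventually (\<lambda>x. norm (1::real) \<le> 1 * norm (L (n - i) (phi i) x)) F" by (intro eventually_F_I) simp
  qed simp
  finally show ?case .
next
  case (step k)
  show ?case
    by (rule smallo_descend[OF res_deriv[OF f i(2)] i(1) _ _ step.IH]) (use step i in auto)
qed

definition itg_prim where
  "itg_prim f m G \<longleftrightarrow> (\<forall>x\<in>S. \<forall>y\<in>S. x \<le> y \<longrightarrow> (I f m has_integral (G y - G x)) {x..y})"

lemma itg_prim_conv: "itg_prim f m G \<Longrightarrow> s \<in> S \<Longrightarrow> imp_conv s x0 (I f m) \<longleftrightarrow> (\<exists>l. (G \<longlongrightarrow> l) F)"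
  by (rule imp_conv_iff) (auto simp: itg_prim_def)

lemma itg_prim_int: "itg_prim f m G \<Longrightarrow> s \<in> S \<Longrightarrow> (G \<longlongrightarrow> l) F \<Longrightarrow> imp_int s x0 (I f m) = l - G s"
  by (rule imp_int_eq) (auto simp: itg_prim_def)

text \<open>Integrating up to x0 a function whose primitive tends to 0 returns minus that primitive,
  whence one sign per level. No limit is assumed at level n - 1 - m itself, so the lemma can serve
  to derive that limit from convergence of the integral.\<close>

lemma itg_prim_res:
  assumes f: "R (n - 1) f" and i: "i \<le> n"
    and lim: "\<And>k. n - 1 - m < k \<Longrightarrow> k < n \<Longrightarrow> (res f a i k \<longlongrightarrow> 0) F" and m: "m < n"
  shows "itg_prim f m (\<lambda>x. (- 1) ^ m * res f a i (n - 1 - m) x)"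
  using lim m
proof (induction m)
  case 0
  show ?case unfolding itg_prim_def
  proof (intro ballI impI)
    fix x y assume xy: "x \<in> S" "y \<in> S" "x \<le> y"
    \<comment> \<open>At the top level the subtracted sum is constant, so the residual and L_(n-1) f
      have equal increments.\<close>
    have "res f a i (n - 1) z = L (n - 1) f z - (\<Sum>j=1..i. a j * (if j = 1 then sg (n - 1) else 0))" if "z \<in> S" for z
    proof -
      have "L (n - 1) (phi j) z = (if j = 1 then sg (n - 1) else 0)" if "j \<in> {1..i}" for j
        using L_zero[of "n - 1" j z] L_const[of "n - 1" z] \<open>z \<in> S\<close> that i n2 by auto
      then show ?thesis unfolding res_def by (intro arg_cong2[where f="(-)"] sum.cong refl) simp
    qed
    then have "res f a i (n - 1) y - res f a i (n - 1) x = L (n - 1) f y - L (n - 1) f x" using xy by simp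
    then show "(I f 0 has_integral (- 1) ^ 0 * res f a i (n - 1 - 0) y - (- 1) ^ 0 * res f a i (n - 1 - 0) x) {x..y}"
      using L_has_integral[OF f xy] by simp
  qed
next
  case (Suc m)
  have prev: "itg_prim f m (\<lambda>x. (- 1) ^ m * res f a i (n - 1 - m) x)" using Suc by auto
  have k: "n - 1 - m = Suc (n - 1 - Suc m)" "Suc (n - 1 - Suc m) < n" "n - Suc m = Suc (n - 1 - Suc m)"
    using Suc.prems(2) by auto
  have "((\<lambda>x. (- 1) ^ m * res f a i (n - 1 - m) x) \<longlongrightarrow> (- 1) ^ m * 0) F"
    using Suc.prems by (intro tendsto_mult tendsto_const) auto
  then have lim0: "((\<lambda>x. (- 1) ^ m * res f a i (n - 1 - m) x) \<longlongrightarrow> 0) F" by simp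
  have eq: "I f (Suc m) s = (- 1) ^ Suc m * (res f a i (n - 1 - m) s / p (n - Suc m) s)" if "s \<in> S" for s
    using itg_prim_int[OF prev that lim0] by simp
  show ?case unfolding itg_prim_def
  proof (intro ballI impI)
    fix x y assume xy: "x \<in> S" "y \<in> S" "x \<le> y"
    have "((\<lambda>s. (- 1) ^ Suc m * (res f a i (n - 1 - m) s / p (n - Suc m) s)) has_integral
        ((- 1) ^ Suc m * res f a i (n - 1 - Suc m) y - (- 1) ^ Suc m * res f a i (n - 1 - Suc m) x)) {x..y}"
      unfolding k(1,3) by (rule derivative_has_integral[OF _ xy]) (intro DERIV_cmult res_deriv f i k(2))
    then show "(I f (Suc m) has_integral
        ((- 1) ^ Suc m * res f a i (n - 1 - Suc m) y - (- 1) ^ Suc m * res f a i (n - 1 - Suc m) x)) {x..y}"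
      by (rule has_integral_eq[rotated]) (use eq S_sub[OF xy(1,2)] in auto)
  qed
qed

text \<open>Convergence of the next integral gives a limit for the residual at the next lower level.
  The new coefficient removes it, as L_k0 phi_(m+1) is a constant sign there, and leaves higher
  levels alone, where L_k phi_(m+1) = 0.\<close>

lemma iter_conv_constants:
  assumes f: "R (n - 1) f" and conv: "iter_conv T x0 n phi f i" and i: "i \<le> n" and m: "m \<le> i"
  shows "\<exists>a. \<forall>k. n - m \<le> k \<longrightarrow> k < n \<longrightarrow> (res f a m k \<longlongrightarrow> 0) F"
  using m
proof (induction m)
  case (Suc m)
  then obtain a where a: "\<And>k. n - m \<le> k \<Longrightarrow> k < n \<Longrightarrow> (res f a m k \<longlongrightarrow> 0) F" by auto
  define k0 where "k0 = n - 1 - m"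
  have k0: "k0 < n" "n - k0 = Suc m" using Suc.prems i by (auto simp: k0_def)
  have prim: "itg_prim f m (\<lambda>x. (- 1) ^ m * res f a m k0 x)"
    unfolding k0_def by (rule itg_prim_res[OF f]) (use a Suc.prems i in auto)
  have "imp_conv T x0 (I f m)"
  \<comment> \<open>\<open>iter_conv\<close> demands the inner integrals from every s in S but the
    outermost only from T; the base point T is available in both cases.\<close>
  proof (cases "Suc m = i")
    case True
    then show ?thesis using conv by (auto simp: iter_conv_def)
  next
    case False
    then show ?thesis using conv Suc.prems T_in by (simp add: iter_conv_def)
  qed
  then obtain l where l: "((\<lambda>x. (- 1) ^ m * res f a m k0 x) \<longlongrightarrow> l) F"
    using itg_prim_conv[OF prim T_in] by blast
  have "((\<lambda>x. (- 1) ^ m * ((- 1) ^ m * res f a m k0 x)) \<longlongrightarrow> (- 1) ^ m * l) F" by (intro tendsto_mult tendsto_const l)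
  moreover have "(- 1) ^ m * ((- 1) ^ m * r) = r" for r :: real by (simp flip: power_mult_distrib mult.assoc)
  ultimately have l': "(res f a m k0 \<longlongrightarrow> (- 1) ^ m * l) F" by simp
  define c where "c = (- 1) ^ m * l"
  \<comment> \<open>Since L_k0 phi_(m+1) = \<open>sg k0\<close> is its own inverse, this coefficient
    subtracts exactly the limit c.\<close>
  define a' where "a' = a(Suc m := c * sg k0)"
  have step: "res f a' (Suc m) k x = res f a m k x - c * sg k0 * L k (phi (Suc m)) x" for k x
  proof -
    have "(\<Sum>j=1..m. a' j * L k (phi j) x) = (\<Sum>j=1..m. a j * L k (phi j) x)"
      by (rule sum.cong) (auto simp: a'_def)
    then show ?thesis by (simp add: res_def a'_def)
  qed
  have "(res f a' (Suc m) k \<longlongrightarrow> 0) F" if k: "n - Suc m \<le> k" "k < n" for k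
  proof (cases "k = k0")
    case True
    have "res f a m k0 x - c = res f a' (Suc m) k x" if "x \<in> S" for x
      using L_const[OF k0(1) that] sg_sq[OF k0(1)] k0(2) unfolding step True by simp
    then have ev: "eventually (\<lambda>x. res f a m k0 x - c = res f a' (Suc m) k x) F" by (intro eventually_F_I)
    have "((\<lambda>x. res f a m k0 x - c) \<longlongrightarrow> c - c) F" using l' unfolding c_def[symmetric] by (intro tendsto_diff tendsto_const)
    then show ?thesis using ev by (simp add: Lim_transform_eventually)
  next
    case False
    then have k': "n - m \<le> k" using k by (auto simp: k0_def)
    have "res f a m k x = res f a' (Suc m) k x" if "x \<in> S" for x
      using L_zero[of k "Suc m" x] that k k' Suc.prems i unfolding step by simp
    then have ev: "eventually (\<lambda>x. res f a m k x = res f a' (Suc m) k x) F" by (intro eventually_F_I)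
    show ?thesis by (rule Lim_transform_eventually[OF a[OF k' k(2)] ev])
  qed
  then show ?case by blast
qed simp

abbreviation second_group where
  "second_group f a i \<equiv> \<forall>h\<le>i - 1. (\<lambda>x. L (n - i + h) f x - (\<Sum>j=1..i - h. a j * L (n - i + h) (phi j) x)) \<in> o[F](\<lambda>x. 1)"

lemma second_group_iff:
  assumes i: "1 \<le> i" "i \<le> n"
  shows "second_group f a i
    \<longleftrightarrow> (\<forall>k. n - i \<le> k \<longrightarrow> k < n \<longrightarrow> (res f a i k \<longlongrightarrow> 0) F)"
proof -
  have eq: "(\<lambda>x. L (n - i + h) f x - (\<Sum>j=1..i - h. a j * L (n - i + h) (phi j) x)) \<in> o[F](\<lambda>x. 1)
      \<longleftrightarrow> (res f a i (n - i + h) \<longlongrightarrow> 0) F" if h: "h \<le> i - 1" for h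
  proof -
    have "n - (n - i + h) = i - h" using h i by simp
    then have "eventually (\<lambda>x. L (n - i + h) f x - (\<Sum>j=1..i - h. a j * L (n - i + h) (phi j) x) = res f a i (n - i + h) x) F"
      using res_truncate[of i "n - i + h" _ f a] h i by (intro eventually_F_I) simp
    then show ?thesis unfolding tendsto_zero_iff_smallo by (rule landau_o.small.in_cong)
  qed
  show ?thesis
  proof
    assume l: "second_group f a i"
    show "\<forall>k. n - i \<le> k \<longrightarrow> k < n \<longrightarrow> (res f a i k \<longlongrightarrow> 0) F"
    proof (intro allI impI)
      fix k assume "n - i \<le> k" "k < n"
      then have "k - (n - i) \<le> i - 1" "n - i + (k - (n - i)) = k" using i by auto
      then show "(res f a i k \<longlongrightarrow> 0) F" using eq[of "k - (n - i)"] l by auto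
    qed
  next
    assume r: "\<forall>k. n - i \<le> k \<longrightarrow> k < n \<longrightarrow> (res f a i k \<longlongrightarrow> 0) F"
    show "second_group f a i"
    proof (intro allI impI)
      fix h assume h: "h \<le> i - 1"
      then have "n - i + h < n" using i by auto
      then show "(\<lambda>x. L (n - i + h) f x - (\<Sum>j=1..i - h. a j * L (n - i + h) (phi j) x)) \<in> o[F](\<lambda>x. 1)"
        using eq[OF h] r by simp
    qed
  qed
qed

lemma residual_vanishes_iff_iter_conv:
  assumes f: "R (n - 1) f" and i: "1 \<le> i" "i \<le> n"
  shows "(\<exists>a. \<forall>k. n - i \<le> k \<longrightarrow> k < n \<longrightarrow> (res f a i k \<longlongrightarrow> 0) F) \<longleftrightarrow> iter_conv T x0 n phi f i"
proof
  assume "\<exists>a. \<forall>k. n - i \<le> k \<longrightarrow> k < n \<longrightarrow> (res f a i k \<longlongrightarrow> 0) F"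
  then obtain a where a: "\<And>k. n - i \<le> k \<Longrightarrow> k < n \<Longrightarrow> (res f a i k \<longlongrightarrow> 0) F" by blast
  have conv: "imp_conv s x0 (I f m)" if "m < i" "s \<in> S" for m s
  proof -
    have "itg_prim f m (\<lambda>x. (- 1) ^ m * res f a i (n - 1 - m) x)"
      using a that i by (intro itg_prim_res f) auto
    moreover have "((\<lambda>x. (- 1) ^ m * res f a i (n - 1 - m) x) \<longlongrightarrow> (- 1) ^ m * 0) F"
      using a that i by (intro tendsto_mult tendsto_const) auto
    ultimately show ?thesis using itg_prim_conv[OF _ that(2)] by blast
  qed
  show "iter_conv T x0 n phi f i"
    unfolding iter_conv_def using conv T_in i by auto
next
  assume "iter_conv T x0 n phi f i"
  from iter_conv_constants[OF f this i(2) order_refl]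
  show "\<exists>a. \<forall>k. n - i \<le> k \<longrightarrow> k < n \<longrightarrow> (res f a i k \<longlongrightarrow> 0) F" .
qed

text \<open>The limit 0 at level n - i fixes the constant of integration; the last integration
  supplies the remaining sign.\<close>

lemma residual_eq_integral:
  assumes f: "R (n - 1) f" and i: "1 \<le> i" "i \<le> n" and x: "x \<in> S"
    and a: "\<And>k. n - i \<le> k \<Longrightarrow> k < n \<Longrightarrow> (res f a i k \<longlongrightarrow> 0) F"
  shows "res f a i (n - i) x = (- 1) ^ i * imp_int x x0 (I f (i - 1))"
proof -
  obtain m where m: "i = Suc m" using i by (cases i) auto
  have "itg_prim f m (\<lambda>x. (- 1) ^ m * res f a i (n - 1 - m) x)"
    using a m i by (intro itg_prim_res f) auto
  moreover have "((\<lambda>x. (- 1) ^ m * res f a i (n - 1 - m) x) \<longlongrightarrow> (- 1) ^ m * 0) F"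
    using a m i by (intro tendsto_mult tendsto_const) auto
  ultimately have "imp_int x x0 (I f m) = (- 1) ^ m * 0 - (- 1) ^ m * res f a i (n - 1 - m) x"
    by (rule itg_prim_int[OF _ x])
  moreover have "(- 1) ^ m * ((- 1) ^ m * r) = r" for r :: real by (simp flip: power_mult_distrib mult.assoc)
  ultimately show ?thesis by (simp add: m)
qed

text \<open>Since b_1 is the constant value of L_(n-1) phi_1, the relation is the case i = 1 of
  vanishing residuals, in which n - 1 is the only level.\<close>

lemma first_relation_iff:
  assumes f: "R (n - 1) f"
  shows "(\<lambda>x. L (n - 1) f x - a * b1 T x0 n phi) \<in> o[F](\<lambda>x. 1)
    \<longleftrightarrow> (\<forall>k. n - 1 \<le> k \<longrightarrow> k < n \<longrightarrow> (res f (\<lambda>_. a) 1 k \<longlongrightarrow> 0) F)"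
proof -
  have "eventually (\<lambda>x. L (n - 1) f x - a * b1 T x0 n phi = res f (\<lambda>_. a) 1 (n - 1) x) F"
    using L_const[of "n - 1"] n2 by (intro eventually_F_I) (simp add: res_def b1_eq)
  then have "(\<lambda>x. L (n - 1) f x - a * b1 T x0 n phi) \<in> o[F](\<lambda>x. 1) \<longleftrightarrow> (res f (\<lambda>_. a) 1 (n - 1) \<longlongrightarrow> 0) F"
    unfolding tendsto_zero_iff_smallo by (rule landau_o.small.in_cong)
  moreover have "(\<forall>k. n - 1 \<le> k \<longrightarrow> k < n \<longrightarrow> Q k) \<longleftrightarrow> Q (n - 1)" for Q
  proof -
    have "k = n - 1" if "n - 1 \<le> k" "k < n" for k using that by simp
    moreover have "n - 1 \<le> n - 1" "n - 1 < n" using n2 by simp_all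
    ultimately show ?thesis by metis
  qed
  ultimately show ?thesis by simp
qed

end

theorem theorem4p4:
  fixes T :: real and x0 :: ereal and n :: nat
    and phi :: "nat \<Rightarrow> real \<Rightarrow> real" and f :: "real \<Rightarrow> real"
  assumes "ereal T < x0" and "n \<ge> 2"
    and "cheb_scale T x0 n phi"
    and "\<forall>i\<in>{1..n}. ACk (Ivl T x0) (n - 1) (phi i)"
    and "ACk (Ivl T x0) (n - 1) f"
  shows
    "(\<forall>a1::real.
        (\<forall>k\<le>n - 1. (\<lambda>x. Lk T x0 n phi k f x - a1 * Lk T x0 n phi k (phi 1) x)
                      \<in> o[lnbhd x0](Lk T x0 n phi k (phi 1)))
        \<longleftrightarrow> (\<lambda>x. Lk T x0 n phi (n - 1) f x - a1 * b1 T x0 n phi) \<in> o[lnbhd x0](\<lambda>x. 1))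
     \<and> ((\<exists>a1::real. (\<lambda>x. Lk T x0 n phi (n - 1) f x - a1 * b1 T x0 n phi) \<in> o[lnbhd x0](\<lambda>x. 1))
        \<longleftrightarrow> imp_conv T x0 (\<lambda>t. LL T x0 n phi f t / pp T x0 n phi n t))
     \<and> (\<forall>a1::real. (\<lambda>x. Lk T x0 n phi (n - 1) f x - a1 * b1 T x0 n phi) \<in> o[lnbhd x0](\<lambda>x. 1)
        \<longrightarrow> (\<forall>x\<in>Ivl T x0. Lk T x0 n phi (n - 1) f x
               = a1 * b1 T x0 n phi - imp_int x x0 (\<lambda>t. LL T x0 n phi f t / pp T x0 n phi n t)))
     \<and> (\<forall>i\<in>{2..n}.
        (\<forall>a::nat \<Rightarrow> real.
           ((\<forall>k\<le>n - i. (\<lambda>x. Lk T x0 n phi k f x - (\<Sum>j=1..i. a j * Lk T x0 n phi k (phi j) x))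
                           \<in> o[lnbhd x0](Lk T x0 n phi k (phi i)))
            \<and> (\<forall>h\<le>i - 1. (\<lambda>x. Lk T x0 n phi (n - i + h) f x
                     - (\<Sum>j=1..i - h. a j * Lk T x0 n phi (n - i + h) (phi j) x)) \<in> o[lnbhd x0](\<lambda>x. 1)))
           \<longleftrightarrow> (\<forall>h\<le>i - 1. (\<lambda>x. Lk T x0 n phi (n - i + h) f x
                     - (\<Sum>j=1..i - h. a j * Lk T x0 n phi (n - i + h) (phi j) x)) \<in> o[lnbhd x0](\<lambda>x. 1)))
        \<and> ((\<exists>a::nat \<Rightarrow> real. \<forall>h\<le>i - 1. (\<lambda>x. Lk T x0 n phi (n - i + h) f x
                     - (\<Sum>j=1..i - h. a j * Lk T x0 n phi (n - i + h) (phi j) x)) \<in> o[lnbhd x0](\<lambda>x. 1))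
           \<longleftrightarrow> iter_conv T x0 n phi f i)
        \<and> (\<forall>a::nat \<Rightarrow> real. (\<forall>h\<le>i - 1. (\<lambda>x. Lk T x0 n phi (n - i + h) f x
                     - (\<Sum>j=1..i - h. a j * Lk T x0 n phi (n - i + h) (phi j) x)) \<in> o[lnbhd x0](\<lambda>x. 1))
           \<longrightarrow> (\<forall>x\<in>Ivl T x0. Lk T x0 n phi (n - i) f x
                  = (\<Sum>j=1..i. a j * Lk T x0 n phi (n - i) (phi j) x)
                    + (-1) ^ i * imp_int x x0 (itg T x0 n phi f (i - 1)))))"
proof -
  interpret half_open T x0 by unfold_locales fact
  interpret scale_family T x0 n phi by unfold_locales (use assms in auto)
  have f: "R (n - 1) f" using assms(5) by (simp add: ACk_iff_R)
  have one: "1 \<le> n" using n2 by simp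
  have itg0: "I f 0 = (\<lambda>t. LL T x0 n phi f t / p n t)" by simp
  have res1: "res f (\<lambda>_. a1) 1 k = (\<lambda>x. L k f x - a1 * L k (phi 1) x)" for a1 k by (simp add: res_def[abs_def])
  \<comment> \<open>For i = 1 a coefficient sequence enters only through its first member, which
    lets one real constant stand for the sequence.\<close>
  have res_cong1: "res f a 1 k = res f (\<lambda>_. a 1) 1 k" for a k by (simp add: res_def[abs_def])
  have I1: "(\<forall>k\<le>n - 1. (\<lambda>x. L k f x - a1 * L k (phi 1) x) \<in> o[F](L k (phi 1)))
      \<longleftrightarrow> (\<lambda>x. L (n - 1) f x - a1 * b1 T x0 n phi) \<in> o[F](\<lambda>x. 1)" (is "?A \<longleftrightarrow> ?B") for a1
  proof
    assume ?A
    then have "(\<lambda>x. L (n - 1) f x - a1 * L (n - 1) (phi 1) x) \<in> o[F](L (n - 1) (phi 1))" by blast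
    \<comment> \<open>At the top level the comparison function is a nonzero constant, so smallness
      relative to it is o(1).\<close>
    moreover have "o[F](L (n - 1) (phi 1)) = o[F](\<lambda>_. sg (n - 1))"
      using L_const[of "n - 1"] n2 by (intro landau_o.small.cong eventually_F_I) simp
    ultimately have "(\<lambda>x. L (n - 1) f x - a1 * L (n - 1) (phi 1) x) \<in> o[F](\<lambda>_. sg (n - 1))"
      by (simp only:)
    moreover have "o[F](\<lambda>_. sg (n - 1)) = o[F](\<lambda>_. 1)"
      using sg_nonzero[of "n - 1"] n2 by (intro landau_o.small.const) simp
    ultimately have "(res f (\<lambda>_. a1) 1 (n - 1) \<longlongrightarrow> 0) F"
      unfolding res1 tendsto_zero_iff_smallo by (simp only:)
    moreover have "k = n - 1" if "n - 1 \<le> k" "k < n" for k using that by simp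
    ultimately show ?B unfolding first_relation_iff[OF f] by blast
  next
    assume ?B
    then have "(res f (\<lambda>_. a1) 1 (n - 1) \<longlongrightarrow> 0) F" unfolding first_relation_iff[OF f] using n2 by simp
    then show ?A using res_smallo[OF f order_refl one, where a="\<lambda>_. a1"] unfolding res1 by blast
  qed
  have I2: "(\<exists>a1. (\<lambda>x. L (n - 1) f x - a1 * b1 T x0 n phi) \<in> o[F](\<lambda>x. 1))
      \<longleftrightarrow> imp_conv T x0 (\<lambda>t. LL T x0 n phi f t / p n t)"
  proof -
    have "(\<exists>a1. (\<lambda>x. L (n - 1) f x - a1 * b1 T x0 n phi) \<in> o[F](\<lambda>x. 1))
        \<longleftrightarrow> (\<exists>a. \<forall>k. n - 1 \<le> k \<longrightarrow> k < n \<longrightarrow> (res f a 1 k \<longlongrightarrow> 0) F)"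
      unfolding first_relation_iff[OF f]
    proof
      assume "\<exists>a. \<forall>k. n - 1 \<le> k \<longrightarrow> k < n \<longrightarrow> (res f a 1 k \<longlongrightarrow> 0) F"
      then obtain a where a: "\<forall>k. n - 1 \<le> k \<longrightarrow> k < n \<longrightarrow> (res f a 1 k \<longlongrightarrow> 0) F" by blast
      have "\<forall>k. n - 1 \<le> k \<longrightarrow> k < n \<longrightarrow> (res f (\<lambda>_. a 1) 1 k \<longlongrightarrow> 0) F"
        using a by (simp only: res_cong1[of a])
      then show "\<exists>a1. \<forall>k. n - 1 \<le> k \<longrightarrow> k < n \<longrightarrow> (res f (\<lambda>_. a1) 1 k \<longlongrightarrow> 0) F" by blast
    qed blast
    also have "\<dots> \<longleftrightarrow> iter_conv T x0 n phi f 1" by (rule residual_vanishes_iff_iter_conv[OF f order_refl one])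
    finally show ?thesis by (simp add: iter_conv_def)
  qed
  have I3: "L (n - 1) f x = a1 * b1 T x0 n phi - imp_int x x0 (\<lambda>t. LL T x0 n phi f t / p n t)"
    if "(\<lambda>x. L (n - 1) f x - a1 * b1 T x0 n phi) \<in> o[F](\<lambda>x. 1)" "x \<in> S" for a1 x
  proof -
    have "res f (\<lambda>_. a1) 1 (n - 1) x = (- 1) ^ 1 * imp_int x x0 (I f (1 - 1))"
      by (rule residual_eq_integral[OF f order_refl one that(2)]) (use that(1) first_relation_iff[OF f] in blast)
    moreover have "L (n - 1) (phi 1) x = b1 T x0 n phi" using L_const[of "n - 1" x] n2 that(2) by (simp add: b1_eq)
    ultimately show ?thesis unfolding res1 by simp
  qed
  have II1: "((\<forall>k\<le>n - i. (\<lambda>x. L k f x - (\<Sum>j=1..i. a j * L k (phi j) x)) \<in> o[F](L k (phi i)))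
       \<and> second_group f a i)
      \<longleftrightarrow> second_group f a i"
    if i: "i \<in> {2..n}" for i a
  proof -
    have i': "1 \<le> i" "i \<le> n" using i by auto
    have "(\<lambda>x. L k f x - (\<Sum>j=1..i. a j * L k (phi j) x)) \<in> o[F](L k (phi i))"
      if "second_group f a i" "k \<le> n - i" for k
      using res_smallo[OF f i' _ that(2), of a] that(1) i' unfolding second_group_iff[OF i'] res_def[abs_def] by simp
    then show ?thesis by blast
  qed
  have II2: "(\<exists>a. second_group f a i)
      \<longleftrightarrow> iter_conv T x0 n phi f i" if i: "i \<in> {2..n}" for i
  proof -
    have i': "1 \<le> i" "i \<le> n" using i by auto
    show ?thesis unfolding second_group_iff[OF i'] by (rule residual_vanishes_iff_iter_conv[OF f i'])
  qed
  have II3: "L (n - i) f x = (\<Sum>j=1..i. a j * L (n - i) (phi j) x) + (-1) ^ i * imp_int x x0 (I f (i - 1))"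
    if i: "i \<in> {2..n}" and x: "x \<in> S"
      and a: "second_group f a i" for i a x
  proof -
    have i': "1 \<le> i" "i \<le> n" using i by auto
    have "res f a i (n - i) x = (- 1) ^ i * imp_int x x0 (I f (i - 1))"
      by (rule residual_eq_integral[OF f i' x]) (use a[unfolded second_group_iff[OF i']] in blast)
    then show ?thesis by (simp add: res_def)
  qed
  show ?thesis
    apply (intro conjI ballI)
    subgoal by (intro allI I1)
    subgoal by (rule I2)
    subgoal by (intro allI impI ballI) (rule I3)
    subgoal by (intro allI) (erule II1)
    subgoal by (erule II2)
    subgoal by (intro allI impI ballI) (rule II3)
    done
qed

end
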